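(* For every fixed integer $r \ge 2$ and every $\varepsilon > 0$ there exists $d_0 = d_0(r,\varepsilon)$ such that for every fixed integer $d \ge d_0$, with probability tending to $1$ as $n \to \infty$ (over $n$ with $r \mid nd$), the random $r$-uniform $d$-regular hypergraph $\mathcal{H}_r(n,d)$ on $n$ vertices satisfies \[ \left| \frac{\chi(\mathcal{H}_r(n,d)) - \left(\frac{(r-1)d}{r\log d}\right)^{\frac{1}{r-1}}}{\left(\frac{(r-1)d}{r\log d}\right)^{\frac{1}{r-1}}} \right| \le \varepsilon \qquad\text{and}\qquad \left| \frac{\alpha(\mathcal{H}_r(n,d)) - \left(\frac{r\log d}{(r-1)d}\right)^{\frac{1}{r-1}} n}{\left(\frac{r\log d}{(r-1)d}\right)^{\frac{1}{r-1}} n} \right| \le \varepsilon . \]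
   Context: $\mathcal{H}_r(n,d)$ denotes a hypergraph chosen uniformly at random from all $r$-uniform hypergraphs on vertex set $\{1,\dots,n\}$ in which every vertex lies in exactly $d$ edges (edges are $r$-element sets of vertices). A vertex coloring of a hypergraph is proper if no edge has all its vertices of the same color; $\chi(H)$ is the minimum number of colors in a proper coloring of $H$. A set of vertices is independent if it contains no edge, and $\alpha(H)$ is the maximum size of an independent set in $H$. $\log$ is the natural logarithm. *)

theory Defs
  imports Complex_Main
begin

definition reg_unif_hypergraphs :: "nat \<Rightarrow> nat \<Rightarrow> nat \<Rightarrow> nat set set set" where
  "reg_unif_hypergraphs r d n =
     {H. (\<forall>e\<in>H. e \<subseteq> {1..n} \<and> card e = r) \<and>
         (\<forall>v\<in>{1..n}. card {e\<in>H. v \<in> e} = d)}"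

definition proper_coloring :: "nat set \<Rightarrow> nat set set \<Rightarrow> nat \<Rightarrow> (nat \<Rightarrow> nat) \<Rightarrow> bool" where
  "proper_coloring V H k f \<longleftrightarrow>
     (\<forall>v\<in>V. f v < k) \<and> (\<forall>e\<in>H. \<not> (\<exists>c. \<forall>v\<in>e. f v = c))"

definition chromatic_number :: "nat set \<Rightarrow> nat set set \<Rightarrow> nat" where
  "chromatic_number V H = (LEAST k. \<exists>f. proper_coloring V H k f)"

definition independent_set :: "nat set \<Rightarrow> nat set set \<Rightarrow> nat set \<Rightarrow> bool" where
  "independent_set V H S \<longleftrightarrow> S \<subseteq> V \<and> (\<forall>e\<in>H. \<not> e \<subseteq> S)"

definition independence_number :: "nat set \<Rightarrow> nat set set \<Rightarrow> nat" where
  "independence_number V H = Max {card S | S. independent_set V H S}"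

definition hprob :: "nat \<Rightarrow> nat \<Rightarrow> nat \<Rightarrow> (nat set set \<Rightarrow> bool) \<Rightarrow> real" where
  "hprob r d n P =
     real (card {H \<in> reg_unif_hypergraphs r d n. P H}) / real (card (reg_unif_hypergraphs r d n))"

end

theory Submission
  imports Defs "HOL-Combinatorics.Permutations" "HOL-Library.FuncSet" "HOL-Analysis.Convex"
    "HOL-Real_Asymp.Real_Asymp"
begin

text \<open>Work in the configuration model: a uniformly random permutation assigns the \<open>n * d\<close> points
  (\<open>d\<close> per vertex) to the positions of \<open>m = n * d / r\<close> blocks of size \<open>r\<close>. A switching argument shows
  that all blocks are distinct \<open>r\<close>-sets with probability bounded away from 0, and every regular
  hypergraph arises from equally many permutations, so whp statements transfer.

  If the vertices are given labels with frequencies \<open>p\<close>, then up to polynomial factors the blocks behave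
  like independent \<open>p\<close>-random words. The first moment method thus bounds \<open>\<alpha>\<close> from above.
  For \<open>\<chi>\<close>, count nearly balanced proper \<open>k\<close>-colourings with \<open>k\<close> slightly above the claimed value. A pair of
  colourings with overlap matrix \<open>p\<close> contributes to the second moment, relative to the square of the first,
  about \<open>exp (n * (H(p) - 2 * ln k + (d / r) * (\<Sum> p^r - k^(2 - 2 * r))))\<close>, and this exponent is at most 0 entry by entry:
  with \<open>y = k^2 * p\<close> it is a sum of terms \<open>c * (y^r - 1 - r * (y - 1)) - (y * ln y - y + 1)\<close>
  over \<open>0 \<le> y \<le> k\<close>. Hence a proper \<open>k\<close>-colouring exists with at least inverse polynomial probability. The least number of
  monochromatic blocks is Lipschitz under transpositions, so by concentration it is whp at most
  a tiny multiple of \<open>n\<close>; one vertex from each of these blocks forms a small set, which spans few edges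
  and is coloured with \<open>2 * r\<close> new colours. Finally \<open>n \<le> \<chi> * \<alpha>\<close> turns the two upper
  bounds into the two lower bounds.\<close>

section \<open>Words of given type and random permutations\<close>

text \<open>Both claimed values have one origin. The expected number
  \<open>k ^ n * (1 - k powr (1 - r)) powr (n * d / r)\<close> of proper colourings and the expected
  number of independent sets of size \<open>n / k\<close> both turn from exponentially small to
  exponentially large where, to leading order, \<open>k ^ (r - 1) * ln k = d / r\<close>. With
  \<open>ln k\<close> about \<open>ln d / (r - 1)\<close> this reads
  \<open>k ^ (r - 1) = (r - 1) * d / (r * ln d)\<close>. The delicate pairs in the second moment are
  nearly equal colourings, where \<open>y\<close> is close to \<open>k\<close>. There the entrywise
  inequality asks for \<open>(d / r) * k powr (1 - r) \<le> ln k\<close> up to lower order terms,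
  which is the first moment condition again, and \<epsilon> pays for these terms. Of the constraints
  on the overlap matrix only the total mass and the bound of about \<open>1 / k\<close> on each
  entry enter. As \<open>k\<close> need not divide \<open>n\<close>, classes are only nearly
  balanced, whence the range \<open>(1 + \<eta>) * k\<close> for \<open>y\<close>. All counts lose
  powers of \<open>n\<close>, so the second moment alone cannot give high probability; concentration
  wins a factor \<open>exp (- c * n)\<close>, which absorbs any such loss.\<close>

definition words :: "'a set \<Rightarrow> 'c set \<Rightarrow> ('c \<Rightarrow> nat) \<Rightarrow> ('a \<Rightarrow> 'c) set" where
  "words A C t = {f \<in> A \<rightarrow>\<^sub>E C. \<forall>c\<in>C. card {x \<in> A. f x = c} = t c}"

definition perm_prob :: "'a set \<Rightarrow> (('a \<Rightarrow> 'a) \<Rightarrow> bool) \<Rightarrow> real" where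
  "perm_prob S Q = real (card {p. p permutes S \<and> Q p}) / fact (card S)"

lemma finite_perms_where: "finite S \<Longrightarrow> finite {p. p permutes S \<and> Q p}"
  by (rule finite_subset[OF _ finite_permutations[of S]]) auto

lemma perm_prob_nonneg: "0 \<le> perm_prob S Q"
  by (simp add: perm_prob_def)

lemma perm_prob_mono:
  assumes "finite S" "\<And>p. p permutes S \<Longrightarrow> Q p \<Longrightarrow> R p"
  shows "perm_prob S Q \<le> perm_prob S R"
  unfolding perm_prob_def using assms
  by (intro divide_right_mono of_nat_mono card_mono finite_perms_where) auto

lemma perm_prob_cong:
  assumes "\<And>p. p permutes S \<Longrightarrow> Q p = R p"
  shows "perm_prob S Q = perm_prob S R"
proof -
  have "{p. p permutes S \<and> Q p} = {p. p permutes S \<and> R p}" using assms by blast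
  then show ?thesis by (simp add: perm_prob_def)
qed

lemma perm_prob_disj:
  assumes "finite S"
  shows "perm_prob S (\<lambda>p. Q p \<or> R p) \<le> perm_prob S Q + perm_prob S R"
proof -
  have "{p. p permutes S \<and> (Q p \<or> R p)} = {p. p permutes S \<and> Q p} \<union> {p. p permutes S \<and> R p}"
    by auto
  then show ?thesis
    unfolding perm_prob_def add_divide_distrib[symmetric]
    by (intro divide_right_mono) (auto simp flip: of_nat_add intro: card_Un_le)
qed

lemma perm_prob_Bex:
  assumes "finite S" "finite I"
  shows "perm_prob S (\<lambda>p. \<exists>i\<in>I. Q i p) \<le> (\<Sum>i\<in>I. perm_prob S (Q i))"
  using assms(2)
proof (induction I rule: finite_induct)
  case empty
  then show ?case by (simp add: perm_prob_def)
next
  case (insert i I)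
  have "perm_prob S (\<lambda>p. \<exists>i\<in>insert i I. Q i p) \<le> perm_prob S (Q i) + perm_prob S (\<lambda>p. \<exists>i\<in>I. Q i p)"
    using perm_prob_disj[OF assms(1), of "Q i" "\<lambda>p. \<exists>i\<in>I. Q i p"] by simp
  with insert show ?case by simp
qed

lemma words_finite: "finite A \<Longrightarrow> finite C \<Longrightarrow> finite (words A C t)"
  unfolding words_def by (rule finite_subset[of _ "A \<rightarrow>\<^sub>E C"]) (auto intro: finite_PiE)

lemma ex_word:
  assumes "finite C" "finite A" "sum t C = card A"
  shows "\<exists>f. f \<in> words A C t"
  using assms
proof (induction C arbitrary: A rule: finite_induct)
  case empty
  then show ?case by (auto simp: words_def)
next
  case (insert c C)
  then have "t c \<le> card A" by simp
  then obtain X where X: "X \<subseteq> A" "card X = t c" "finite X"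
    by (metis obtain_subset_with_card_n)
  have "card (A - X) = sum t C"
    using insert X by (simp add: card_Diff_subset)
  then obtain f where f: "f \<in> words (A - X) C t"
    using insert by (metis finite_Diff)
  let ?g = "\<lambda>x. if x \<in> X then c else f x"
  have 1: "{x \<in> A. ?g x = c} = X"
    using X f insert by (auto simp: words_def PiE_def Pi_def)
  have 2: "{x \<in> A. ?g x = c'} = {x \<in> A - X. f x = c'}" if "c' \<in> C" for c'
    using that insert by auto
  have "?g \<in> words A (insert c C) t"
    using f X 1 2 unfolding words_def by (auto simp: PiE_def Pi_def extensional_def)
  then show ?case by blast
qed

section \<open>Stirling bounds with polynomial loss\<close>

lemma fact_ge_pow: "(real N / exp 1) ^ N \<le> fact N"
proof -
  have "real N ^ N / fact N \<le> exp (real N)"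
  proof -
    have "(\<Sum>i\<in>{N}. real N ^ i /\<^sub>R fact i) \<le> exp (real N)"
      unfolding exp_def by (rule sum_le_suminf) (use summable_exp_generic[of "real N"] in auto)
    then show ?thesis by (simp add: field_simps)
  qed
  then have "real N ^ N \<le> fact N * exp (real N)"
    by (simp add: field_simps)
  moreover have "exp (real N) = exp 1 ^ N"
    by (simp add: exp_of_nat_mult[symmetric])
  ultimately show ?thesis by (simp add: power_divide field_simps)
qed

text \<open>The induction rests on \<open>(1 + 1 / t) ^ (t + 1) \<ge> exp 1\<close> and proves the
  bound with factor \<open>t\<close> for \<open>t \<ge> 1\<close>; the factor \<open>t + 1\<close>
  lets the statement hold at \<open>t = 0\<close> too.\<close>

lemma fact_le_pow: "fact t \<le> exp 1 * (real t + 1) * (real t / exp 1) ^ t"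
proof (cases "t = 0")
  case True
  then show ?thesis by simp
next
  case False
  then have "1 \<le> t" by simp
  then have "fact t \<le> exp 1 * real t * (real t / exp 1) ^ t"
  proof (induction t rule: dec_induct)
    case base
    then show ?case by simp
  next
    case (step t)
    have t: "real t > 0" using step by simp
    have "- ln (real t / (real t + 1)) \<ge> 1 / (real t + 1)"
      using ln_le_minus_one[of "real t / (real t + 1)"] t by (simp add: field_simps)
    then have "ln ((real t + 1) / real t) \<ge> 1 / (real t + 1)"
      using t by (simp add: ln_div)
    then have "(real t + 1) * ln ((real t + 1) / real t) \<ge> 1"
      using t by (simp add: field_simps)
    then have "exp 1 \<le> exp ((real t + 1) * ln ((real t + 1) / real t))" by simp
    also have "\<dots> = ((real t + 1) / real t) ^ (Suc t)"
      using t by (simp add: exp_of_nat_mult[of "Suc t", simplified] add.commute)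
    finally have "exp 1 * real t ^ Suc t \<le> (real t + 1) ^ Suc t"
      using t by (simp add: power_divide field_simps del: power_Suc)
    then have "real t * (real t / exp 1) ^ t \<le> ((real t + 1) / exp 1) ^ Suc t"
      by (simp add: power_divide field_simps)
    have "fact (Suc t) = (real t + 1) * fact t" by (simp add: algebra_simps)
    also have "\<dots> \<le> (real t + 1) * (exp 1 * real t * (real t / exp 1) ^ t)"
      using step t by (intro mult_left_mono) auto
    also have "\<dots> = exp 1 * (real t + 1) * (real t * (real t / exp 1) ^ t)" by simp
    also have "\<dots> \<le> exp 1 * (real t + 1) * ((real t + 1) / exp 1) ^ Suc t"
      using \<open>real t * _ \<le> _\<close> t by (intro mult_left_mono) auto
    finally show ?case by (simp add: add.commute)
  qed
  also have "\<dots> \<le> exp 1 * (real t + 1) * (real t / exp 1) ^ t"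
    by (intro mult_right_mono mult_left_mono) auto
  finally show ?thesis .
qed

lemma card_inj_funcset_eq:
  assumes "finite A" "finite B" "card A = card B"
  shows "card {h \<in> A \<rightarrow>\<^sub>E B. inj_on h A} = fact (card B)"
proof -
  have "card {h \<in> A \<rightarrow>\<^sub>E B. inj_on h A} = prod ((-) (card B)) {0..<card A}"
    using card_inj_on_subset_funcset[OF assms(1,2) order.refl] by simp
  also have "\<dots> = prod Suc {0..<card B}"
    unfolding assms(3) by (rule prod.reindex_bij_witness[of _ "\<lambda>i. card B - Suc i" "\<lambda>i. card B - Suc i"]) auto
  also have "\<dots> = fact (card B)" by (simp add: fact_prod_Suc)
  finally show ?thesis .
qed

text \<open>Feeds \<open>image_mset_eq_implies_permutes\<close>, which turns equal letter counts
  into a permutation of the positions.\<close>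

lemma image_mset_eqI_word:
  assumes "finite A" "finite C" "f \<in> A \<rightarrow> C" "g \<in> A \<rightarrow> C"
    and "\<And>c. c \<in> C \<Longrightarrow> card {x \<in> A. f x = c} = card {x \<in> A. g x = c}"
  shows "image_mset f (mset_set A) = image_mset g (mset_set A)"
proof (rule multiset_eqI)
  fix c
  have *: "count (image_mset f (mset_set A)) c = card {x \<in> A. f x = c}" for f :: "'a \<Rightarrow> 'b"
    using assms(1) by (auto simp: count_image_mset vimage_def Int_def conj_commute intro!: arg_cong[where f=card])
  show "count (image_mset f (mset_set A)) c = count (image_mset g (mset_set A)) c"
  proof (cases "c \<in> C")
    case True
    then show ?thesis using * assms by simp
  next
    case False
    then have "{x \<in> A. f x = c} = {}" "{x \<in> A. g x = c} = {}" using assms by auto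
    then show ?thesis using * by (metis)
  qed
qed

text \<open>All words of a given type have equally many preimages under \<open>p \<mapsto> g \<circ> p\<close>, because
  permuting positions acts transitively on them.\<close>

lemma word_fibre:
  fixes g :: "'a \<Rightarrow> 'c"
  assumes S: "finite S" and C: "finite C" and g: "g \<in> S \<rightarrow> C"
    and t: "\<And>c. c \<in> C \<Longrightarrow> card {x \<in> S. g x = c} = t c"
  shows "\<exists>D>0. D \<le> (\<Prod>c\<in>C. fact (t c)) \<and>
    (\<forall>M\<subseteq>words S C t. card {p. p permutes S \<and> restrict (g \<circ> p) S \<in> M} = D * card M)"
proof -
  define fib where "fib f = {p. p permutes S \<and> restrict (g \<circ> p) S = f}" for f
  define f0 where "f0 = restrict g S"
  have f0: "f0 \<in> words S C t"
    using g t unfolding words_def f0_def by (auto cong: conj_cong)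
  have fin: "finite (fib f)" for f
    unfolding fib_def using S by (rule finite_perms_where)
  have eq: "card (fib f) = card (fib f0)" if f: "f \<in> words S C t" for f
  proof -
    have "image_mset f (mset_set S) = image_mset f0 (mset_set S)"
      using f f0 by (intro image_mset_eqI_word[OF S C]) (auto simp: words_def)
    then obtain q where q: "q permutes S" "\<forall>x\<in>S. f x = f0 (q x)"
      using image_mset_eq_implies_permutes[OF S] by metis
    have iq: "inv q permutes S" using q permutes_inv by blast
    have fe: "f \<in> extensional S" "f0 \<in> extensional S" using f f0 by (auto simp: words_def PiE_def)
    have val: "p \<in> fib h \<longleftrightarrow> p permutes S \<and> (\<forall>x\<in>S. g (p x) = h x)" if "h \<in> extensional S" for p h
      using that unfolding fib_def by (auto simp: fun_eq_iff extensional_def)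
    have "bij_betw (\<lambda>p. p \<circ> q) (fib f0) (fib f)"
    proof (rule bij_betw_byWitness[where f' = "\<lambda>p. p \<circ> inv q"])
      show "\<forall>p\<in>fib f0. p \<circ> q \<circ> inv q = p"
        using q by (auto simp: o_assoc[symmetric] permutes_inv_o)
      show "\<forall>p\<in>fib f. p \<circ> inv q \<circ> q = p"
        using q by (auto simp: o_assoc[symmetric] permutes_inv_o)
      show "(\<lambda>p. p \<circ> q) ` fib f0 \<subseteq> fib f"
        using q by (auto simp: val fe permutes_compose permutes_in_image)
      show "(\<lambda>p. p \<circ> inv q) ` fib f \<subseteq> fib f0"
        using q iq by (auto simp: val fe permutes_compose permutes_in_image permutes_inverses)
    qed
    then show ?thesis by (metis bij_betw_same_card)
  qed
  have id: "id \<in> fib f0" by (simp add: fib_def f0_def permutes_id)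
  have pos: "card (fib f0) > 0" using id fin by (metis card_gt_0_iff empty_iff)
  \<comment> \<open>A permutation in the fibre of \<open>f0\<close> maps every class
    \<open>{x \<in> S. g x = c}\<close> to itself, so it is determined by one permutation of each
    class.\<close>
  have le: "card (fib f0) \<le> (\<Prod>c\<in>C. fact (t c))"
  proof -
    let ?X = "\<lambda>c. {x \<in> S. g x = c}"
    let ?T = "PiE C (\<lambda>c. {h \<in> ?X c \<rightarrow>\<^sub>E ?X c. inj_on h (?X c)})"
    let ?m = "\<lambda>p. \<lambda>c\<in>C. restrict p (?X c)"
    have gp: "g (p x) = g x" if "p \<in> fib f0" "x \<in> S" for p x
      using that unfolding fib_def f0_def by (auto simp: fun_eq_iff dest: spec[of _ x])
    have per: "p permutes S" if "p \<in> fib f0" for p using that by (simp add: fib_def)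
    have "inj_on ?m (fib f0)"
    proof (rule inj_onI)
      fix p q assume pq: "p \<in> fib f0" "q \<in> fib f0" "?m p = ?m q"
      show "p = q"
      proof
        fix x show "p x = q x"
        proof (cases "x \<in> S")
          case True
          then have "g x \<in> C" using g by auto
          moreover have "?m p (g x) x = ?m q (g x) x" using pq(3) by simp
          ultimately show ?thesis using True by simp
        next
          case False
          then show ?thesis using per[OF pq(1)] per[OF pq(2)] by (simp add: permutes_def)
        qed
      qed
    qed
    moreover have "?m ` fib f0 \<subseteq> ?T"
    proof (rule image_subsetI)
      fix p assume p: "p \<in> fib f0"
      have "inj p" using per[OF p] permutes_inj by blast
      then show "?m p \<in> ?T"
        using gp[OF p] per[OF p] by (auto simp: permutes_in_image inj_on_def)
    qed
    moreover have "finite ?T"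
    proof (intro finite_PiE C)
      fix c assume "c \<in> C"
      have "finite (?X c \<rightarrow>\<^sub>E ?X c)" using S by (intro finite_PiE) auto
      then show "finite {h \<in> ?X c \<rightarrow>\<^sub>E ?X c. inj_on h (?X c)}" by (rule rev_finite_subset) auto
    qed
    ultimately have "card (fib f0) \<le> card ?T" by (rule card_inj_on_le)
    also have "\<dots> = (\<Prod>c\<in>C. fact (t c))"
      using S C t by (simp add: card_PiE card_inj_funcset_eq)
    finally show ?thesis .
  qed
  have "card {p. p permutes S \<and> restrict (g \<circ> p) S \<in> M} = card (fib f0) * card M"
    if M: "M \<subseteq> words S C t" for M
  proof -
    have finM: "finite M" using M words_finite[OF S C] finite_subset by blast
    have "{p. p permutes S \<and> restrict (g \<circ> p) S \<in> M} = (\<Union>f\<in>M. fib f)"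
      by (auto simp: fib_def)
    also have "card \<dots> = (\<Sum>f\<in>M. card (fib f))"
      using finM fin by (intro card_UN_disjoint) (auto simp: fib_def)
    also have "\<dots> = (\<Sum>f\<in>M. card (fib f0))" using M eq by (intro sum.cong) auto
    finally show ?thesis by simp
  qed
  with pos le show ?thesis by blast
qed

lemma restrict_comp_in_words:
  assumes S: "finite S" and g: "g \<in> S \<rightarrow> C"
    and t: "\<And>c. c \<in> C \<Longrightarrow> card {x \<in> S. g x = c} = t c" and p: "p permutes S"
  shows "restrict (g \<circ> p) S \<in> words S C t"
proof -
  have "card {x \<in> S. g (p x) = c} = card {x \<in> S. g x = c}" for c
  proof -
    have "p ` {x \<in> S. g (p x) = c} = {x \<in> S. g x = c}"
    proof (intro equalityI subsetI)
      fix y assume y: "y \<in> {x \<in> S. g x = c}"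
      then obtain x where "y = p x" "x \<in> S"
        using permutes_image[OF p] by auto
      with y show "y \<in> p ` {x \<in> S. g (p x) = c}" by blast
    qed (use permutes_in_image[OF p] in blast)
    moreover have "card (p ` {x \<in> S. g (p x) = c}) = card {x \<in> S. g (p x) = c}"
      by (rule card_image[OF inj_on_subset[OF permutes_inj[OF p] subset_UNIV]])
    ultimately show ?thesis by simp
  qed
  moreover have "{x \<in> S. restrict (g \<circ> p) S x = c} = {x \<in> S. g (p x) = c}" for c
    by auto
  moreover have "restrict (g \<circ> p) S \<in> S \<rightarrow>\<^sub>E C"
    using g permutes_in_image[OF p] by auto
  ultimately show ?thesis
    using t unfolding words_def by simp
qed

text \<open>Since all fibres have the same size, \<open>g \<circ> p\<close> is uniform among the
  words of its type, and probabilities become ratios of word counts.\<close>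

lemma perm_prob_word:
  assumes S: "finite S" and C: "finite C" and g: "g \<in> S \<rightarrow> C"
    and t: "\<And>c. c \<in> C \<Longrightarrow> card {x \<in> S. g x = c} = t c"
    and M: "M \<subseteq> words S C t"
  shows "perm_prob S (\<lambda>p. restrict (g \<circ> p) S \<in> M) = real (card M) / real (card (words S C t))"
    and "card (words S C t) > 0"
proof -
  obtain D where D: "D > 0" "D \<le> (\<Prod>c\<in>C. fact (t c))"
     "\<forall>M\<subseteq>words S C t. card {p. p permutes S \<and> restrict (g \<circ> p) S \<in> M} = D * card M"
    using word_fibre[OF S C g t] by blast
  have "restrict (g \<circ> p) S \<in> words S C t" if "p permutes S" for p
    by (rule restrict_comp_in_words[OF S g t that])
  then have "{p. p permutes S} = {p. p permutes S \<and> restrict (g \<circ> p) S \<in> words S C t}"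
    by blast
  then have "fact (card S) = D * card (words S C t)"
    using D(3)[rule_format, OF order.refl] card_permutations[OF refl S] by metis
  then have f: "fact (card S) = real D * real (card (words S C t))" by (metis of_nat_fact of_nat_mult)
  then show "perm_prob S (\<lambda>p. restrict (g \<circ> p) S \<in> M) = real (card M) / real (card (words S C t))"
    unfolding perm_prob_def using D(3)[rule_format, OF M] D(1) by simp
  show "card (words S C t) > 0"
    using f by (metis fact_nonzero gr0I mult_zero_right of_nat_0)
qed

text \<open>Method of types: a word of independent letters with frequencies \<open>t c / N\<close>
  has exactly the type \<open>t\<close> with probability at least
  \<open>1 / (exp 1 * (N + 1)) ^ card C\<close>. The proof applies the two Stirling bounds to the
  multinomial coefficient, whose denominator bounds the fibre size \<open>D\<close>.\<close>

lemma card_words_lower: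
  assumes S: "finite S" and C: "finite C" and t: "sum t C = card S"
  shows "1 \<le> (exp 1 * (real (card S) + 1)) ^ card C * (real (card (words S C t)) * (\<Prod>c\<in>C. (real (t c) / real (card S)) ^ t c))"
proof -
  let ?N = "card S"
  obtain g where g: "g \<in> words S C t" using ex_word[OF C S t] by blast
  then have g': "g \<in> S \<rightarrow> C" "\<And>c. c \<in> C \<Longrightarrow> card {x \<in> S. g x = c} = t c"
    by (auto simp: words_def)
  obtain D where D: "D > 0" "D \<le> (\<Prod>c\<in>C. fact (t c))"
     "\<forall>M\<subseteq>words S C t. card {p. p permutes S \<and> restrict (g \<circ> p) S \<in> M} = D * card M"
    using word_fibre[OF S C g'(1) g'(2)] by blast
  have "restrict (g \<circ> p) S \<in> words S C t" if "p permutes S" for p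
    by (rule restrict_comp_in_words[OF S g'(1) g'(2) that])
  then have "{p. p permutes S} = {p. p permutes S \<and> restrict (g \<circ> p) S \<in> words S C t}"
    by blast
  then have "fact ?N = D * card (words S C t)"
    using D(3)[rule_format, OF order.refl] card_permutations[OF refl S] by metis
  then have f: "fact ?N = real D * real (card (words S C t))" by (metis of_nat_fact of_nat_mult)
  define P where "P = (\<Prod>c\<in>C. (real (t c) / real ?N) ^ t c)"
  have tle: "t c \<le> ?N" if "c \<in> C" for c using t that C by (metis member_le_sum le0)
  have "(real ?N / exp 1) ^ ?N * P = (\<Prod>c\<in>C. (real ?N / exp 1) ^ t c) * P"
    using t by (simp add: power_sum[symmetric])
  also have "\<dots> = (\<Prod>c\<in>C. (real (t c) / exp 1) ^ t c)"
    unfolding P_def prod.distrib[symmetric] power_mult_distrib[symmetric]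
  proof (rule prod.cong[OF refl])
    fix c assume "c \<in> C"
    \<comment> \<open>If \<open>?N = 0\<close>, the quotient is 0 by convention, but then the
      exponent \<open>t c\<close> is 0 as well.\<close>
    then have "?N \<noteq> 0 \<or> t c = 0" using tle[of c] by auto
    then show "(real ?N / exp 1 * (real (t c) / real ?N)) ^ t c = (real (t c) / exp 1) ^ t c" by auto
  qed
  finally have e1: "(real ?N / exp 1) ^ ?N * P = (\<Prod>c\<in>C. (real (t c) / exp 1) ^ t c)" .
  have P0: "P \<ge> 0" unfolding P_def by (intro prod_nonneg) auto
  have "real D \<le> real (\<Prod>c\<in>C. fact (t c))" using D(2) by (rule of_nat_mono)
  also have "\<dots> = (\<Prod>c\<in>C. fact (t c))" by simp
  also have "\<dots> \<le> (\<Prod>c\<in>C. exp 1 * (real ?N + 1) * (real (t c) / exp 1) ^ t c)"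
  proof (intro prod_mono conjI)
    fix c assume c: "c \<in> C"
    have "fact (t c) \<le> exp 1 * (real (t c) + 1) * (real (t c) / exp 1) ^ t c" by (rule fact_le_pow)
    also have "\<dots> \<le> exp 1 * (real ?N + 1) * (real (t c) / exp 1) ^ t c"
      using tle[OF c] by (intro mult_right_mono mult_left_mono) auto
    finally show "fact (t c) \<le> exp 1 * (real ?N + 1) * (real (t c) / exp 1) ^ t c" .
  qed auto
  also have "\<dots> = (exp 1 * (real ?N + 1)) ^ card C * ((real ?N / exp 1) ^ ?N * P)"
    using C by (simp add: e1 prod.distrib prod_constant)
  also have "\<dots> \<le> (exp 1 * (real ?N + 1)) ^ card C * (fact ?N * P)"
    using P0 fact_ge_pow by (intro mult_left_mono mult_right_mono) auto
  also have "\<dots> = real D * ((exp 1 * (real ?N + 1)) ^ card C * (real (card (words S C t)) * P))"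
    by (simp add: f)
  finally show ?thesis using D(1) unfolding P_def by simp
qed

section \<open>Concentration for random permutations\<close>

text \<open>Symmetrise over pairs: as \<open>G b \<le> Q / F b\<close>, a pair contributes at most
  \<open>Q * (u + 1 / u)\<close> with \<open>u = F b / F b'\<close> between \<open>exp (- x)\<close>
  and \<open>exp x\<close>, and \<open>u + 1 / u = 2 * cosh (ln u)\<close>.\<close>

lemma sum_mult_sum_le_cosh:
  fixes F G :: "'b \<Rightarrow> real"
  assumes B: "finite B" and F: "\<And>b. b \<in> B \<Longrightarrow> F b > 0"
    and FG: "\<And>b. b \<in> B \<Longrightarrow> F b * G b \<le> Q"
    and ratio: "\<And>b b'. b \<in> B \<Longrightarrow> b' \<in> B \<Longrightarrow> F b \<le> exp x * F b'"
    and x: "x \<ge> 0" and Q: "Q \<ge> 0"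
  shows "sum F B * sum G B \<le> (real (card B))\<^sup>2 * (Q * cosh x)"
proof -
  have pair: "F b * G b' + F b' * G b \<le> 2 * (Q * cosh x)" if b: "b \<in> B" "b' \<in> B" for b b'
  proof -
    define u where "u = F b / F b'"
    have pos: "F b > 0" "F b' > 0" using F b by auto
    then have u0: "u > 0" by (simp add: u_def)
    have "F b * G b' \<le> Q * u"
    proof -
      have "F b * G b' = u * (F b' * G b')" using pos by (simp add: u_def)
      also have "\<dots> \<le> u * Q" using FG b u0 by (intro mult_left_mono) auto
      finally show ?thesis by (simp add: mult.commute)
    qed
    moreover have "F b' * G b \<le> Q * inverse u"
    proof -
      have "F b' * G b = inverse u * (F b * G b)" using pos by (simp add: u_def)
      also have "\<dots> \<le> inverse u * Q" using FG b u0 by (intro mult_left_mono) auto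
      finally show ?thesis by (simp add: mult.commute)
    qed
    ultimately have 1: "F b * G b' + F b' * G b \<le> Q * (u + inverse u)" by (simp add: algebra_simps)
    have "u \<le> exp x" using ratio[OF b] pos by (simp add: u_def field_simps)
    moreover have "inverse u \<le> exp x" using ratio[OF b(2,1)] pos by (simp add: u_def field_simps)
    ultimately have "\<bar>ln u\<bar> \<le> x"
      using u0 by (smt (verit) exp_le_cancel_iff exp_ln ln_inverse positive_imp_inverse_positive)
    then have "cosh \<bar>ln u\<bar> \<le> cosh x"
      using x by (subst cosh_real_nonneg_le_iff) auto
    then have "u + inverse u \<le> 2 * cosh x"
      using u0 by (simp add: cosh_ln_real field_simps)
    then have "Q * (u + inverse u) \<le> Q * (2 * cosh x)" using Q by (rule mult_left_mono)
    with 1 show ?thesis by simp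
  qed
  have "2 * (sum F B * sum G B) = (\<Sum>b\<in>B. \<Sum>b'\<in>B. F b * G b') + (\<Sum>b\<in>B. \<Sum>b'\<in>B. F b' * G b)"
  proof -
    have "sum F B * sum G B = (\<Sum>b\<in>B. \<Sum>b'\<in>B. F b * G b')" by (rule sum_product)
    moreover have "(\<Sum>b\<in>B. \<Sum>b'\<in>B. F b' * G b) = (\<Sum>b\<in>B. \<Sum>b'\<in>B. F b * G b')" by (rule sum.swap)
    ultimately show ?thesis by simp
  qed
  also have "\<dots> = (\<Sum>b\<in>B. \<Sum>b'\<in>B. F b * G b' + F b' * G b)" by (simp add: sum.distrib)
  also have "\<dots> \<le> (\<Sum>b\<in>B. \<Sum>b'\<in>B. 2 * (Q * cosh x))" by (intro sum_mono pair)
  also have "\<dots> = 2 * ((real (card B))\<^sup>2 * (Q * cosh x))" by (simp add: power2_eq_square)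
  finally show ?thesis by simp
qed

text \<open>Splitting by the image of the new point, the averages of \<open>exp (l * f)\<close> over any two parts
  differ by a factor at most \<open>exp (2 * L * l)\<close>, so the product of the two averages gains at most
  a factor \<open>cosh (2 * L * l)\<close>.\<close>

lemma perm_concentration_aux:
  fixes f :: "('a \<Rightarrow> 'a) \<Rightarrow> real"
  assumes "finite S" and "L \<ge> 0" and "l \<ge> 0"
    and "\<And>p a b. p permutes S \<Longrightarrow> a \<in> S \<Longrightarrow> b \<in> S \<Longrightarrow> \<bar>f (p \<circ> transpose a b) - f p\<bar> \<le> L"
  shows "(\<Sum>p | p permutes S. exp (l * f p)) * (\<Sum>p | p permutes S. exp (- l * f p))
     \<le> (fact (card S))\<^sup>2 * cosh (2 * L * l) ^ card S"
  using assms(1,4)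
proof (induction S arbitrary: f rule: finite_induct)
  case empty
  have "{p. p permutes {}} = {id :: 'a \<Rightarrow> 'a}" by auto
  then show ?case by (simp add: exp_minus_inverse)
next
  case (insert a S)
  let ?B = "insert a S" and ?T = "insert a S"
  \<comment> \<open>Every permutation of \<open>insert a S\<close> is uniquely
    \<open>transpose a b \<circ> p\<close> with \<open>p\<close> permuting \<open>S\<close>;
    \<open>F b\<close> and \<open>G b\<close> collect those with a given \<open>b\<close>.\<close>
  define F where "F b = (\<Sum>p | p permutes S. exp (l * f (transpose a b \<circ> p)))" for b
  define G where "G b = (\<Sum>p | p permutes S. exp (- l * f (transpose a b \<circ> p)))" for b
  define Q where "Q = (fact (card S))\<^sup>2 * cosh (2 * L * l) ^ card S"
  have fin: "finite {p. p permutes S}" using insert by (simp add: finite_permutations)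
  have ne: "{p. p permutes S} \<noteq> {}" using permutes_id[of S] by blast
  have perm: "transpose a b \<circ> p permutes ?T" if "b \<in> ?B" "p permutes S" for b p
    using that by (intro permutes_compose permutes_swap_id permutes_subset[OF that(2)]) auto
  have lip: "\<bar>f (p \<circ> transpose c e) - f p\<bar> \<le> L" if "p permutes ?T" "c \<in> ?T" "e \<in> ?T" for p c e
    using insert.prems that by blast
  have FG: "F b * G b \<le> Q" if b: "b \<in> ?B" for b
    unfolding F_def G_def Q_def
  proof (rule insert.IH)
    fix p c e assume pce: "p permutes S" "c \<in> S" "e \<in> S"
    have "\<bar>f ((transpose a b \<circ> p) \<circ> transpose c e) - f (transpose a b \<circ> p)\<bar> \<le> L"
      using lip[OF perm[OF b pce(1)]] pce by blast
    then show "\<bar>f (transpose a b \<circ> (p \<circ> transpose c e)) - f (transpose a b \<circ> p)\<bar> \<le> L"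
      by (simp add: o_assoc)
  qed
  have ratio: "F b \<le> exp (2 * L * l) * F b'" if b: "b \<in> ?B" "b' \<in> ?B" for b b'
    unfolding F_def sum_distrib_left
  proof (rule sum_mono)
    fix p assume "p \<in> {p. p permutes S}"
    then have p: "p permutes S" by simp
    \<comment> \<open>The Lipschitz hypothesis speaks of transpositions composed on the right;
      conjugation turns one on the left into one on the right.\<close>
    have conj: "transpose x y \<circ> p' = p' \<circ> transpose (inv p' x) (inv p' y)" if "p' permutes ?T" for x y p'
    proof -
      have bij: "bij p'" using that permutes_bij by blast
      show ?thesis
        using bij_inv_eq_iff[OF bij] permutes_inverses(1)[OF that] by (auto simp: fun_eq_iff transpose_def)
    qed
    have inT: "inv p' x \<in> ?T" if "p' permutes ?T" "x \<in> ?T" for p' x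
      using that by (metis permutes_in_image permutes_inv)
    \<comment> \<open>From \<open>transpose a b' \<circ> p\<close> to
      \<open>transpose a b \<circ> p\<close> one passes through \<open>p\<close> itself, hence two
      transpositions and the change \<open>2 * L\<close>.\<close>
    define p1 where "p1 = transpose a b' \<circ> p"
    have p1: "p1 permutes ?T" using perm b p p1_def by blast
    define p2 where "p2 = transpose a b' \<circ> p1"
    have p2: "p2 permutes ?T"
      unfolding p2_def using p1 b by (intro permutes_compose permutes_swap_id) auto
    have p2p: "p2 = p" by (simp add: p2_def p1_def o_assoc)
    have s1: "\<bar>f p2 - f p1\<bar> \<le> L"
      unfolding p2_def conj[OF p1] by (rule lip[OF p1 inT[OF p1] inT[OF p1]]) (use b in auto)
    have s2: "\<bar>f (transpose a b \<circ> p2) - f p2\<bar> \<le> L"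
      unfolding conj[OF p2] by (rule lip[OF p2 inT[OF p2] inT[OF p2]]) (use b in auto)
    have "f (transpose a b \<circ> p) \<le> 2 * L + f (transpose a b' \<circ> p)"
      using s1 s2 unfolding p2p p1_def by linarith
    then have "l * f (transpose a b \<circ> p) \<le> l * (2 * L + f (transpose a b' \<circ> p))"
      using assms(3) by (rule mult_left_mono)
    then show "exp (l * f (transpose a b \<circ> p)) \<le> exp (2 * L * l) * exp (l * f (transpose a b' \<circ> p))"
      by (simp flip: exp_add add: algebra_simps)
  qed
  have "(\<Sum>p | p permutes ?T. exp (l * f p)) * (\<Sum>p | p permutes ?T. exp (- l * f p)) = sum F ?B * sum G ?B"
    unfolding sum_over_permutations_insert[OF insert.hyps] F_def G_def ..
  also have "\<dots> \<le> (real (card ?B))\<^sup>2 * (Q * cosh (2 * L * l))"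
  proof (rule sum_mult_sum_le_cosh)
    show "F b > 0" for b unfolding F_def using fin ne by (intro sum_pos) auto
    show "0 \<le> Q" unfolding Q_def by simp
  qed (use FG ratio assms insert in auto)
  also have "\<dots> = (fact (card ?T))\<^sup>2 * cosh (2 * L * l) ^ card ?T"
    using insert.hyps by (simp add: Q_def power2_eq_square algebra_simps)
  finally show ?case .
qed

lemma cosh_le_exp_square:
  fixes x :: real
  assumes "0 \<le> x" "x \<le> 1"
  shows "cosh x \<le> exp (x\<^sup>2)"
proof -
  have "exp (-x) \<le> 1 - x + x\<^sup>2"
  proof -
    have "exp (-x) \<le> 1 / (1 + x)"
      using assms exp_ge_add_one_self[of x] by (simp add: exp_minus field_simps)
    also have "\<dots> \<le> 1 - x + x\<^sup>2"
    proof -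
      have "1 \<le> (1 - x + x\<^sup>2) * (1 + x)"
        using assms by (simp add: algebra_simps power2_eq_square)
      then show ?thesis using assms by (simp add: field_simps)
    qed
    finally show ?thesis .
  qed
  with exp_bound[OF assms] have "cosh x \<le> 1 + x\<^sup>2" by (simp add: cosh_field_def)
  also have "\<dots> \<le> exp (x\<^sup>2)" by (rule exp_ge_add_one_self)
  finally show ?thesis .
qed

lemma perm_prob_eq_sum:
  assumes "finite S"
  shows "perm_prob S Q = (\<Sum>p | p permutes S. of_bool (Q p)) / fact (card S)"
proof -
  have "(\<Sum>p | p permutes S. of_bool (Q p)) = real (card ({p. p permutes S} \<inter> {p. Q p}))"
    using finite_permutations[OF assms] by (simp add: sum_of_bool_eq Int_def)
  then show ?thesis by (simp add: perm_prob_def Int_def)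
qed

text \<open>Markov's inequality is applied to both exponential moments, and only their product is
  bounded, so the mean of \<open>f\<close> never appears: the event \<open>Q\<close>, on which
  \<open>f\<close> vanishes, takes its place. If \<open>Q\<close> is not exponentially unlikely,
  large values of \<open>f\<close> must be.\<close>

lemma perm_concentration:
  fixes f :: "('a \<Rightarrow> 'a) \<Rightarrow> real"
  assumes S: "finite S" and L: "L \<ge> 0" and l: "l \<ge> 0" "2 * L * l \<le> 1"
    and lip: "\<And>p a b. p permutes S \<Longrightarrow> a \<in> S \<Longrightarrow> b \<in> S \<Longrightarrow> \<bar>f (p \<circ> transpose a b) - f p\<bar> \<le> L"
    and f0: "\<And>p. Q p \<Longrightarrow> f p = 0"
  shows "perm_prob S (\<lambda>p. f p > u) * perm_prob S Q \<le> exp ((2 * L * l)\<^sup>2 * real (card S) - l * u)"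
proof -
  let ?F = "(fact (card S) :: real)"
  have fin: "finite {p. p permutes S}" using S by (simp add: finite_permutations)
  have "(\<Sum>p | p permutes S. of_bool (f p > u)) \<le> (\<Sum>p | p permutes S. exp (- l * u) * exp (l * f p))"
  proof (rule sum_mono)
    fix p
    show "of_bool (f p > u) \<le> exp (- l * u) * exp (l * f p)"
      using l mult_left_mono[of u "f p" l] by (cases "f p > u") (auto simp flip: exp_add)
  qed
  then have 1: "perm_prob S (\<lambda>p. f p > u) \<le> exp (- l * u) * (\<Sum>p | p permutes S. exp (l * f p)) / ?F"
    unfolding perm_prob_eq_sum[OF S] sum_distrib_left[symmetric] by (rule divide_right_mono) simp
  have "(\<Sum>p | p permutes S. of_bool (Q p)) \<le> (\<Sum>p | p permutes S. exp (- l * f p))"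
    by (rule sum_mono) (use f0 in auto)
  then have 2: "perm_prob S Q \<le> (\<Sum>p | p permutes S. exp (- l * f p)) / ?F"
    unfolding perm_prob_eq_sum[OF S] by (rule divide_right_mono) simp
  have "perm_prob S (\<lambda>p. f p > u) * perm_prob S Q \<le>
     (exp (- l * u) * (\<Sum>p | p permutes S. exp (l * f p)) / ?F) * ((\<Sum>p | p permutes S. exp (- l * f p)) / ?F)"
    using 1 2 by (intro mult_mono) (auto simp: perm_prob_nonneg intro!: sum_nonneg divide_nonneg_nonneg mult_nonneg_nonneg)
  also have "\<dots> = exp (- l * u) * ((\<Sum>p | p permutes S. exp (l * f p)) * (\<Sum>p | p permutes S. exp (- l * f p)) / ?F\<^sup>2)"
    by (simp add: power2_eq_square)
  also have "\<dots> \<le> exp (- l * u) * cosh (2 * L * l) ^ card S"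
    using perm_concentration_aux[OF S L l(1) lip] by (intro mult_left_mono) (auto simp: field_simps)
  also have "\<dots> \<le> exp (- l * u) * exp ((2 * L * l)\<^sup>2) ^ card S"
    using L l by (intro mult_left_mono power_mono cosh_le_exp_square) auto
  also have "\<dots> = exp ((2 * L * l)\<^sup>2 * real (card S) - l * u)"
    by (simp flip: exp_of_nat_mult exp_add add: algebra_simps)
  finally show ?thesis .
qed

section \<open>Two elementary inequalities and degenerate colourings\<close>

text \<open>The left-hand excess is the Taylor remainder at 1 and obeys
  \<open>G (r + 1) = y * G r + r * (y - 1)^2\<close>. The factor \<open>max 1 y\<close> is the one
  in \<open>entropy_excess_bound\<close>, so that \<open>(y - 1)^2\<close> can be eliminated between
  the two bounds.\<close>

lemma power_excess_bound:
  fixes y :: real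
  assumes y: "y \<ge> 0" and r: "r \<ge> 1"
  shows "(y ^ r - 1 - real r * (y - 1)) * max 1 y \<le> (real r)\<^sup>2 * max 1 y ^ (r - 1) * (y - 1)\<^sup>2"
  using r
proof (induction r rule: dec_induct)
  case base
  then show ?case by simp
next
  case (step r)
  let ?M = "max 1 y"
  have M: "?M \<ge> 1" "?M \<ge> y" by auto
  have eq: "y ^ Suc r - 1 - real (Suc r) * (y - 1) = y * (y ^ r - 1 - real r * (y - 1)) + real r * (y - 1)\<^sup>2"
    by (simp add: algebra_simps power2_eq_square)
  have "(y ^ Suc r - 1 - real (Suc r) * (y - 1)) * ?M
     = y * ((y ^ r - 1 - real r * (y - 1)) * ?M) + real r * ?M * (y - 1)\<^sup>2"
    unfolding eq by algebra
  also have "\<dots> \<le> y * ((real r)\<^sup>2 * ?M ^ (r - 1) * (y - 1)\<^sup>2) + real r * ?M ^ r * (y - 1)\<^sup>2"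
    using step y M by (intro add_mono mult_left_mono mult_right_mono self_le_power) auto
  also have "\<dots> \<le> ?M * ((real r)\<^sup>2 * ?M ^ (r - 1) * (y - 1)\<^sup>2) + real r * ?M ^ r * (y - 1)\<^sup>2"
    using M by (intro add_right_mono mult_right_mono) auto
  also have "\<dots> = ((real r)\<^sup>2 + real r) * (?M ^ r * (y - 1)\<^sup>2)"
    using step by (cases r) (auto simp: algebra_simps)
  also have "\<dots> \<le> (real (Suc r))\<^sup>2 * (?M ^ r * (y - 1)\<^sup>2)"
  proof (rule mult_right_mono)
    show "(real r)\<^sup>2 + real r \<le> (real (Suc r))\<^sup>2" by (simp add: power2_eq_square algebra_simps)
  qed simp
  finally show ?case by (simp add: mult.assoc)
qed

text \<open>With \<open>s = sqrt y\<close> the entropy excess is at least \<open>(s - 1)^2\<close>,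
  while \<open>(y - 1)^2 = (s - 1)^2 * (s + 1)^2\<close> and
  \<open>(s + 1)^2 \<le> 4 * max 1 y\<close>.\<close>

lemma entropy_excess_bound:
  fixes y :: real
  assumes "y \<ge> 0"
  shows "(y - 1)\<^sup>2 \<le> (y * ln y - y + 1) * (4 * max 1 y)"
proof (cases "y = 0")
  case True
  then show ?thesis by simp
next
  case False
  then have y: "y > 0" using assms by simp
  define s where "s = sqrt y"
  have s: "s > 0" "y = s\<^sup>2" using y by (auto simp: s_def)
  have "- ln s \<le> inverse s - 1"
    using ln_le_minus_one[of "inverse s"] s by (simp add: ln_inverse)
  then have "ln y \<ge> 2 * (1 - inverse s)" using s by (simp add: ln_realpow)
  then have "y * ln y \<ge> s\<^sup>2 * (2 * (1 - inverse s))" unfolding s(2)[symmetric] using y by (intro mult_left_mono) auto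
  moreover have "s\<^sup>2 * (2 * (1 - inverse s)) = 2 * s\<^sup>2 - 2 * s"
    using s by (simp add: field_simps power2_eq_square)
  ultimately have "y * ln y \<ge> 2 * s\<^sup>2 - 2 * s" by simp
  then have F: "y * ln y - y + 1 \<ge> (s - 1)\<^sup>2"
    using s(2) by (simp add: power2_diff)
  have "(s + 1)\<^sup>2 \<le> 4 * max 1 y"
  proof (cases "s \<le> 1")
    case True
    then have "(s + 1)\<^sup>2 \<le> 2\<^sup>2" using s by (intro power_mono) auto
    then show ?thesis by simp
  next
    case False
    then have "(s + 1)\<^sup>2 \<le> (2 * s)\<^sup>2" using s by (intro power_mono) auto
    then show ?thesis using s by (simp add: power_mult_distrib)
  qed
  then have "(s - 1)\<^sup>2 * (s + 1)\<^sup>2 \<le> (y * ln y - y + 1) * (4 * max 1 y)"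
    using F order.trans[OF zero_le_power2 F] by (intro mult_mono) auto
  moreover have "(y - 1)\<^sup>2 = (s - 1)\<^sup>2 * (s + 1)\<^sup>2"
    using s by (simp add: power2_eq_square algebra_simps)
  ultimately show ?thesis by simp
qed

text \<open>Up to the crossover \<open>y1\<close> both sides are compared with
  \<open>(y - 1)^2\<close>. Beyond it the left side is at most \<open>y * (A * Y ^ (r - 1))\<close>
  and the right side at least \<open>y * (ln y - 1)\<close>. The crossover is left free, to be
  chosen when \<open>A\<close> and \<open>Y\<close> are known.\<close>

lemma power_excess_le_entropy_excess:
  fixes y A y1 Y :: real
  assumes y: "0 \<le> y" "y \<le> Y" and r: "r \<ge> 1" and A: "A \<ge> 0" and y1: "y1 \<ge> 1"
    and small: "4 * A * (real r)\<^sup>2 * y1 ^ (r - 1) \<le> 1"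
    and large: "A * Y ^ (r - 1) \<le> ln y1 - 1"
  shows "A * (y ^ r - 1 - real r * (y - 1)) \<le> y * ln y - y + 1"
proof (cases "y \<le> y1")
  case True
  let ?G = "y ^ r - 1 - real r * (y - 1)" and ?M = "max 1 y"
  have "(A * ?G) * (4 * ?M) = 4 * A * (?G * ?M)" by simp
  also have "\<dots> \<le> 4 * A * ((real r)\<^sup>2 * ?M ^ (r - 1) * (y - 1)\<^sup>2)"
    using A power_excess_bound[OF y(1) r] by (intro mult_left_mono) auto
  also have "\<dots> = (4 * A * (real r)\<^sup>2 * ?M ^ (r - 1)) * (y - 1)\<^sup>2" by simp
  also have "\<dots> \<le> (4 * A * (real r)\<^sup>2 * y1 ^ (r - 1)) * (y - 1)\<^sup>2"
    using A True y1 by (intro mult_right_mono mult_left_mono power_mono) auto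
  also have "\<dots> \<le> 1 * (y - 1)\<^sup>2" using small by (intro mult_right_mono) auto
  also have "\<dots> \<le> (y * ln y - y + 1) * (4 * ?M)" using entropy_excess_bound[OF y(1)] by simp
  finally show ?thesis by (rule mult_right_le_imp_le) simp
next
  case False
  then have yy: "y > y1" "y > 1" using y1 by auto
  have "0 \<le> real r * (y - 1)" using yy by simp
  then have "A * (y ^ r - 1 - real r * (y - 1)) \<le> A * y ^ r"
    using A by (intro mult_left_mono) linarith+
  also have "\<dots> = y * (A * y ^ (r - 1))" using r by (cases r) auto
  also have "\<dots> \<le> y * (A * Y ^ (r - 1))" using y yy A by (intro mult_left_mono power_mono) auto
  also have "\<dots> \<le> y * (ln y1 - 1)" using large yy by (intro mult_left_mono) auto
  also have "\<dots> \<le> y * (ln y - 1)" using yy y1 by (intro mult_left_mono) auto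
  also have "\<dots> \<le> y * ln y - y + 1" by (simp add: algebra_simps)
  finally show ?thesis .
qed

text \<open>By double counting some vertex of \<open>U\<close> lies in fewer than
  \<open>2 * r\<close> edges inside \<open>U\<close>. Remove it, colour the rest, and put it
  back.\<close>

lemma degenerate_coloring:
  fixes E :: "'a set set"
  assumes fin: "finite U" and r: "r \<ge> 2" and E: "\<And>e. e \<in> E \<Longrightarrow> finite e \<and> card e = r"
    and sparse: "\<And>U'. U' \<subseteq> U \<Longrightarrow> U' \<noteq> {} \<Longrightarrow> card {e \<in> E. e \<subseteq> U'} < 2 * card U'"
  shows "\<exists>f. (\<forall>v\<in>U. f v < 2 * r) \<and> (\<forall>e\<in>E. e \<subseteq> U \<longrightarrow> \<not> (\<exists>c::nat. \<forall>v\<in>e. f v = c))"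
  using fin sparse
proof (induction "card U" arbitrary: U)
  case 0
  then have "U = {}" by simp
  moreover have "\<not> e \<subseteq> {}" if "e \<in> E" for e using E[OF that] r by auto
  ultimately show ?case by auto
next
  case (Suc k)
  let ?EU = "{e \<in> E. e \<subseteq> U}"
  have finEU: "finite ?EU" using Suc.prems(1) by (intro finite_subset[of ?EU "Pow U"]) auto
  have Une: "U \<noteq> {}" using Suc.hyps(2) by auto
  have "(\<Sum>v\<in>U. card {e \<in> ?EU. v \<in> e}) = (\<Sum>e\<in>?EU. card {v \<in> U. v \<in> e})"
    using Suc.prems(1) finEU sum_multicount_gen[of U ?EU "\<lambda>v e. v \<in> e" "\<lambda>e. card {v \<in> U. v \<in> e}"] by simp
  also have "\<dots> = (\<Sum>e\<in>?EU. r)"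
  proof (rule sum.cong[OF refl])
    fix e assume "e \<in> ?EU"
    then have "{v \<in> U. v \<in> e} = e" "card e = r" using E by auto
    then show "card {v \<in> U. v \<in> e} = r" by simp
  qed
  also have "\<dots> = card ?EU * r" by simp
  also have "\<dots> < 2 * card U * r"
    using Suc.prems(2)[OF order.refl Une] r by simp
  also have "\<dots> = (\<Sum>v\<in>U. 2 * r)" by simp
  finally obtain v where v: "v \<in> U" "card {e \<in> ?EU. v \<in> e} < 2 * r"
    by (meson not_le sum_mono)
  have "k = card (U - {v})" using Suc.hyps(2) v Suc.prems(1) by simp
  moreover have "card {e \<in> E. e \<subseteq> U'} < 2 * card U'" if "U' \<subseteq> U - {v}" "U' \<noteq> {}" for U'
    using Suc.prems(2)[of U'] that by blast
  ultimately obtain f where f: "\<forall>u\<in>U - {v}. f u < 2 * r"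
    "\<forall>e\<in>E. e \<subseteq> U - {v} \<longrightarrow> \<not> (\<exists>c::nat. \<forall>v\<in>e. f v = c)"
    using Suc.hyps(1)[of "U - {v}"] Suc.prems(1) by (metis (no_types, lifting) finite_Diff)
  let ?X = "{e \<in> ?EU. v \<in> e}"
  have "\<exists>w. w \<in> e \<and> w \<noteq> v" if "e \<in> ?X" for e
  proof (rule ccontr)
    assume "\<not> ?thesis"
    then have "e \<subseteq> {v}" by auto
    then have "card e \<le> 1" by (metis card_mono card.empty card_insert_disjoint empty_iff finite.intros One_nat_def)
    then show False using E that r by auto
  qed
  then obtain w where w: "\<And>e. e \<in> ?X \<Longrightarrow> w e \<in> e \<and> w e \<noteq> v" by metis
  let ?Y = "(\<lambda>e. f (w e)) ` ?X"
  have finX: "finite ?X" using finEU by (rule rev_finite_subset) auto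
  have "card ?Y \<le> card ?X" using finX by (rule card_image_le)
  then have "card ?Y < card {..<2 * r}" using v by simp
  moreover have "finite ?Y" using finX by auto
  ultimately have "\<not> {..<2 * r} \<subseteq> ?Y" by (meson card_mono not_le)
  \<comment> \<open>Each edge at \<open>v\<close> forbids only one colour, that of a single other
    vertex \<open>w e\<close> in it, and there are fewer than \<open>2 * r\<close> such
    edges.\<close>
  then obtain c where c: "c < 2 * r" "c \<notin> ?Y" by auto
  let ?g = "f(v := c)"
  have "\<not> (\<exists>c'. \<forall>u\<in>e. ?g u = c')" if e: "e \<in> E" "e \<subseteq> U" for e
  proof (cases "v \<in> e")
    case True
    then have "e \<in> ?X" using e by simp
    then have "w e \<in> e" "w e \<noteq> v" "f (w e) \<noteq> c" using w c by auto
    then show ?thesis using True by (metis fun_upd_apply)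
  next
    case False
    then have "e \<subseteq> U - {v}" using e by auto
    moreover have "\<forall>u\<in>e. ?g u = f u" using False by auto
    ultimately show ?thesis using f(2) e(1) by metis
  qed
  moreover have "\<forall>u\<in>U. ?g u < 2 * r" using f(1) c by auto
  ultimately show ?case by blast
qed

section \<open>Switchings\<close>

text \<open>Positions are related by lying in the same
  block or by carrying points of the same vertex. The tuples below are the (possibly
  degenerate) alternating 4-cycles; a repeated vertex within a block shows up as \<open>(p, a, p, a)\<close>.\<close>

definition short_cycles :: "'a set \<Rightarrow> ('a \<Rightarrow> 'b) \<Rightarrow> ('a \<Rightarrow> 'c) \<Rightarrow> ('a \<Rightarrow> 'a) \<Rightarrow> ('a \<times> 'a \<times> 'a \<times> 'a) set" where
  "short_cycles S bl vt \<pi> = {(p, a, b, c). p \<in> S \<and> a \<in> S \<and> b \<in> S \<and> c \<in> S \<and> bl p = bl a \<and> p \<noteq> a \<and> bl b = bl c \<and> b \<noteq> c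
     \<and> vt (\<pi> a) = vt (\<pi> b) \<and> vt (\<pi> c) = vt (\<pi> p) \<and> p \<noteq> c}"

definition near :: "'a set \<Rightarrow> ('a \<Rightarrow> 'b) \<Rightarrow> ('a \<Rightarrow> 'c) \<Rightarrow> ('a \<Rightarrow> 'a) \<Rightarrow> 'a \<Rightarrow> 'a set" where
  "near S bl vt \<pi> p = {q \<in> S. bl q = bl p \<or> vt (\<pi> q) = vt (\<pi> p)}"

text \<open>Four steps are the right radius: if a swapped position lies on a new alternating
  4-cycle, the other three positions of that cycle link \<open>p\<close> to \<open>q\<close> in the
  old configuration.\<close>

definition near4 :: "'a set \<Rightarrow> ('a \<Rightarrow> 'b) \<Rightarrow> ('a \<Rightarrow> 'c) \<Rightarrow> ('a \<Rightarrow> 'a) \<Rightarrow> 'a \<Rightarrow> 'a set" where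
  "near4 S bl vt \<pi> p = (\<Union>x\<in>near S bl vt \<pi> p. \<Union>y\<in>near S bl vt \<pi> x. \<Union>z\<in>near S bl vt \<pi> y. near S bl vt \<pi> z)"

text \<open>These must be avoided because swapping two loop positions trades the two loops for a
  pair of vertices shared by two blocks, which is a new cycle even when \<open>p\<close> and
  \<open>q\<close> are far apart.\<close>

definition loop_positions :: "'a set \<Rightarrow> ('a \<Rightarrow> 'b) \<Rightarrow> ('a \<Rightarrow> 'c) \<Rightarrow> ('a \<Rightarrow> 'a) \<Rightarrow> 'a set" where
  "loop_positions S bl vt \<pi> = {q \<in> S. \<exists>c. (q, c, q, c) \<in> short_cycles S bl vt \<pi>}"

lemma short_cycles_finite: "finite S \<Longrightarrow> finite (short_cycles S bl vt \<pi>)"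
  by (rule finite_subset[of _ "S \<times> S \<times> S \<times> S"]) (auto simp: short_cycles_def)

text \<open>A cycle that becomes closed by the swap yields, in the old configuration, a walk of at
  most four steps from \<open>p\<close> to \<open>q\<close> or a loop at \<open>q\<close>. The case
  analysis on which of the four positions were moved checks just this.\<close>

lemma swap_no_new_short_cycles:
  assumes pq: "p \<in> S" "q \<in> S" and far: "q \<notin> near4 S bl vt \<pi> p" and nl: "q \<notin> loop_positions S bl vt \<pi>"
  shows "short_cycles S bl vt (\<pi> \<circ> transpose p q) \<subseteq> short_cycles S bl vt \<pi>"
proof
  fix t assume "t \<in> short_cycles S bl vt (\<pi> \<circ> transpose p q)"
  then obtain u a b c where t: "t = (u, a, b, c)" and inS: "u \<in> S" "a \<in> S" "b \<in> S" "c \<in> S"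
    and bl: "bl u = bl a" "u \<noteq> a" "bl b = bl c" "b \<noteq> c" "u \<noteq> c"
    and vt: "vt (\<pi> (transpose p q a)) = vt (\<pi> (transpose p q b))" "vt (\<pi> (transpose p q c)) = vt (\<pi> (transpose p q u))"
    by (auto simp: short_cycles_def)
  define R where "R x y \<longleftrightarrow> bl x = bl y \<or> vt (\<pi> x) = vt (\<pi> y)" for x y
  have R: "\<not> (R p x \<and> R x y \<and> R y z \<and> R z q)" if "x \<in> S" "y \<in> S" "z \<in> S" for x y z
  proof
    assume "R p x \<and> R x y \<and> R y z \<and> R z q"
    then have "x \<in> near S bl vt \<pi> p" "y \<in> near S bl vt \<pi> x" "z \<in> near S bl vt \<pi> y" "q \<in> near S bl vt \<pi> z"
      using that pq by (auto simp: near_def R_def)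
    then show False using far unfolding near4_def by blast
  qed
  have loop: False if "x \<in> S" "x \<noteq> q" "bl x = bl q" "vt (\<pi> x) = vt (\<pi> q)" for x
    using nl that pq unfolding loop_positions_def short_cycles_def by auto
  have refl: "R x x" for x by (simp add: R_def)
  have R2: "\<not> (R p x \<and> R x q)" if "x \<in> S" for x using R[of x x x] that refl by blast
  have R1: "\<not> R p q" using R2[of p] refl pq by blast
  have blpq: "bl p \<noteq> bl q" and vtpq: "vt (\<pi> p) \<noteq> vt (\<pi> q)" using R1 by (auto simp: R_def)
  have pnq: "p \<noteq> q" using blpq by auto
  have walk4: False if "x \<in> S" "y \<in> S" "z \<in> S" "bl p = bl x \<or> vt (\<pi> p) = vt (\<pi> x)" "bl x = bl y \<or> vt (\<pi> x) = vt (\<pi> y)"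
     "bl y = bl z \<or> vt (\<pi> y) = vt (\<pi> z)" "bl z = bl q \<or> vt (\<pi> z) = vt (\<pi> q)" for x y z
    using R[of x y z] that by (simp add: R_def)
  have walk2: False if "x \<in> S" "bl p = bl x \<or> vt (\<pi> p) = vt (\<pi> x)" "bl x = bl q \<or> vt (\<pi> x) = vt (\<pi> q)" for x
    using R2[of x] that by (simp add: R_def)
  have "vt (\<pi> a) = vt (\<pi> b) \<and> vt (\<pi> c) = vt (\<pi> u)"
    using vt bl inS walk2[of a] walk2[of b] walk2[of c] walk2[of u] walk4[of a b c] walk4[of c b a] walk4[of u c b] walk4[of b c u] walk4[of c u a] walk4[of a u c] walk4[of b a u] walk4[of u a b]
      loop[of a] loop[of b] loop[of c] loop[of u] blpq vtpq pnq unfolding transpose_def by (auto split: if_splits)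
  then show "t \<in> short_cycles S bl vt \<pi>"
    using t inS bl by (simp add: short_cycles_def)
qed

text \<open>Composing with the inverse of one solution \<open>p0\<close> maps all solutions
  injectively to permutations fixing \<open>A\<close>.\<close>

lemma card_perms_prescribed:
  assumes S: "finite S" and A: "A \<subseteq> S"
  shows "card {p. p permutes S \<and> (\<forall>a\<in>A. p a = f a)} \<le> fact (card S - card A)"
proof (cases "{p. p permutes S \<and> (\<forall>a\<in>A. p a = f a)} = {}")
  case True
  then show ?thesis by (metis card.empty le0)
next
  case False
  then obtain p0 where p0: "p0 permutes S" "\<forall>a\<in>A. p0 a = f a" by auto
  let ?X = "{p. p permutes S \<and> (\<forall>a\<in>A. p a = f a)}"
  have finA: "finite A" using S A finite_subset by blast
  have "card ?X \<le> card {q. q permutes (S - A)}"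
  proof (rule card_inj_on_le)
    show "inj_on (\<lambda>p. inv p0 \<circ> p) ?X"
    proof (rule inj_onI)
      fix p q assume "inv p0 \<circ> p = inv p0 \<circ> q"
      then have "p0 \<circ> (inv p0 \<circ> p) = p0 \<circ> (inv p0 \<circ> q)" by simp
      then show "p = q" by (simp add: o_assoc permutes_inv_o[OF p0(1)])
    qed
    show "(\<lambda>p. inv p0 \<circ> p) ` ?X \<subseteq> {q. q permutes (S - A)}"
    proof (rule image_subsetI)
      fix p assume p: "p \<in> ?X"
      then have "inv p0 \<circ> p permutes S" using p0 by (auto intro: permutes_compose permutes_inv)
      moreover have "(inv p0 \<circ> p) a = a" if "a \<in> A" for a
        using p p0 that permutes_inverses(2)[OF p0(1), of a] by simp
      ultimately show "inv p0 \<circ> p \<in> {q. q permutes (S - A)}"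
        using permutes_superset[of "inv p0 \<circ> p" S "S - A"] by auto
    qed
    show "finite {q. q permutes (S - A)}" using S by (simp add: finite_permutations)
  qed
  also have "\<dots> = fact (card S - card A)"
    using S A finA by (intro card_permutations) (auto simp: card_Diff_subset)
  finally show ?thesis .
qed

lemma card_UN_le_mult:
  assumes "finite A" "\<And>x. x \<in> A \<Longrightarrow> card (f x) \<le> k"
  shows "card (\<Union>x\<in>A. f x) \<le> card A * k"
proof -
  have "card (\<Union>x\<in>A. f x) \<le> (\<Sum>x\<in>A. card (f x))" by (rule card_UN_le[OF assms(1)])
  also have "\<dots> \<le> (\<Sum>x\<in>A. k)" by (rule sum_mono) (use assms in auto)
  finally show ?thesis by simp
qed

section \<open>Counting switchings\<close>

locale two_partitions =
  fixes S :: "'a set" and bl :: "'a \<Rightarrow> 'b" and vt :: "'a \<Rightarrow> 'c" and K :: nat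
  assumes finS: "finite S"
    and bl_class: "\<And>p. p \<in> S \<Longrightarrow> card {q \<in> S. bl q = bl p} \<le> K"
    and vt_class: "\<And>p. p \<in> S \<Longrightarrow> card {q \<in> S. vt q = vt p} \<le> K"
begin

abbreviation "sc \<pi> \<equiv> short_cycles S bl vt \<pi>"

lemma card_near:
  assumes "\<pi> permutes S" "p \<in> S"
  shows "card (near S bl vt \<pi> p) \<le> 2 * K"
proof -
  have eq: "near S bl vt \<pi> p = {q \<in> S. bl q = bl p} \<union> {q \<in> S. vt (\<pi> q) = vt (\<pi> p)}"
    by (auto simp: near_def)
  have "card {q \<in> S. vt (\<pi> q) = vt (\<pi> p)} \<le> card {q \<in> S. vt q = vt (\<pi> p)}"
    using finS permutes_in_image[OF assms(1)]
    by (intro card_inj_on_le[of \<pi>] inj_on_subset[OF permutes_inj[OF assms(1)]]) auto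
  also have "\<dots> \<le> K" using vt_class permutes_in_image[OF assms(1)] assms(2) by blast
  finally have "card {q \<in> S. vt (\<pi> q) = vt (\<pi> p)} \<le> K" .
  then show ?thesis
    unfolding eq using bl_class[OF assms(2)] card_Un_le[of "{q \<in> S. bl q = bl p}" "{q \<in> S. vt (\<pi> q) = vt (\<pi> p)}"]
    by linarith
qed

lemma card_near4:
  assumes pi: "\<pi> permutes S" and p: "p \<in> S"
  shows "card (near4 S bl vt \<pi> p) \<le> (2 * K) ^ 4"
proof -
  have near_sub: "near S bl vt \<pi> x \<subseteq> S" for x by (auto simp: near_def)
  have fin: "finite (near S bl vt \<pi> x)" for x using finS near_sub finite_subset by blast
  have 2: "card (\<Union>z\<in>near S bl vt \<pi> y. near S bl vt \<pi> z) \<le> (2 * K) ^ 2" if "y \<in> S" for y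
  proof -
    have "card (\<Union>z\<in>near S bl vt \<pi> y. near S bl vt \<pi> z) \<le> card (near S bl vt \<pi> y) * (2 * K)"
      using near_sub card_near[OF pi] by (intro card_UN_le_mult fin) auto
    also have "\<dots> \<le> (2 * K) * (2 * K)" by (intro mult_right_mono card_near[OF pi that]) simp
    finally show ?thesis by (simp add: power2_eq_square)
  qed
  have 3: "card (\<Union>y\<in>near S bl vt \<pi> x. \<Union>z\<in>near S bl vt \<pi> y. near S bl vt \<pi> z) \<le> (2 * K) ^ 3" if "x \<in> S" for x
  proof -
    have "card (\<Union>y\<in>near S bl vt \<pi> x. \<Union>z\<in>near S bl vt \<pi> y. near S bl vt \<pi> z) \<le> card (near S bl vt \<pi> x) * (2 * K) ^ 2"
      using near_sub 2 by (intro card_UN_le_mult fin) auto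
    also have "\<dots> \<le> (2 * K) * (2 * K) ^ 2" by (intro mult_right_mono card_near[OF pi that]) simp
    finally show ?thesis by (simp add: eval_nat_numeral)
  qed
  have "card (near4 S bl vt \<pi> p) \<le> card (near S bl vt \<pi> p) * (2 * K) ^ 3"
    unfolding near4_def using near_sub 3 by (intro card_UN_le_mult fin) auto
  also have "\<dots> \<le> (2 * K) * (2 * K) ^ 3" by (intro mult_right_mono card_near[OF pi p]) simp
  finally show ?thesis by (simp add: eval_nat_numeral)
qed

lemma card_loop_positions: "card (loop_positions S bl vt \<pi>) \<le> card (sc \<pi>)"
proof -
  have "loop_positions S bl vt \<pi> \<subseteq> fst ` sc \<pi>" 
    unfolding loop_positions_def by (force simp: image_iff)
  then have "card (loop_positions S bl vt \<pi>) \<le> card (fst ` sc \<pi>)"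
    by (intro card_mono finite_imageI short_cycles_finite finS)
  also have "\<dots> \<le> card (sc \<pi>)" using short_cycles_finite[OF finS] by (rule card_image_le)
  finally show ?thesis .
qed

text \<open>After the swap \<open>p\<close> carries the vertex of \<open>q\<close>. For the cycle to
  survive, \<open>c\<close> would have to carry that vertex too, which would put \<open>q\<close>
  two steps away from \<open>p\<close>.\<close>

lemma swap_destroys:
  assumes pi: "\<pi> permutes S" and x: "(p, a, b, c) \<in> sc \<pi>"
    and q: "q \<in> S" "q \<notin> near4 S bl vt \<pi> p" "q \<notin> loop_positions S bl vt \<pi>"
  shows "card (sc (\<pi> \<circ> transpose p q)) < card (sc \<pi>)"
proof (rule psubset_card_mono[OF short_cycles_finite[OF finS]])
  have pc: "p \<in> S" "c \<in> S" "vt (\<pi> c) = vt (\<pi> p)" "p \<noteq> c" using x by (auto simp: short_cycles_def)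
  have "c \<in> near S bl vt \<pi> p" "c \<in> near S bl vt \<pi> c" using pc by (auto simp: near_def)
  then have sub: "near S bl vt \<pi> c \<subseteq> near4 S bl vt \<pi> p" unfolding near4_def by blast
  have "(p, a, b, c) \<notin> sc (\<pi> \<circ> transpose p q)"
  proof
    assume "(p, a, b, c) \<in> sc (\<pi> \<circ> transpose p q)"
    then have "vt (\<pi> (transpose p q c)) = vt (\<pi> q)" by (simp add: short_cycles_def)
    moreover have "c \<noteq> q" using q(2) sub \<open>c \<in> near S bl vt \<pi> c\<close> by blast
    ultimately have "vt (\<pi> c) = vt (\<pi> q)" using pc by (simp add: transpose_def)
    then have "q \<in> near S bl vt \<pi> c" using q by (simp add: near_def)
    then show False using sub q by blast
  qed
  then show "sc (\<pi> \<circ> transpose p q) \<subset> sc \<pi>"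
    using swap_no_new_short_cycles[OF pc(1) q] x by blast
qed

definition few_cycles :: "nat \<Rightarrow> ('a \<Rightarrow> 'a) set" where
  "few_cycles j = {\<pi>. \<pi> permutes S \<and> card (sc \<pi>) \<le> j}"

lemma finite_few_cycles: "finite (few_cycles j)"
  unfolding few_cycles_def by (rule finite_perms_where[OF finS])

text \<open>Double count the switchings \<open>\<pi> \<mapsto> \<pi> \<circ> transpose p q\<close>.
  A permutation with exactly \<open>j + 1\<close> cycles has at least \<open>card S / 2\<close> of
  them leading to at most \<open>j\<close> cycles; each permutation with at most \<open>j\<close>
  cycles is reached at most \<open>card S * C\<close> times. The ratio is independent of
  \<open>card S\<close>.\<close>

lemma card_few_cycles_step:
  assumes j: "j < J" and N: "2 * ((2 * K) ^ 4 + J) \<le> card S" and N0: "card S > 0"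
  shows "card (few_cycles (Suc j)) \<le> (1 + 2 * ((2 * K) ^ 4 + J)) * card (few_cycles j)"
proof -
  define C where "C = (2 * K) ^ 4 + J"
  define bad where "bad \<pi> p = near4 S bl vt \<pi> p \<union> loop_positions S bl vt \<pi>" for \<pi> p
  have bad_card: "card (bad \<pi> p) \<le> C" if "\<pi> permutes S" "p \<in> S" "card (sc \<pi>) \<le> J" for \<pi> p
    unfolding bad_def C_def using card_Un_le[of "near4 S bl vt \<pi> p" "loop_positions S bl vt \<pi>"]
      card_near4[OF that(1,2)] card_loop_positions[of \<pi>] that(3) by linarith
  have bad_sub: "bad \<pi> p \<subseteq> S" for \<pi> p
    unfolding bad_def near4_def near_def loop_positions_def by auto
  have bad_fin: "finite (bad \<pi> p)" for \<pi> p by (rule finite_subset[OF bad_sub finS])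
  define A where "A = few_cycles (Suc j) - few_cycles j"
  have finA: "finite A" unfolding A_def using finite_few_cycles by blast
  have A: "\<pi> permutes S" "card (sc \<pi>) = Suc j" if "\<pi> \<in> A" for \<pi>
    using that unfolding A_def few_cycles_def by auto
  define T where "T = (SIGMA \<pi>:A. {(p, q). p \<in> S \<and> q \<in> S \<and> \<pi> \<circ> transpose p q \<in> few_cycles j})"
  define T' where "T' = (SIGMA \<pi>:few_cycles j. SIGMA p:S. bad \<pi> p)"
  have perm: "\<pi> \<circ> transpose p q permutes S" if "\<pi> permutes S" "p \<in> S" "q \<in> S" for \<pi> p q
    using that by (intro permutes_compose permutes_swap_id) auto
  have fin2: "finite {(p, q). p \<in> S \<and> q \<in> S \<and> P p q}" for P :: "'a \<Rightarrow> 'a \<Rightarrow> bool"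
    by (rule finite_subset[of _ "S \<times> S"]) (use finS in auto)
  have "card A * card S \<le> 2 * card T"
  proof -
    have "card S \<le> 2 * card {(p, q). p \<in> S \<and> q \<in> S \<and> \<pi> \<circ> transpose p q \<in> few_cycles j}" if pi: "\<pi> \<in> A" for \<pi>
    proof -
      have "sc \<pi> \<noteq> {}" using A(2)[OF pi] by auto
      then obtain p a b c where x: "(p, a, b, c) \<in> sc \<pi>" by (metis ex_in_conv prod_cases4)
      then have p: "p \<in> S" by (simp add: short_cycles_def)
      have "{p} \<times> (S - bad \<pi> p) \<subseteq> {(p, q). p \<in> S \<and> q \<in> S \<and> \<pi> \<circ> transpose p q \<in> few_cycles j}"
      proof
        fix z assume "z \<in> {p} \<times> (S - bad \<pi> p)"
        then obtain q where z: "z = (p, q)" and q: "q \<in> S" "q \<notin> bad \<pi> p" by auto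
        then have "card (sc (\<pi> \<circ> transpose p q)) < Suc j"
          using swap_destroys[OF A(1)[OF pi] x, of q] A(2)[OF pi] by (auto simp: bad_def)
        then show "z \<in> {(p, q). p \<in> S \<and> q \<in> S \<and> \<pi> \<circ> transpose p q \<in> few_cycles j}"
          using z p q perm[OF A(1)[OF pi]] by (auto simp: few_cycles_def)
      qed
      then have "card ({p} \<times> (S - bad \<pi> p)) \<le> card {(p, q). p \<in> S \<and> q \<in> S \<and> \<pi> \<circ> transpose p q \<in> few_cycles j}"
        by (rule card_mono[OF fin2])
      moreover have "card ({p} \<times> (S - bad \<pi> p)) = card S - card (bad \<pi> p)"
        using bad_sub[of \<pi> p] finite_subset[OF bad_sub finS] by (simp add: card_cartesian_product card_Diff_subset)
      moreover have "card (bad \<pi> p) \<le> C" using bad_card A[OF pi] p j by auto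
      ultimately show ?thesis using N unfolding C_def[symmetric] by linarith
    qed
    then have "(\<Sum>\<pi>\<in>A. card S) \<le> (\<Sum>\<pi>\<in>A. 2 * card {(p, q). p \<in> S \<and> q \<in> S \<and> \<pi> \<circ> transpose p q \<in> few_cycles j})"
      by (rule sum_mono)
    then show ?thesis
      unfolding T_def using finA fin2 by (subst card_SigmaI) (auto simp: sum_distrib_left)
  qed
  also have "card T \<le> card T'"
  proof (rule card_inj_on_le[where f = "\<lambda>(\<pi>, p, q). (\<pi> \<circ> transpose p q, p, q)"])
    show "inj_on (\<lambda>(\<pi>, p, q). (\<pi> \<circ> transpose p q, p, q)) T"
    proof (rule inj_onI)
      fix z z' :: "('a \<Rightarrow> 'a) \<times> 'a \<times> 'a"
      assume eq: "(\<lambda>(\<pi>, p, q). (\<pi> \<circ> transpose p q, p, q)) z = (\<lambda>(\<pi>, p, q). (\<pi> \<circ> transpose p q, p, q)) z'"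
      obtain \<pi> p q where z: "z = (\<pi>, p, q)" by (cases z) auto
      obtain \<pi>' p' q' where z': "z' = (\<pi>', p', q')" by (cases z') auto
      have pq: "p' = p" "q' = q" and "\<pi> \<circ> transpose p q = \<pi>' \<circ> transpose p q" using eq z z' by auto
      moreover have "f = (f \<circ> transpose p q) \<circ> transpose p q" for f :: "'a \<Rightarrow> 'a"
        by (simp add: o_assoc[symmetric])
      ultimately have "\<pi> = \<pi>'" by metis
      then show "z = z'" using pq z z' by simp
    qed
    show "(\<lambda>(\<pi>, p, q). (\<pi> \<circ> transpose p q, p, q)) ` T \<subseteq> T'"
    proof (rule image_subsetI)
      fix z assume "z \<in> T"
      then obtain \<pi> p q where z: "z = (\<pi>, p, q)" and pi: "\<pi> \<in> A" and pq: "p \<in> S" "q \<in> S"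
        and new: "\<pi> \<circ> transpose p q \<in> few_cycles j"
        by (auto simp: T_def)
      \<comment> \<open>Switching back increases the number of cycles, so \<open>q\<close> must be
        one of the few positions for which a swap with \<open>p\<close> can create some.\<close>
      have "q \<in> bad (\<pi> \<circ> transpose p q) p"
      proof (rule ccontr)
        assume "q \<notin> bad (\<pi> \<circ> transpose p q) p"
        then have "sc ((\<pi> \<circ> transpose p q) \<circ> transpose p q) \<subseteq> sc (\<pi> \<circ> transpose p q)"
          using pq by (intro swap_no_new_short_cycles) (auto simp: bad_def)
        then have "card (sc \<pi>) \<le> card (sc (\<pi> \<circ> transpose p q))"
          by (intro card_mono short_cycles_finite finS) (simp add: o_assoc[symmetric])
        then show False using A(2)[OF pi] new by (simp add: few_cycles_def)
      qed
      then show "(\<lambda>(\<pi>, p, q). (\<pi> \<circ> transpose p q, p, q)) z \<in> T'" using new pq z by (simp add: T'_def)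
    qed
    show "finite T'" unfolding T'_def
      by (intro finite_SigmaI finite_few_cycles finS bad_fin)
  qed
  also have "card T' \<le> card (few_cycles j) * (card S * C)"
  proof -
    have "card T' = (\<Sum>\<pi>\<in>few_cycles j. \<Sum>p\<in>S. card (bad \<pi> p))"
      unfolding T'_def using finite_few_cycles finS bad_fin by simp
    also have "\<dots> \<le> (\<Sum>\<pi>\<in>few_cycles j. \<Sum>p\<in>S. C)"
      using bad_card j by (intro sum_mono) (auto simp: few_cycles_def)
    finally show ?thesis by simp
  qed
  finally have "card A * card S \<le> (2 * C * card (few_cycles j)) * card S" by (simp add: algebra_simps)
  then have "card A \<le> 2 * C * card (few_cycles j)" using N0 by simp
  moreover have "card (few_cycles (Suc j)) = card A + card (few_cycles j)"
  proof -
    have "few_cycles j \<subseteq> few_cycles (Suc j)" by (auto simp: few_cycles_def)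
    then show ?thesis unfolding A_def using finite_few_cycles
      by (metis card_Diff_subset card_mono le_add_diff_inverse2)
  qed
  ultimately show ?thesis by (simp add: C_def algebra_simps)
qed

lemma card_pairs_le:
  assumes "finite A" "\<And>x. x \<in> A \<Longrightarrow> card {y \<in> B. R x y} \<le> k" "finite B"
  shows "card {(x, y). x \<in> A \<and> y \<in> B \<and> R x y} \<le> card A * k"
proof -
  have "{(x, y). x \<in> A \<and> y \<in> B \<and> R x y} = (SIGMA x:A. {y \<in> B. R x y})" by auto
  then have "card {(x, y). x \<in> A \<and> y \<in> B \<and> R x y} = (\<Sum>x\<in>A. card {y \<in> B. R x y})"
    using assms by simp
  also have "\<dots> \<le> (\<Sum>x\<in>A. k)" using assms by (intro sum_mono) auto
  finally show ?thesis by simp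
qed

text \<open>A bounded mean results from two balances: about \<open>N * K^3\<close> tuples in one
  block, each closed with probability about \<open>K / N\<close>, and about \<open>(N * K)^2\<close>
  tuples over two blocks, each closed with probability about \<open>(K / N)^2\<close>.\<close>

lemma sum_card_short_cycles:
  assumes N: "card S \<ge> 6"
  shows "(\<Sum>\<pi> | \<pi> permutes S. card (sc \<pi>)) \<le> 10 * K ^ 4 * fact (card S)"
proof -
  let ?N = "card S"
  define \<Omega> where "\<Omega> = {\<pi>. \<pi> permutes S}"
  have fin\<Omega>: "finite \<Omega>" unfolding \<Omega>_def by (rule finite_permutations[OF finS])
  define Q where "Q \<pi> = (\<lambda>(p, a, b, c). vt (\<pi> a) = vt (\<pi> b) \<and> vt (\<pi> c) = vt (\<pi> p))" for \<pi> :: "'a \<Rightarrow> 'a"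
  define T where "T = {(p, a, b, c). p \<in> S \<and> a \<in> S \<and> b \<in> S \<and> c \<in> S \<and> bl p = bl a \<and> p \<noteq> a \<and> bl b = bl c \<and> b \<noteq> c \<and> p \<noteq> c}"
  define T1 where "T1 = {(p, a, b, c). p \<in> S \<and> a \<in> S \<and> b \<in> S \<and> c \<in> S \<and> bl a = bl p \<and> bl b = bl p \<and> bl c = bl p \<and> p \<noteq> c}"
  define T2 where "T2 = {(p, a, b, c). p \<in> S \<and> a \<in> S \<and> b \<in> S \<and> c \<in> S \<and> bl a = bl p \<and> bl c = bl b \<and> distinct [p, a, b, c]}"
  \<comment> \<open>If the two blocks differ, all four positions are distinct. Otherwise all lie in
    one block and only the coincidence at \<open>c\<close> and \<open>p\<close> is
    exploited.\<close>
  have T: "T \<subseteq> T1 \<union> T2" unfolding T_def T1_def T2_def by auto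
  have sub: "T1 \<subseteq> S \<times> S \<times> S \<times> S" "T2 \<subseteq> S \<times> S \<times> S \<times> S" unfolding T1_def T2_def by auto
  have finT12: "finite T1" "finite T2" using finS sub by (meson finite_SigmaI finite_subset)+
  then have finT: "finite T" using T by (meson finite_UnI finite_subset)
  define P where "P = {(x, y). x \<in> S \<and> y \<in> S \<and> vt y = vt x}"
  have finP: "finite P" unfolding P_def by (rule finite_subset[of _ "S \<times> S"]) (use finS in auto)
  have cardP: "card P \<le> ?N * K" unfolding P_def
    using vt_class finS by (intro card_pairs_le) auto
  have perms2: "card {\<pi> \<in> \<Omega>. Q \<pi> t} \<le> ?N * K * fact (?N - 2)" if t: "t \<in> T1" for t
  proof -
    obtain p a b c where tt: "t = (p, a, b, c)" by (cases t) auto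
    then have pc: "p \<in> S" "c \<in> S" "p \<noteq> c" using t by (auto simp: T1_def)
    have "{\<pi> \<in> \<Omega>. Q \<pi> t} \<subseteq> (\<Union>z\<in>P. {\<pi>. \<pi> permutes S \<and> (\<forall>i\<in>{c, p}. \<pi> i = (if i = c then fst z else snd z))})"
    proof
      fix \<pi> assume pi: "\<pi> \<in> {\<pi> \<in> \<Omega>. Q \<pi> t}"
      then have "(\<pi> c, \<pi> p) \<in> P" using pc permutes_in_image[of \<pi> S] by (auto simp: P_def Q_def tt \<Omega>_def)
      moreover have "\<pi> \<in> {\<pi>'. \<pi>' permutes S \<and> (\<forall>i\<in>{c, p}. \<pi>' i = (if i = c then fst (\<pi> c, \<pi> p) else snd (\<pi> c, \<pi> p)))}"
        using pi pc by (auto simp: \<Omega>_def)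
      ultimately show "\<pi> \<in> (\<Union>z\<in>P. {\<pi>. \<pi> permutes S \<and> (\<forall>i\<in>{c, p}. \<pi> i = (if i = c then fst z else snd z))})"
        by blast
    qed
    then have "card {\<pi> \<in> \<Omega>. Q \<pi> t} \<le> card (\<Union>z\<in>P. {\<pi>. \<pi> permutes S \<and> (\<forall>i\<in>{c, p}. \<pi> i = (if i = c then fst z else snd z))})"
      using finP finS by (intro card_mono finite_UN_I finite_perms_where)
    also have "\<dots> \<le> card P * fact (?N - 2)"
    proof (rule card_UN_le_mult[OF finP])
      fix z
      show "card {\<pi>. \<pi> permutes S \<and> (\<forall>i\<in>{c, p}. \<pi> i = (if i = c then fst z else snd z))} \<le> fact (?N - 2)"
        using card_perms_prescribed[OF finS, of "{c, p}" "\<lambda>i. if i = c then fst z else snd z"] pc by (simp add: numeral_2_eq_2)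
    qed
    also have "\<dots> \<le> ?N * K * fact (?N - 2)" using cardP by (intro mult_right_mono) auto
    finally show ?thesis .
  qed
  have perms4: "card {\<pi> \<in> \<Omega>. Q \<pi> t} \<le> (?N * K)\<^sup>2 * fact (?N - 4)" if t: "t \<in> T2" for t
  proof -
    obtain p a b c where tt: "t = (p, a, b, c)" by (cases t) auto
    then have pc: "p \<in> S" "a \<in> S" "b \<in> S" "c \<in> S" "distinct [p, a, b, c]" using t by (auto simp: T2_def)
    define g where "g z i = (if i = b then fst (fst z) else if i = a then snd (fst z) else if i = c then fst (snd z) else snd (snd z))"
      for z :: "('a \<times> 'a) \<times> ('a \<times> 'a)" and i
    have "{\<pi> \<in> \<Omega>. Q \<pi> t} \<subseteq> (\<Union>z\<in>P \<times> P. {\<pi>. \<pi> permutes S \<and> (\<forall>i\<in>{p, a, b, c}. \<pi> i = g z i)})"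
    proof
      fix \<pi> assume pi: "\<pi> \<in> {\<pi> \<in> \<Omega>. Q \<pi> t}"
      then have "((\<pi> b, \<pi> a), (\<pi> c, \<pi> p)) \<in> P \<times> P"
        using pc permutes_in_image[of \<pi> S] by (auto simp: P_def Q_def tt \<Omega>_def)
      moreover have "\<pi> \<in> {\<pi>'. \<pi>' permutes S \<and> (\<forall>i\<in>{p, a, b, c}. \<pi>' i = g ((\<pi> b, \<pi> a), (\<pi> c, \<pi> p)) i)}"
        using pi pc by (auto simp: \<Omega>_def g_def)
      ultimately show "\<pi> \<in> (\<Union>z\<in>P \<times> P. {\<pi>. \<pi> permutes S \<and> (\<forall>i\<in>{p, a, b, c}. \<pi> i = g z i)})"
        by blast
    qed
    then have "card {\<pi> \<in> \<Omega>. Q \<pi> t} \<le> card (\<Union>z\<in>P \<times> P. {\<pi>. \<pi> permutes S \<and> (\<forall>i\<in>{p, a, b, c}. \<pi> i = g z i)})"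
      using finP finS by (intro card_mono finite_UN_I finite_perms_where finite_cartesian_product)
    also have "\<dots> \<le> card (P \<times> P) * fact (?N - 4)"
    proof (rule card_UN_le_mult)
      fix z
      have "card {p, a, b, c} = 4" using pc(5) by simp
      then show "card {\<pi>. \<pi> permutes S \<and> (\<forall>i\<in>{p, a, b, c}. \<pi> i = g z i)} \<le> fact (?N - 4)"
        using card_perms_prescribed[OF finS, of "{p, a, b, c}" "g z"] pc by simp
    qed (use finP in auto)
    also have "\<dots> \<le> (?N * K)\<^sup>2 * fact (?N - 4)"
      using cardP by (auto simp: card_cartesian_product power2_eq_square intro!: mult_mono)
    finally show ?thesis .
  qed
  have blc: "card {a \<in> S. bl a = bl p} \<le> K" if "p \<in> S" for p using bl_class[OF that] .
  have cardT1: "card T1 \<le> ?N * (K * (K * K))"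
  proof -
    have "T1 \<subseteq> (SIGMA p:S. {a \<in> S. bl a = bl p} \<times> ({b \<in> S. bl b = bl p} \<times> {c \<in> S. bl c = bl p}))"
      unfolding T1_def by auto
    then have "card T1 \<le> card (SIGMA p:S. {a \<in> S. bl a = bl p} \<times> ({b \<in> S. bl b = bl p} \<times> {c \<in> S. bl c = bl p}))"
      using finS by (intro card_mono) auto
    also have "\<dots> = (\<Sum>p\<in>S. card {a \<in> S. bl a = bl p} * (card {a \<in> S. bl a = bl p} * card {a \<in> S. bl a = bl p}))"
      using finS by (simp add: card_cartesian_product)
    also have "\<dots> \<le> (\<Sum>p\<in>S. K * (K * K))"
      using blc by (intro sum_mono mult_mono) auto
    finally show ?thesis by simp
  qed
  have cardT2: "card T2 \<le> (?N * K)\<^sup>2"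
  proof -
    let ?B = "{(p, a). p \<in> S \<and> a \<in> S \<and> bl a = bl p}"
    have cB: "card ?B \<le> ?N * K" using blc finS by (intro card_pairs_le) auto
    have "card T2 \<le> card (?B \<times> ?B)"
    proof (rule card_inj_on_le[where f = "\<lambda>(p, a, b, c). ((p, a), (b, c))"])
      show "finite (?B \<times> ?B)" by (rule finite_subset[of _ "(S \<times> S) \<times> (S \<times> S)"]) (use finS in auto)
    qed (auto simp: T2_def inj_on_def)
    also have "\<dots> \<le> (?N * K)\<^sup>2"
      using cB by (auto simp: card_cartesian_product power2_eq_square intro!: mult_mono)
    finally show ?thesis .
  qed
  have "(\<Sum>\<pi>\<in>\<Omega>. card (sc \<pi>)) = (\<Sum>\<pi>\<in>\<Omega>. card {t \<in> T. Q \<pi> t})"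
    by (intro sum.cong refl arg_cong[where f = card]) (auto simp: short_cycles_def T_def Q_def)
  also have "\<dots> = (\<Sum>t\<in>T. card {\<pi> \<in> \<Omega>. Q \<pi> t})"
    by (rule sum_multicount_gen[OF fin\<Omega> finT]) simp
  also have "\<dots> \<le> (\<Sum>t\<in>T1 \<union> T2. card {\<pi> \<in> \<Omega>. Q \<pi> t})"
    using T finT12 by (intro sum_mono2) auto
  also have "\<dots> \<le> (\<Sum>t\<in>T1. card {\<pi> \<in> \<Omega>. Q \<pi> t}) + (\<Sum>t\<in>T2. card {\<pi> \<in> \<Omega>. Q \<pi> t})"
    using sum.union_inter[OF finT12, of "\<lambda>t. card {\<pi> \<in> \<Omega>. Q \<pi> t}"] by linarith
  also have "\<dots> \<le> (\<Sum>t\<in>T1. ?N * K * fact (?N - 2)) + (\<Sum>t\<in>T2. (?N * K)\<^sup>2 * fact (?N - 4))"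
    using perms2 perms4 by (intro add_mono sum_mono)
  also have "\<dots> = card T1 * (?N * K * fact (?N - 2)) + card T2 * ((?N * K)\<^sup>2 * fact (?N - 4))" by simp
  also have "\<dots> \<le> (?N * (K * (K * K))) * (?N * K * fact (?N - 2)) + (?N * K)\<^sup>2 * ((?N * K)\<^sup>2 * fact (?N - 4))"
    using cardT1 cardT2 by (intro add_mono mult_right_mono) auto
  also have "\<dots> = K ^ 4 * (?N * ?N * fact (?N - 2) + ?N ^ 4 * fact (?N - 4))"
    by (simp add: eval_nat_numeral algebra_simps)
  also have "\<dots> \<le> K ^ 4 * (10 * fact ?N)"
  proof (rule mult_left_mono)
    \<comment> \<open>The constant is \<open>10 = 2 + 8\<close>: replacing falling factorials by
      powers costs a factor 2 for each of one, respectively three, factors;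
      \<open>M + 4 \<le> 2 * (M + 1)\<close> is where \<open>?N \<ge> 6\<close> enters.\<close>
    define M where "M = ?N - 4"
    have M: "?N = M + 4" "M \<ge> 2" using N by (auto simp: M_def)
    have f2: "fact (?N - 2) = (M + 2) * ((M + 1) * fact M)"
      by (simp add: M(1) eval_nat_numeral)
    have f0: "fact ?N = (M + 4) * ((M + 3) * ((M + 2) * ((M + 1) * fact M)))"
      by (simp add: M(1) eval_nat_numeral)
    have "?N * ?N * fact (?N - 2) \<le> (M + 4) * (2 * (M + 3)) * fact (?N - 2)"
      unfolding M(1) by (intro mult_right_mono mult_left_mono) auto
    also have "\<dots> = 2 * fact ?N" unfolding f2 f0 by (simp only: mult.assoc mult.left_commute)
    finally have 1: "?N * ?N * fact (?N - 2) \<le> 2 * fact ?N" .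
    have "?N ^ 4 * fact (?N - 4) = (M + 4) * ((M + 4) * ((M + 4) * ((M + 4) * fact M)))"
      unfolding M(1) power4_eq_xxxx mult.assoc by simp
    also have "\<dots> \<le> (M + 4) * ((2 * (M + 3)) * ((2 * (M + 2)) * ((2 * (M + 1)) * fact M)))"
      using M(2) by (intro mult_left_mono mult_mono) auto
    also have "\<dots> = 8 * fact ?N"
    proof -
      have "a * ((2 * b) * ((2 * c) * ((2 * e) * x))) = 8 * (a * (b * (c * (e * x))))" for a b c e x :: nat
        by simp
      then show ?thesis unfolding f0 .
    qed
    finally have "?N ^ 4 * fact (?N - 4) \<le> 8 * fact ?N" .
    with 1 show "?N * ?N * fact (?N - 2) + ?N ^ 4 * fact (?N - 4) \<le> 10 * fact ?N"
      by linarith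
  qed simp
  finally show ?thesis by (simp add: \<Omega>_def)
qed

text \<open>\<open>J\<close> is twice the bound on the mean, so by Markov's inequality half of all
  permutations have at most \<open>J\<close> cycles; \<open>J\<close> switching steps down to 0 lose
  a constant factor each.\<close>

lemma perm_prob_no_short_cycles:
  assumes J: "J = 20 * K ^ 4" and N: "2 * ((2 * K) ^ 4 + J) + 6 \<le> card S"
  shows "perm_prob S (\<lambda>\<pi>. sc \<pi> = {}) \<ge> 1 / (2 * (1 + 2 * ((2 * K) ^ 4 + J)) ^ J)"
proof -
  define C where "C = 1 + 2 * ((2 * K) ^ 4 + J)"
  let ?\<Omega> = "{\<pi>. \<pi> permutes S}"
  have fin: "finite ?\<Omega>" by (rule finite_permutations[OF finS])
  have card\<Omega>: "card ?\<Omega> = fact (card S)" by (rule card_permutations[OF refl finS])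
  have half: "fact (card S) \<le> 2 * card (few_cycles J)"
  proof -
    have "(Suc J) * card (?\<Omega> - few_cycles J) = (\<Sum>\<pi>\<in>?\<Omega> - few_cycles J. Suc J)" by simp
    also have "\<dots> \<le> (\<Sum>\<pi>\<in>?\<Omega> - few_cycles J. card (sc \<pi>))"
      by (rule sum_mono) (auto simp: few_cycles_def)
    also have "\<dots> \<le> (\<Sum>\<pi>\<in>?\<Omega>. card (sc \<pi>))" using fin by (intro sum_mono2) auto
    also have "\<dots> \<le> 10 * K ^ 4 * fact (card S)" using sum_card_short_cycles N by simp
    finally have "2 * (Suc J * card (?\<Omega> - few_cycles J)) \<le> J * fact (card S)" using J by simp
    also have "\<dots> \<le> Suc J * fact (card S)" by simp
    finally have "Suc J * (2 * card (?\<Omega> - few_cycles J)) \<le> Suc J * fact (card S)"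
      by (simp only: mult.left_commute)
    then have "2 * card (?\<Omega> - few_cycles J) \<le> fact (card S)" by (simp only: Suc_mult_le_cancel1)
    moreover have "card (?\<Omega> - few_cycles J) = fact (card S) - card (few_cycles J)"
      using finite_few_cycles card\<Omega> by (subst card_Diff_subset) (auto simp: few_cycles_def)
    ultimately show ?thesis by linarith
  qed
  have "card (few_cycles (J - i)) * C ^ i \<ge> card (few_cycles J)" if "i \<le> J" for i
    using that
  proof (induction i)
    case (Suc i)
    then have "J - i = Suc (J - Suc i)" by simp
    then have "card (few_cycles (J - i)) \<le> C * card (few_cycles (J - Suc i))"
      using card_few_cycles_step[of "J - Suc i" J] N Suc.prems unfolding C_def by simp
    then have "card (few_cycles (J - i)) * C ^ i \<le> (C * card (few_cycles (J - Suc i))) * C ^ i"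
      by (rule mult_right_mono) simp
    moreover have "card (few_cycles J) \<le> card (few_cycles (J - i)) * C ^ i" using Suc by simp
    ultimately have "card (few_cycles J) \<le> (C * card (few_cycles (J - Suc i))) * C ^ i" by (rule order.trans[rotated])
    also have "\<dots> = card (few_cycles (J - Suc i)) * C ^ Suc i" by (simp only: power_Suc mult.assoc mult.commute mult.left_commute)
    finally show ?case .
  qed simp
  from this[of J] have "card (few_cycles J) \<le> card (few_cycles 0) * C ^ J" by simp
  with half have "fact (card S) \<le> 2 * (card (few_cycles 0) * C ^ J)" by linarith
  then have "real (fact (card S)) \<le> real (2 * (card (few_cycles 0) * C ^ J))" by (rule of_nat_mono)
  then have "fact (card S) \<le> real (card (few_cycles 0)) * (2 * real C ^ J)" by simp
  moreover have "few_cycles 0 = {\<pi>. \<pi> permutes S \<and> sc \<pi> = {}}"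
    by (simp add: few_cycles_def card_0_eq[OF short_cycles_finite[OF finS]])
  moreover have "C > 0" by (simp add: C_def)
  ultimately show ?thesis
    unfolding perm_prob_def C_def[symmetric] by (simp add: field_simps)
qed

end

section \<open>Configurations and regular hypergraphs\<close>

definition edge :: "nat \<Rightarrow> (nat \<times> nat \<Rightarrow> nat) \<Rightarrow> nat \<Rightarrow> nat set" where
  "edge r f e = (\<lambda>i. f (e, i)) ` {..<r}"

definition simple :: "nat \<Rightarrow> nat \<Rightarrow> (nat \<times> nat \<Rightarrow> nat) \<Rightarrow> bool" where
  "simple r m f \<longleftrightarrow> (\<forall>e<m. inj_on (\<lambda>i. f (e, i)) {..<r}) \<and> inj_on (edge r f) {..<m}"

lemma edge_cong: "(\<And>i. i < r \<Longrightarrow> f (e, i) = g (e, i)) \<Longrightarrow> edge r f e = edge r g e"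
  by (auto simp: edge_def)

lemma simple_cong:
  assumes "\<And>x. x \<in> {..<m} \<times> {..<r} \<Longrightarrow> f x = g x"
  shows "simple r m f = simple r m g" "edge r f ` {..<m} = edge r g ` {..<m}"
proof -
  have 1: "edge r f e = edge r g e" if "e < m" for e
    using assms that by (intro edge_cong) auto
  have 2: "inj_on (\<lambda>i. f (e, i)) {..<r} = inj_on (\<lambda>i. g (e, i)) {..<r}" if "e < m" for e
    using assms that by (intro inj_on_cong) auto
  have 3: "inj_on (edge r f) {..<m} = inj_on (edge r g) {..<m}"
    using 1 by (intro inj_on_cong) auto
  show "simple r m f = simple r m g" unfolding simple_def using 2 3 by auto
  show "edge r f ` {..<m} = edge r g ` {..<m}" using 1 by (intro image_cong) auto
qed

lemma card_reg_unif_hypergraph: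
  assumes H: "H \<in> reg_unif_hypergraphs r d n"
  shows "finite H" "card H * r = n * d"
proof -
  have sub: "H \<subseteq> Pow {1..n}" using H by (auto simp: reg_unif_hypergraphs_def)
  then show fin: "finite H" by (rule finite_subset) simp
  have "(\<Sum>v\<in>{1..n}. card {e \<in> H. v \<in> e}) = (\<Sum>e\<in>H. card {v \<in> {1..n}. v \<in> e})"
    by (rule sum_multicount_gen) (use fin in auto)
  moreover have "(\<Sum>v\<in>{1..n}. card {e \<in> H. v \<in> e}) = (\<Sum>v\<in>{1..n}. d)"
    using H by (intro sum.cong) (auto simp: reg_unif_hypergraphs_def)
  moreover have "(\<Sum>e\<in>H. card {v \<in> {1..n}. v \<in> e}) = (\<Sum>e\<in>H. r)"
  proof (rule sum.cong[OF refl])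
    fix e assume e: "e \<in> H"
    then have "{v \<in> {1..n}. v \<in> e} = e" using sub by blast
    then show "card {v \<in> {1..n}. v \<in> e} = r" using H e by (simp add: reg_unif_hypergraphs_def)
  qed
  ultimately show "card H * r = n * d" by simp
qed

text \<open>Points and positions share one index set: \<open>(e, i)\<close> is slot \<open>i\<close>
  of block \<open>e\<close>, \<open>vt\<close> labels a point by its vertex, and \<pi> tells which
  point sits in a slot. Hence \<open>vt \<circ> \<pi>\<close> is the random word of vertices, and
  each vertex owns \<open>d\<close> points.\<close>

locale config =
  fixes r d n m :: nat and vt :: "nat \<times> nat \<Rightarrow> nat"
  assumes r2: "2 \<le> r" and d1: "1 \<le> d"
    and vt_in: "vt \<in> {..<m} \<times> {..<r} \<rightarrow> {1..n}"
    and vt_fib: "\<And>v. v \<in> {1..n} \<Longrightarrow> card {x \<in> {..<m} \<times> {..<r}. vt x = v} = d"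
begin

abbreviation "S \<equiv> {..<m} \<times> {..<r}"

abbreviation "hgraph \<pi> \<equiv> edge r (vt \<circ> \<pi>) ` {..<m}"

lemma finS: "finite S" by simp

lemma card_S: "card S = m * r" by (simp add: card_cartesian_product)

lemma mr: "m * r = n * d"
proof -
  have "card S = (\<Sum>v\<in>{1..n}. card {x \<in> S. vt x = v})"
  proof -
    have "S = (\<Union>v\<in>{1..n}. {x \<in> S. vt x = v})" using vt_in by auto
    then have "card S = card (\<Union>v\<in>{1..n}. {x \<in> S. vt x = v})" by simp
    also have "\<dots> = (\<Sum>v\<in>{1..n}. card {x \<in> S. vt x = v})"
      by (rule card_UN_disjoint) auto
    finally show ?thesis .
  qed
  also have "\<dots> = n * d" using vt_fib by simp
  finally show ?thesis using card_S by simp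
qed

lemma word_degree:
  assumes "f \<in> S \<rightarrow> V" "\<forall>e<m. inj_on (\<lambda>i. f (e, i)) {..<r}"
  shows "card {x \<in> S. f x = v} = card {e. e < m \<and> v \<in> edge r f e}"
proof -
  have "bij_betw fst {x \<in> S. f x = v} {e. e < m \<and> v \<in> edge r f e}"
  proof (rule bij_betw_imageI)
    show "inj_on fst {x \<in> S. f x = v}"
      using assms(2) by (fastforce simp: inj_on_def)
    show "fst ` {x \<in> S. f x = v} = {e. e < m \<and> v \<in> edge r f e}"
      by (force simp: edge_def image_iff)
  qed
  then show ?thesis by (rule bij_betw_same_card)
qed

lemma hgraph_reg_unif:
  assumes f: "f \<in> words S {1..n} (\<lambda>_. d)" and s: "simple r m f"
  shows "edge r f ` {..<m} \<in> reg_unif_hypergraphs r d n"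
proof -
  have fS: "f \<in> S \<rightarrow> {1..n}" using f by (auto simp: words_def)
  have inj: "\<forall>e<m. inj_on (\<lambda>i. f (e, i)) {..<r}" "inj_on (edge r f) {..<m}" using s by (auto simp: simple_def)
  have "card {e \<in> edge r f ` {..<m}. v \<in> e} = d" if v: "v \<in> {1..n}" for v
  proof -
    have "{e \<in> edge r f ` {..<m}. v \<in> e} = edge r f ` {e. e < m \<and> v \<in> edge r f e}" by auto
    also have "card \<dots> = card {e. e < m \<and> v \<in> edge r f e}"
      by (rule card_image, rule inj_on_subset[OF inj(2)]) auto
    also have "\<dots> = card {x \<in> S. f x = v}" using word_degree[OF fS inj(1)] by simp
    also have "\<dots> = d" using f v by (auto simp: words_def)
    finally show ?thesis .
  qed
  moreover have "edge r f e \<subseteq> {1..n}" if "e < m" for e using fS that by (auto simp: edge_def)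
  moreover have "card (edge r f e) = r" if "e < m" for e
    unfolding edge_def using inj(1) that by (subst card_image) auto
  ultimately show ?thesis by (auto simp: reg_unif_hypergraphs_def)
qed

text \<open>A simple word giving \<open>H\<close> is an ordering of its \<open>m\<close> edges
  together with an ordering of the \<open>r\<close> vertices of each. That the number does not
  depend on \<open>H\<close> makes the configuration model uniform when conditioned on
  simplicity.\<close>

lemma card_words_of_hypergraph:
  assumes H: "H \<in> reg_unif_hypergraphs r d n"
  shows "card {f \<in> words S {1..n} (\<lambda>_. d). simple r m f \<and> edge r f ` {..<m} = H} = fact m * fact r ^ m"
proof -
  have finH: "finite H" by (rule card_reg_unif_hypergraph[OF H])
  have "card H * r = m * r" using card_reg_unif_hypergraph(2)[OF H] mr by simp
  then have cH: "card H = m" using r2 by simp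
  have He: "finite e" "card e = r" "e \<subseteq> {1..n}" if "e \<in> H" for e
    using H that by (auto simp: reg_unif_hypergraphs_def intro: finite_subset)
  define B where "B = {h \<in> {..<m} \<rightarrow>\<^sub>E H. inj_on h {..<m}}"
  define G where "G h = PiE {..<m} (\<lambda>e. {b \<in> {..<r} \<rightarrow>\<^sub>E h e. inj_on b {..<r}})" for h :: "nat \<Rightarrow> nat set"
  let ?M = "{f \<in> words S {1..n} (\<lambda>_. d). simple r m f \<and> edge r f ` {..<m} = H}"
  define \<Phi> where "\<Phi> f = ((\<lambda>e\<in>{..<m}. edge r f e), (\<lambda>e\<in>{..<m}. \<lambda>i\<in>{..<r}. f (e, i)))" for f :: "nat \<times> nat \<Rightarrow> nat"
  define \<Psi> where "\<Psi> z = (\<lambda>x\<in>S. snd z (fst x) (snd x))" for z :: "(nat \<Rightarrow> nat set) \<times> (nat \<Rightarrow> nat \<Rightarrow> nat)"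
  have "bij_betw \<Phi> ?M (Sigma B G)"
  proof (rule bij_betw_byWitness[where f' = \<Psi>])
    show "\<forall>f\<in>?M. \<Psi> (\<Phi> f) = f"
      by (auto simp: \<Psi>_def \<Phi>_def words_def PiE_def extensional_def fun_eq_iff)
    show "\<Phi> ` ?M \<subseteq> Sigma B G"
    proof (rule image_subsetI)
      fix f assume f: "f \<in> ?M"
      then have 1: "(\<lambda>e\<in>{..<m}. edge r f e) \<in> B"
        unfolding B_def simple_def by (auto simp: inj_on_def)
      have "(\<lambda>e\<in>{..<m}. \<lambda>i\<in>{..<r}. f (e, i)) \<in> G (\<lambda>e\<in>{..<m}. edge r f e)"
        using f unfolding G_def simple_def by (auto simp: edge_def inj_on_def)
      with 1 show "\<Phi> f \<in> Sigma B G" by (simp add: \<Phi>_def)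
    qed
    have key: "\<Psi> (h, F) \<in> ?M \<and> \<Phi> (\<Psi> (h, F)) = (h, F)" if h: "h \<in> B" and F: "F \<in> G h" for h F
    proof -
      define f where "f = \<Psi> (h, F)"
      have fv: "f (e, i) = F e i" if "e < m" "i < r" for e i using that by (simp add: f_def \<Psi>_def)
      have hH: "h e \<in> H" if "e < m" for e using h that by (auto simp: B_def)
      have Fe: "F e \<in> {..<r} \<rightarrow>\<^sub>E h e" "inj_on (F e) {..<r}" if "e < m" for e
        using F that by (auto simp: G_def)
      have inj: "\<forall>e<m. inj_on (\<lambda>i. f (e, i)) {..<r}"
        using Fe(2) fv by (auto simp: inj_on_def)
      have edge: "edge r f e = h e" if e: "e < m" for e
      proof (rule card_subset_eq[OF He(1)[OF hH[OF e]]])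
        show "edge r f e \<subseteq> h e" using Fe(1)[OF e] fv[OF e] by (auto simp: edge_def)
        show "card (edge r f e) = card (h e)"
          unfolding edge_def using inj e He(2)[OF hH[OF e]] by (subst card_image) auto
      qed
      have injh: "inj_on h {..<m}" using h by (simp add: B_def)
      have imh: "h ` {..<m} = H"
      proof (rule card_subset_eq[OF finH])
        show "h ` {..<m} \<subseteq> H" using hH by auto
        show "card (h ` {..<m}) = card H" using injh cH by (simp add: card_image)
      qed
      have simple: "simple r m f"
        unfolding simple_def using inj injh edge by (auto simp: inj_on_def)
      have fS: "f \<in> S \<rightarrow>\<^sub>E {1..n}"
      proof (rule PiE_I)
        fix x assume "x \<in> S"
        then obtain e i where x: "x = (e, i)" "e < m" "i < r" by auto
        then have "f x \<in> h e" using fv Fe(1)[of e] by auto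
        then show "f x \<in> {1..n}" using He(3)[OF hH[OF x(2)]] by blast
      next
        fix x assume "x \<notin> S"
        then show "f x = undefined" unfolding f_def \<Psi>_def by (simp only: restrict_apply if_False)
      qed
      have "card {x \<in> S. f x = v} = d" if v: "v \<in> {1..n}" for v
      proof -
        have "card {x \<in> S. f x = v} = card {e. e < m \<and> v \<in> edge r f e}"
          using fS inj by (intro word_degree) auto
        also have "\<dots> = card (h ` {e. e < m \<and> v \<in> edge r f e})"
          by (rule card_image[symmetric], rule inj_on_subset[OF injh]) auto
        also have "h ` {e. e < m \<and> v \<in> edge r f e} = {e \<in> H. v \<in> e}"
          using edge imh by auto
        also have "card \<dots> = d" using H v by (simp add: reg_unif_hypergraphs_def)
        finally show ?thesis .
      qed
      then have "f \<in> words S {1..n} (\<lambda>_. d)" using fS by (simp add: words_def)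
      moreover have "edge r f ` {..<m} = H" using edge imh by auto
      moreover have "\<Phi> f = (h, F)"
      proof -
        have "(\<lambda>e\<in>{..<m}. edge r f e) = h"
          using edge h by (auto simp: B_def PiE_def extensional_def fun_eq_iff)
        moreover have "(\<lambda>e\<in>{..<m}. \<lambda>i\<in>{..<r}. f (e, i)) = F"
        proof
          fix e show "(\<lambda>e\<in>{..<m}. \<lambda>i\<in>{..<r}. f (e, i)) e = F e"
          proof (cases "e < m")
            case True
            then show ?thesis using Fe(1)[OF True] fv[OF True]
              by (auto simp: PiE_def extensional_def fun_eq_iff)
          next
            case False
            then show ?thesis using F by (auto simp: G_def PiE_def extensional_def)
          qed
        qed
        ultimately show ?thesis by (simp add: \<Phi>_def)
      qed
      ultimately show ?thesis using simple unfolding f_def by blast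
    qed
    show "\<forall>z\<in>Sigma B G. \<Phi> (\<Psi> z) = z" using key by auto
    show "\<Psi> ` Sigma B G \<subseteq> ?M"
    proof (rule image_subsetI)
      fix z assume "z \<in> Sigma B G"
      then show "\<Psi> z \<in> ?M" using key[of "fst z" "snd z"] by (cases z) simp
    qed
  qed
  then have "card ?M = card (Sigma B G)" by (rule bij_betw_same_card)
  also have "\<dots> = (\<Sum>h\<in>B. card (G h))"
  proof (rule card_SigmaI)
    show "finite B" unfolding B_def using finH
      by (intro finite_subset[OF _ finite_PiE[of "{..<m}" "\<lambda>_. H"]]) auto
    show "\<forall>h\<in>B. finite (G h)"
    proof
      fix h assume h: "h \<in> B"
      have "finite {b \<in> {..<r} \<rightarrow>\<^sub>E h e. inj_on b {..<r}}" if "e < m" for e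
        using h that He(1) unfolding B_def
        by (intro finite_subset[OF _ finite_PiE[of "{..<r}" "\<lambda>_. h e"]]) auto
      then show "finite (G h)" unfolding G_def by (intro finite_PiE) auto
    qed
  qed
  also have "\<dots> = (\<Sum>h\<in>B. fact r ^ m)"
  proof (rule sum.cong[OF refl])
    fix h assume h: "h \<in> B"
    have "card {b \<in> {..<r} \<rightarrow>\<^sub>E h e. inj_on b {..<r}} = fact r" if e: "e < m" for e
    proof -
      have "h e \<in> H" using h e by (auto simp: B_def)
      then show ?thesis using card_inj_funcset_eq[of "{..<r}" "h e"] He by simp
    qed
    then show "card (G h) = fact r ^ m" unfolding G_def by (simp add: card_PiE)
  qed
  also have "\<dots> = fact m * fact r ^ m"
    using card_inj_funcset_eq[of "{..<m}" H] finH cH by (simp add: B_def)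
  finally show ?thesis .
qed

lemma finite_reg_unif: "finite (reg_unif_hypergraphs r d n)"
  by (rule finite_subset[of _ "Pow (Pow {1..n})"]) (auto simp: reg_unif_hypergraphs_def)

lemma hprob_eq:
  assumes pos: "perm_prob S (\<lambda>\<pi>. simple r m (vt \<circ> \<pi>)) > 0"
  shows "hprob r d n P = perm_prob S (\<lambda>\<pi>. simple r m (vt \<circ> \<pi>) \<and> P (hgraph \<pi>)) / perm_prob S (\<lambda>\<pi>. simple r m (vt \<circ> \<pi>))"
proof -
  let ?W = "words S {1..n} (\<lambda>_. d)"
  define \<kappa> where "\<kappa> = (fact m * fact r ^ m :: nat)"
  have key: "perm_prob S (\<lambda>\<pi>. simple r m (vt \<circ> \<pi>) \<and> Q (hgraph \<pi>)) =
      real (\<kappa> * card {H \<in> reg_unif_hypergraphs r d n. Q H}) / real (card ?W)" for Q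
  proof -
    let ?M = "{f \<in> ?W. simple r m f \<and> Q (edge r f ` {..<m})}"
    have eq: "(simple r m (vt \<circ> \<pi>) \<and> Q (hgraph \<pi>)) \<longleftrightarrow> restrict (vt \<circ> \<pi>) S \<in> ?M" if "\<pi> permutes S" for \<pi>
    proof -
      have "restrict (vt \<circ> \<pi>) S \<in> ?W"
        by (rule restrict_comp_in_words[OF finS vt_in vt_fib that])
      moreover have "simple r m (restrict (vt \<circ> \<pi>) S) = simple r m (vt \<circ> \<pi>)"
        "edge r (restrict (vt \<circ> \<pi>) S) ` {..<m} = hgraph \<pi>"
        by (rule simple_cong; simp)+
      ultimately show ?thesis by simp
    qed
    have "perm_prob S (\<lambda>\<pi>. simple r m (vt \<circ> \<pi>) \<and> Q (hgraph \<pi>)) = perm_prob S (\<lambda>\<pi>. restrict (vt \<circ> \<pi>) S \<in> ?M)"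
      unfolding perm_prob_def using eq by (metis (no_types, lifting) Collect_cong)
    also have "\<dots> = real (card ?M) / real (card ?W)"
      by (rule perm_prob_word(1)[OF finS _ vt_in vt_fib]) auto
    also have "card ?M = \<kappa> * card {H \<in> reg_unif_hypergraphs r d n. Q H}"
    proof -
      have "?M = (\<Union>H\<in>{H \<in> reg_unif_hypergraphs r d n. Q H}. {f \<in> ?W. simple r m f \<and> edge r f ` {..<m} = H})"
        using hgraph_reg_unif by auto
      then have "card ?M = card (\<Union>H\<in>{H \<in> reg_unif_hypergraphs r d n. Q H}. {f \<in> ?W. simple r m f \<and> edge r f ` {..<m} = H})"
        by simp
      also have "\<dots> = (\<Sum>H\<in>{H \<in> reg_unif_hypergraphs r d n. Q H}. card {f \<in> ?W. simple r m f \<and> edge r f ` {..<m} = H})"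
        using finite_reg_unif words_finite[OF finS, of "{1..n}" "\<lambda>_. d"] by (intro card_UN_disjoint) auto
      also have "\<dots> = (\<Sum>H\<in>{H \<in> reg_unif_hypergraphs r d n. Q H}. \<kappa>)"
        using card_words_of_hypergraph by (intro sum.cong) (auto simp: \<kappa>_def)
      finally show ?thesis by simp
    qed
    finally show ?thesis .
  qed
  have W: "card ?W > 0" by (rule perm_prob_word(2)[OF finS _ vt_in vt_fib, where M = "{}"]) auto
  have k: "\<kappa> > 0" by (simp add: \<kappa>_def)
  have "perm_prob S (\<lambda>\<pi>. simple r m (vt \<circ> \<pi>)) = real (\<kappa> * card (reg_unif_hypergraphs r d n)) / real (card ?W)"
    using key[of "\<lambda>_. True"] by simp
  then show ?thesis using key[of P] W k by (simp add: hprob_def)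
qed

text \<open>A repeated vertex in a block is a degenerate cycle. For two equal edges, the vertices in
  the first two slots of one recur in the other, which already closes a 4-cycle; this uses
  \<open>r \<ge> 2\<close>.\<close>

lemma simple_of_no_short_cycles:
  assumes sc: "short_cycles S fst vt \<pi> = {}"
  shows "simple r m (vt \<circ> \<pi>)"
proof -
  let ?f = "vt \<circ> \<pi>"
  have inj: "inj_on (\<lambda>i. ?f (e, i)) {..<r}" if e: "e < m" for e
  proof (rule inj_onI, rule ccontr)
    fix i j assume "i \<in> {..<r}" "j \<in> {..<r}" "?f (e, i) = ?f (e, j)" "i \<noteq> j"
    then have "((e, i), (e, j), (e, i), (e, j)) \<in> short_cycles S fst vt \<pi>"
      using e by (auto simp: short_cycles_def)
    then show False using sc by simp
  qed
  have "inj_on (edge r ?f) {..<m}"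
  proof (rule inj_onI, rule ccontr)
    fix e e' assume e: "e \<in> {..<m}" "e' \<in> {..<m}" "edge r ?f e = edge r ?f e'" "e \<noteq> e'"
    have 01: "0 < r" "1 < r" using r2 by auto
    have "?f (e, 0) \<in> edge r ?f e" "?f (e, 1) \<in> edge r ?f e"
      using 01 unfolding edge_def by blast+
    then obtain j0 j1 where j: "j0 < r" "j1 < r" "?f (e, 0) = ?f (e', j0)" "?f (e, 1) = ?f (e', j1)"
      unfolding e(3) by (auto simp: edge_def)
    have "?f (e, 0) \<noteq> ?f (e, 1)" using inj[of e] e 01 by (auto simp: inj_on_def)
    then have "j0 \<noteq> j1" using j by auto
    then have "((e, 0), (e, 1), (e', j1), (e', j0)) \<in> short_cycles S fst vt \<pi>"
      using e j 01 by (auto simp: short_cycles_def)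
    then show False using sc by simp
  qed
  then show ?thesis using inj by (simp add: simple_def)
qed

end

section \<open>First moments\<close>

lemma binomial_le_exp_pow:
  assumes "k \<ge> 1"
  shows "real (n choose k) \<le> (exp 1 * real n / real k) ^ k"
proof -
  have "real ((n choose k) * fact k) \<le> real (n ^ k)"
    using binomial_fact_pow[of n k] by (rule of_nat_mono)
  then have 1: "real (n choose k) * fact k \<le> real n ^ k" by simp
  have "real (n choose k) * (real k / exp 1) ^ k \<le> real (n choose k) * fact k"
    by (intro mult_left_mono fact_ge_pow) simp
  also note 1
  finally have "real (n choose k) \<le> real n ^ k / (real k / exp 1) ^ k"
    using assms by (simp add: pos_le_divide_eq)
  also have "\<dots> = (exp 1 * real n / real k) ^ k" by (simp add: power_divide power_mult_distrib field_simps)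
  finally show ?thesis .
qed

lemma prod_diff_fact: "l \<le> N \<Longrightarrow> prod ((-) N) {0..<l} * fact (N - l) = (fact N :: nat)"
proof (induction l)
  case (Suc l)
  then have "N - l = Suc (N - Suc l)" by simp
  then have "fact (N - l) = (N - l) * (fact (N - Suc l) :: nat)" by (metis fact_Suc of_nat_id)
  then show ?case using Suc by (simp add: mult.assoc)
qed simp

text \<open>Drawing without replacement: \<open>(Y - i) / (N - i) \<le> Y / N\<close>, and truncated
  subtraction makes the factors with \<open>i > Y\<close> zero.\<close>

lemma falling_ratio: 
  assumes "Y \<le> N" "l \<le> N" "N > 0"
  shows "real (prod ((-) Y) {0..<l} * fact (N - l)) / fact N \<le> (real Y / real N) ^ l"
proof -
  have "(Y - i) * N \<le> Y * (N - i)" for i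
  proof (cases "i \<le> Y")
    case True
    have "(Y - i) * N = Y * N - i * N" by (simp add: diff_mult_distrib)
    also have "\<dots> \<le> Y * N - i * Y" using assms(1) by (intro diff_le_mono2) simp
    also have "\<dots> = Y * (N - i)" by (simp add: diff_mult_distrib2 mult.commute)
    finally show ?thesis .
  qed simp
  then have "(\<Prod>i\<in>{0..<l}. (Y - i) * N) \<le> (\<Prod>i\<in>{0..<l}. Y * (N - i))" by (intro prod_mono) auto
  then have "prod ((-) Y) {0..<l} * N ^ l \<le> Y ^ l * prod ((-) N) {0..<l}"
    by (simp add: prod.distrib)
  then have "(prod ((-) Y) {0..<l} * N ^ l) * fact (N - l) \<le> (Y ^ l * prod ((-) N) {0..<l}) * fact (N - l)"
    by (rule mult_right_mono) simp
  also have "\<dots> = Y ^ l * fact N" using prod_diff_fact[OF assms(2)] by (simp add: mult.assoc)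
  finally have "real ((prod ((-) Y) {0..<l} * N ^ l) * fact (N - l)) \<le> real (Y ^ l * fact N)" by (rule of_nat_mono)
  then have "real (prod ((-) Y) {0..<l} * fact (N - l)) * real N ^ l \<le> real Y ^ l * fact N"
    by (simp add: algebra_simps)
  then show ?thesis using assms(3) by (simp add: power_divide field_simps)
qed

section \<open>Probabilities of block events in the configuration model\<close>

context config
begin

lemma sum_blocks:
  fixes z :: "'c \<Rightarrow> real"
  assumes C: "finite C" and B: "B \<subseteq> {..<r} \<rightarrow>\<^sub>E C"
  shows "(\<Sum>f\<in>{f \<in> S \<rightarrow>\<^sub>E C. \<forall>e<m. (\<lambda>i\<in>{..<r}. f (e, i)) \<in> B}. \<Prod>x\<in>S. z (f x)) = (\<Sum>b\<in>B. \<Prod>i<r. z (b i)) ^ m"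
proof -
  have finB: "finite B" using B C by (meson finite_PiE finite_lessThan finite_subset)
  have "(\<Sum>b\<in>B. \<Prod>i<r. z (b i)) ^ m = (\<Prod>e<m. \<Sum>b\<in>B. \<Prod>i<r. z (b i))" by simp
  also have "\<dots> = (\<Sum>F\<in>{..<m} \<rightarrow>\<^sub>E B. \<Prod>e<m. \<Prod>i<r. z (F e i))"
    by (rule prod_sum_PiE) (use finB in auto)
  also have "\<dots> = (\<Sum>f\<in>{f \<in> S \<rightarrow>\<^sub>E C. \<forall>e<m. (\<lambda>i\<in>{..<r}. f (e, i)) \<in> B}. \<Prod>x\<in>S. z (f x))"
  proof (rule sum.reindex_bij_witness[of _ "\<lambda>f. \<lambda>e\<in>{..<m}. \<lambda>i\<in>{..<r}. f (e, i)" "\<lambda>F. \<lambda>x\<in>S. F (fst x) (snd x)"])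
    fix F assume F: "F \<in> {..<m} \<rightarrow>\<^sub>E B"
    then have FB: "F e \<in> B" "F e \<in> {..<r} \<rightarrow>\<^sub>E C" if "e < m" for e using that B by auto
    let ?f = "\<lambda>x\<in>S. F (fst x) (snd x)"
    have blk: "(\<lambda>i\<in>{..<r}. ?f (e, i)) = F e" if "e < m" for e
      using FB(2)[OF that] that by (auto simp: fun_eq_iff PiE_def extensional_def)
    show "(\<lambda>e\<in>{..<m}. \<lambda>i\<in>{..<r}. ?f (e, i)) = F"
    proof
      fix e show "(\<lambda>e\<in>{..<m}. \<lambda>i\<in>{..<r}. ?f (e, i)) e = F e"
      proof (cases "e < m")
        case True
        then show ?thesis using blk[OF True] by (simp only: restrict_apply lessThan_iff if_True)
      next
        case False
        then show ?thesis using F by (simp add: PiE_def extensional_def)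
      qed
    qed
    show "?f \<in> {f \<in> S \<rightarrow>\<^sub>E C. \<forall>e<m. (\<lambda>i\<in>{..<r}. f (e, i)) \<in> B}"
    proof (rule CollectI, intro conjI allI impI)
      show "?f \<in> S \<rightarrow>\<^sub>E C" using PiE_mem[OF FB(2)] by auto
      fix e assume "e < m"
      then show "(\<lambda>i\<in>{..<r}. ?f (e, i)) \<in> B" using blk FB(1) by simp
    qed
    show "(\<Prod>x\<in>S. z (?f x)) = (\<Prod>e<m. \<Prod>i<r. z (F e i))"
      unfolding prod.cartesian_product by (rule prod.cong) auto
  next
    fix f assume f: "f \<in> {f \<in> S \<rightarrow>\<^sub>E C. \<forall>e<m. (\<lambda>i\<in>{..<r}. f (e, i)) \<in> B}"
    then show "(\<lambda>e\<in>{..<m}. \<lambda>i\<in>{..<r}. f (e, i)) \<in> {..<m} \<rightarrow>\<^sub>E B" by auto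
    show "(\<lambda>x\<in>S. (\<lambda>e\<in>{..<m}. \<lambda>i\<in>{..<r}. f (e, i)) (fst x) (snd x)) = f"
      using f by (auto simp: fun_eq_iff PiE_def extensional_def)
  qed
  finally show ?thesis by simp
qed

text \<open>Under the product law with letter frequencies \<open>t c / (m * r)\<close> all words of
  type \<open>t\<close> have one common weight \<zeta>. Multiplying both counts by \<zeta> makes the
  numerator at most the product-law probability that all blocks lie in \<open>B\<close>, and the
  denominator at least inverse polynomial.\<close>

lemma perm_prob_blocks_le:
  fixes g :: "nat \<times> nat \<Rightarrow> 'c"
  assumes C: "finite C" and B: "B \<subseteq> {..<r} \<rightarrow>\<^sub>E C" and g: "g \<in> S \<rightarrow> C"
    and t: "\<And>c. c \<in> C \<Longrightarrow> card {x \<in> S. g x = c} = t c"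
  shows "perm_prob S (\<lambda>\<pi>. \<forall>e<m. (\<lambda>i\<in>{..<r}. g (\<pi> (e, i))) \<in> B)
    \<le> (exp 1 * (real (m * r) + 1)) ^ card C * (\<Sum>b\<in>B. \<Prod>i<r. real (t (b i)) / real (m * r)) ^ m"
proof -
  let ?W = "words S C t"
  define z where "z c = real (t c) / real (m * r)" for c
  let ?M = "{f \<in> ?W. \<forall>e<m. (\<lambda>i\<in>{..<r}. f (e, i)) \<in> B}"
  define \<zeta> where "\<zeta> = (\<Prod>c\<in>C. z c ^ t c)"
  have tsum: "sum t C = card S"
  proof -
    have "sum t C = (\<Sum>c\<in>C. card {x \<in> S. g x = c})" using t by simp
    also have "\<dots> = (\<Sum>c\<in>C. \<Sum>x\<in>{x \<in> S. g x = c}. 1)" by simp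
    also have "\<dots> = (\<Sum>x\<in>S. 1)" by (rule sum.group) (use C g in auto)
    finally show ?thesis by simp
  qed
  have zw: "(\<Prod>x\<in>S. z (f x)) = \<zeta>" if f: "f \<in> ?W" for f
  proof -
    have "(\<Prod>x\<in>S. z (f x)) = (\<Prod>c\<in>C. \<Prod>x\<in>{x \<in> S. f x = c}. z (f x))"
      by (rule prod.group[symmetric]) (use C f in \<open>auto simp: words_def\<close>)
    also have "\<dots> = \<zeta>" unfolding \<zeta>_def
      using f by (intro prod.cong) (auto simp: words_def)
    finally show ?thesis .
  qed
  \<comment> \<open>Letters that do not occur contribute \<open>0 ^ 0 = 1\<close>.\<close>
  have \<zeta>0: "\<zeta> > 0" unfolding \<zeta>_def
  proof (rule prod_pos)
    fix c assume c: "c \<in> C"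
    show "0 < z c ^ t c"
    proof (cases "t c = 0")
      case False
      have "t c \<le> m * r" using member_le_sum[OF c, of t] C tsum card_S by simp
      with False have "m * r > 0" by (metis le_zero_eq neq0_conv)
      then show ?thesis using False by (simp add: z_def)
    qed simp
  qed
  have "real (card ?M) * \<zeta> = (\<Sum>f\<in>?M. \<Prod>x\<in>S. z (f x))" using zw by simp
  also have "\<dots> \<le> (\<Sum>f\<in>{f \<in> S \<rightarrow>\<^sub>E C. \<forall>e<m. (\<lambda>i\<in>{..<r}. f (e, i)) \<in> B}. \<Prod>x\<in>S. z (f x))"
  proof (rule sum_mono2)
    show "finite {f \<in> S \<rightarrow>\<^sub>E C. \<forall>e<m. (\<lambda>i\<in>{..<r}. f (e, i)) \<in> B}"
      using C by (intro finite_subset[OF _ finite_PiE[of S "\<lambda>_. C"]]) auto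
    show "?M \<subseteq> {f \<in> S \<rightarrow>\<^sub>E C. \<forall>e<m. (\<lambda>i\<in>{..<r}. f (e, i)) \<in> B}" by (auto simp: words_def)
  qed (auto intro!: prod_nonneg simp: z_def)
  also have "\<dots> = (\<Sum>b\<in>B. \<Prod>i<r. z (b i)) ^ m" by (rule sum_blocks[OF C B])
  finally have 1: "real (card ?M) * \<zeta> \<le> (\<Sum>b\<in>B. \<Prod>i<r. z (b i)) ^ m" .
  have 2: "1 \<le> (exp 1 * (real (m * r) + 1)) ^ card C * (real (card ?W) * \<zeta>)"
    using card_words_lower[OF finS C tsum] unfolding card_S \<zeta>_def z_def .
  have W: "card ?W > 0" by (rule perm_prob_word(2)[OF finS C g t, where M = "{}"]) auto
  have eq: "(\<forall>e<m. (\<lambda>i\<in>{..<r}. g (\<pi> (e, i))) \<in> B) \<longleftrightarrow> restrict (g \<circ> \<pi>) S \<in> ?M" if "\<pi> permutes S" for \<pi>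
  proof -
    have "restrict (g \<circ> \<pi>) S \<in> ?W" by (rule restrict_comp_in_words[OF finS g t that])
    moreover have "(\<lambda>i\<in>{..<r}. restrict (g \<circ> \<pi>) S (e, i)) = (\<lambda>i\<in>{..<r}. g (\<pi> (e, i)))" if "e < m" for e
      using that by (auto simp: fun_eq_iff)
    ultimately show ?thesis by simp
  qed
  have "perm_prob S (\<lambda>\<pi>. \<forall>e<m. (\<lambda>i\<in>{..<r}. g (\<pi> (e, i))) \<in> B) = perm_prob S (\<lambda>\<pi>. restrict (g \<circ> \<pi>) S \<in> ?M)"
    by (rule perm_prob_cong) (rule eq)
  also have "\<dots> = real (card ?M) / real (card ?W)"
    by (rule perm_prob_word(1)[OF finS C g t]) auto
  also have "\<dots> = (real (card ?M) * \<zeta>) * (1 / (real (card ?W) * \<zeta>))" using \<zeta>0 by simp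
  also have "\<dots> \<le> (\<Sum>b\<in>B. \<Prod>i<r. z (b i)) ^ m * (exp 1 * (real (m * r) + 1)) ^ card C"
  proof (rule mult_mono[OF 1])
    have "0 < real (card ?W) * \<zeta>" using W \<zeta>0 by simp
    then show "1 / (real (card ?W) * \<zeta>) \<le> (exp 1 * (real (m * r) + 1)) ^ card C"
      using 2 by (simp only: divide_le_eq if_True)
    show "0 \<le> (\<Sum>b\<in>B. \<Prod>i<r. z (b i)) ^ m"
      by (intro zero_le_power sum_nonneg prod_nonneg) (auto simp: z_def)
    show "0 \<le> 1 / (real (card ?W) * \<zeta>)" using \<zeta>0 by simp
  qed
  finally show ?thesis by (simp add: z_def mult.commute)
qed

lemma card_points:
  assumes "\<sigma> \<in> {1..n} \<rightarrow> C"
  shows "card {x \<in> S. \<sigma> (vt x) = c} = d * card {v \<in> {1..n}. \<sigma> v = c}"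
proof -
  have "{x \<in> S. \<sigma> (vt x) = c} = (\<Union>v\<in>{v \<in> {1..n}. \<sigma> v = c}. {x \<in> S. vt x = v})" using vt_in by auto
  then have "card {x \<in> S. \<sigma> (vt x) = c} = card (\<Union>v\<in>{v \<in> {1..n}. \<sigma> v = c}. {x \<in> S. vt x = v})" by simp
  also have "\<dots> = (\<Sum>v\<in>{v \<in> {1..n}. \<sigma> v = c}. card {x \<in> S. vt x = v})"
    by (rule card_UN_disjoint) auto
  also have "\<dots> = (\<Sum>v\<in>{v \<in> {1..n}. \<sigma> v = c}. d)" by (rule sum.cong) (use vt_fib in auto)
  finally show ?thesis by simp
qed

text \<open>Two letters suffice, inside \<open>X\<close> and outside \<open>X\<close>: independence
  means that no block is the constant word \<open>True\<close>. The exponent 2 of the polynomial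
  factor is the size of this alphabet.\<close>

lemma perm_prob_indep_le:
  assumes X: "X \<subseteq> {1..n}" and n: "n > 0"
  shows "perm_prob S (\<lambda>\<pi>. \<forall>e<m. \<not> edge r (vt \<circ> \<pi>) e \<subseteq> X)
    \<le> (exp 1 * (real (m * r) + 1))\<^sup>2 * (1 - (real (card X) / real n) ^ r) ^ m"
proof -
  define g where "g x = (vt x \<in> X)" for x
  define t where "t b = (if b then d * card X else d * (n - card X))" for b
  define B where "B = {b \<in> {..<r} \<rightarrow>\<^sub>E (UNIV :: bool set). \<exists>i<r. \<not> b i}"
  define z where "z b = real (t b) / real (m * r)" for b
  have finX: "finite X" using X finite_subset by blast
  have cX: "card X \<le> n" using X card_mono[of "{1..n}" X] by simp
  have t: "card {x \<in> S. g x = b} = t b" for b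
  proof -
    have "{v \<in> {1..n}. (v \<in> X) = b} = (if b then X else {1..n} - X)" using X by auto
    then have "card {v \<in> {1..n}. (v \<in> X) = b} = (if b then card X else n - card X)"
      using X finX by (simp add: card_Diff_subset)
    then show ?thesis
      unfolding g_def t_def using card_points[of "\<lambda>v. v \<in> X" UNIV b] by (cases b) auto
  qed
  have z: "z True = real (card X) / real n" "z False = 1 - real (card X) / real n"
    using n d1 cX unfolding z_def t_def mr by (auto simp: field_simps of_nat_diff)
  have "(\<Sum>b\<in>B. \<Prod>i<r. z (b i)) = 1 - (real (card X) / real n) ^ r"
  proof -
    define c1 :: "nat \<Rightarrow> bool" where "c1 = (\<lambda>i\<in>{..<r}. True)"
    have c1: "c1 \<in> {..<r} \<rightarrow>\<^sub>E UNIV" by (simp add: c1_def)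
    have BB: "B = ({..<r} \<rightarrow>\<^sub>E UNIV) - {c1}"
    proof (intro equalityI subsetI)
      fix b assume b: "b \<in> ({..<r} \<rightarrow>\<^sub>E UNIV) - {c1}"
      have "\<exists>i<r. \<not> b i"
      proof (rule ccontr)
        assume "\<not> ?thesis"
        then have "b = c1" using b c1 by (intro PiE_ext[of b "{..<r}" "\<lambda>_. UNIV"]) (auto simp: c1_def)
        then show False using b by simp
      qed
      then show "b \<in> B" using b by (simp add: B_def)
    next
      fix b assume b: "b \<in> B"
      then obtain i where "i < r" "\<not> b i" unfolding B_def by blast
      moreover from this have "c1 i" by (simp add: c1_def)
      ultimately show "b \<in> ({..<r} \<rightarrow>\<^sub>E UNIV) - {c1}" using b unfolding B_def by blast
    qed
    have fin: "finite ({..<r} \<rightarrow>\<^sub>E (UNIV :: bool set))" by (rule finite_PiE) auto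
    have "(\<Sum>b\<in>B. \<Prod>i<r. z (b i)) = (\<Sum>b\<in>{..<r} \<rightarrow>\<^sub>E UNIV. \<Prod>i<r. z (b i)) - (\<Prod>i<r. z (c1 i))"
      unfolding BB sum_diff1[OF fin] using c1 by (simp only: if_True)
    also have "(\<Sum>b\<in>{..<r} \<rightarrow>\<^sub>E UNIV. \<Prod>i<r. z (b i)) = (\<Prod>i<r. \<Sum>b\<in>UNIV. z b)"
      by (rule prod_sum_PiE[symmetric]) auto
    also have "\<dots> = 1" by (simp add: UNIV_bool z)
    also have "(\<Prod>i<r. z (c1 i)) = (real (card X) / real n) ^ r" by (simp add: c1_def z)
    finally show ?thesis .
  qed
  moreover have "perm_prob S (\<lambda>\<pi>. \<forall>e<m. (\<lambda>i\<in>{..<r}. g (\<pi> (e, i))) \<in> B)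
    \<le> (exp 1 * (real (m * r) + 1)) ^ card (UNIV :: bool set) * (\<Sum>b\<in>B. \<Prod>i<r. real (t (b i)) / real (m * r)) ^ m"
    by (rule perm_prob_blocks_le) (use t in \<open>auto simp: B_def\<close>)
  moreover have "perm_prob S (\<lambda>\<pi>. \<forall>e<m. \<not> edge r (vt \<circ> \<pi>) e \<subseteq> X) \<le> perm_prob S (\<lambda>\<pi>. \<forall>e<m. (\<lambda>i\<in>{..<r}. g (\<pi> (e, i))) \<in> B)"
    by (rule perm_prob_mono[OF finS]) (auto simp: B_def edge_def g_def)
  ultimately show ?thesis unfolding z_def by simp
qed

text \<open>In contrast to \<open>perm_prob_blocks_le\<close> no polynomial factor is lost. This
  matters for vertex sets of bounded size, where the final bound is only of order
  \<open>1 / n\<close>.\<close>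

lemma perm_prob_positions_le:
  assumes P: "P \<subseteq> S" and X: "X \<subseteq> {1..n}" and n: "n > 0"
  shows "perm_prob S (\<lambda>\<pi>. \<forall>x\<in>P. vt (\<pi> x) \<in> X) \<le> (real (card X) / real n) ^ card P"
proof -
  define Y where "Y = {x \<in> S. vt x \<in> X}"
  have cY: "card Y = d * card X"
  proof -
    have "{v \<in> {1..n}. v \<in> X} = X" using X by auto
    then show ?thesis unfolding Y_def using card_points[of "\<lambda>v. v \<in> X" UNIV True] by simp
  qed
  have finP: "finite P" and finY: "finite Y" using P finite_subset by (auto simp: Y_def)
  have cP: "card P \<le> card S" using P by (intro card_mono) auto
  have YS: "card Y \<le> card S" by (intro card_mono) (auto simp: Y_def)
  have S0: "card S > 0" using n d1 card_S mr by simp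
  let ?I = "{f \<in> P \<rightarrow>\<^sub>E Y. inj_on f P}"
  have finI: "finite ?I" using finP finY by (intro finite_subset[OF _ finite_PiE[of P "\<lambda>_. Y"]]) auto
  have "{\<pi>. \<pi> permutes S \<and> (\<forall>x\<in>P. vt (\<pi> x) \<in> X)} \<subseteq> (\<Union>f\<in>?I. {\<pi>. \<pi> permutes S \<and> (\<forall>x\<in>P. \<pi> x = f x)})"
  proof
    fix \<pi> assume pi: "\<pi> \<in> {\<pi>. \<pi> permutes S \<and> (\<forall>x\<in>P. vt (\<pi> x) \<in> X)}"
    then have per: "\<pi> permutes S" by simp
    have "\<pi> x \<in> Y" if "x \<in> P" for x
      using pi that P permutes_in_image[OF per] unfolding Y_def by blast
    moreover have "inj_on \<pi> P" using permutes_inj[OF per] by (rule inj_on_subset) simp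
    ultimately have "restrict \<pi> P \<in> ?I" by (auto simp: inj_on_def)
    then show "\<pi> \<in> (\<Union>f\<in>?I. {\<pi>. \<pi> permutes S \<and> (\<forall>x\<in>P. \<pi> x = f x)})"
      using per by (intro UN_I[of "restrict \<pi> P"]) auto
  qed
  then have "card {\<pi>. \<pi> permutes S \<and> (\<forall>x\<in>P. vt (\<pi> x) \<in> X)} \<le> card (\<Union>f\<in>?I. {\<pi>. \<pi> permutes S \<and> (\<forall>x\<in>P. \<pi> x = f x)})"
    using finI finite_perms_where[OF finS] by (intro card_mono finite_UN_I) auto
  also have "\<dots> \<le> card ?I * fact (card S - card P)"
    by (rule card_UN_le_mult[OF finI]) (rule card_perms_prescribed[OF finS P])
  also have "card ?I = prod ((-) (card Y)) {0..<card P}"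
    using card_inj_on_subset_funcset[OF finP finY order.refl] by simp
  finally have "real (card {\<pi>. \<pi> permutes S \<and> (\<forall>x\<in>P. vt (\<pi> x) \<in> X)}) \<le> real (prod ((-) (card Y)) {0..<card P} * fact (card S - card P))"
    by (rule of_nat_mono)
  then have "perm_prob S (\<lambda>\<pi>. \<forall>x\<in>P. vt (\<pi> x) \<in> X) \<le> real (prod ((-) (card Y)) {0..<card P} * fact (card S - card P)) / fact (card S)"
    unfolding perm_prob_def by (rule divide_right_mono) simp
  also have "\<dots> \<le> (real (card Y) / real (card S)) ^ card P" by (rule falling_ratio[OF YS cP S0])
  also have "real (card Y) / real (card S) = real (card X) / real n"
    using d1 unfolding cY card_S mr by simp
  finally show ?thesis .
qed

text \<open>With \<open>x = u / n\<close> there are at most \<open>(3 / x) ^ u\<close> sets of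
  \<open>u\<close> vertices and \<open>(d^2 / x^2) ^ u\<close> sets of \<open>2 * u\<close> blocks,
  while all their positions fall into the set with probability at most \<open>x ^ (4 * u)\<close>.
  The product \<open>(3 * d^2 * x) ^ u\<close> has a positive power of \<open>x\<close> because
  there are more blocks than vertices.\<close>

lemma perm_prob_dense_set_le:
  assumes n: "n > 0"
  shows "perm_prob S (\<lambda>\<pi>. \<exists>U\<subseteq>{1..n}. U \<noteq> {} \<and> 12 * d\<^sup>2 * card U \<le> n \<and>
      2 * card U \<le> card {e. e < m \<and> edge r (vt \<circ> \<pi>) e \<subseteq> U}) \<le> 6 * (real d)\<^sup>2 / real n"
proof -
  define I where "I = {u \<in> {1..n}. 12 * d\<^sup>2 * u \<le> n}"
  define UU where "UU u = {U. U \<subseteq> {1..n} \<and> card U = u}" for u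
  define EE where "EE u = {E. E \<subseteq> {..<m} \<and> card E = 2 * u}" for u
  define Q where "Q U E \<pi> \<longleftrightarrow> (\<forall>x\<in>E \<times> {..<r}. vt (\<pi> x) \<in> U)" for U E and \<pi> :: "nat \<times> nat \<Rightarrow> nat \<times> nat"
  have finI: "finite I" by (simp add: I_def)
  have finU: "finite (UU u)" for u unfolding UU_def by (rule finite_subset[of _ "Pow {1..n}"]) auto
  have finE: "finite (EE u)" for u unfolding EE_def by (rule finite_subset[of _ "Pow {..<m}"]) auto
  have cU: "card (UU u) = n choose u" for u unfolding UU_def using n_subsets[of "{1..n}" u] by simp
  have cE: "card (EE u) = m choose (2 * u)" for u unfolding EE_def using n_subsets[of "{..<m}" "2 * u"] by simp
  have "perm_prob S (\<lambda>\<pi>. \<exists>U\<subseteq>{1..n}. U \<noteq> {} \<and> 12 * d\<^sup>2 * card U \<le> n \<and>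
      2 * card U \<le> card {e. e < m \<and> edge r (vt \<circ> \<pi>) e \<subseteq> U})
    \<le> perm_prob S (\<lambda>\<pi>. \<exists>u\<in>I. \<exists>U\<in>UU u. \<exists>E\<in>EE u. Q U E \<pi>)"
  proof (rule perm_prob_mono[OF finS])
    fix \<pi> assume "\<exists>U\<subseteq>{1..n}. U \<noteq> {} \<and> 12 * d\<^sup>2 * card U \<le> n \<and> 2 * card U \<le> card {e. e < m \<and> edge r (vt \<circ> \<pi>) e \<subseteq> U}"
    then obtain U where U: "U \<subseteq> {1..n}" "U \<noteq> {}" "12 * d\<^sup>2 * card U \<le> n"
      "2 * card U \<le> card {e. e < m \<and> edge r (vt \<circ> \<pi>) e \<subseteq> U}" by blast
    have "finite U" using U(1) finite_subset by blast
    then have "card U \<in> I" using U card_mono[of "{1..n}" U] by (auto simp: I_def card_gt_0_iff Suc_le_eq)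
    moreover have "U \<in> UU (card U)" using U by (simp add: UU_def)
    moreover obtain E where E: "E \<subseteq> {e. e < m \<and> edge r (vt \<circ> \<pi>) e \<subseteq> U}" "card E = 2 * card U"
      using obtain_subset_with_card_n[OF U(4)] by blast
    then have "E \<in> EE (card U)" by (auto simp: EE_def)
    moreover have "Q U E \<pi>" using E(1) by (auto simp: Q_def edge_def)
    ultimately show "\<exists>u\<in>I. \<exists>U\<in>UU u. \<exists>E\<in>EE u. Q U E \<pi>" by blast
  qed
  also have "\<dots> \<le> (\<Sum>u\<in>I. perm_prob S (\<lambda>\<pi>. \<exists>U\<in>UU u. \<exists>E\<in>EE u. Q U E \<pi>))"
    by (rule perm_prob_Bex[OF finS finI])
  also have "\<dots> \<le> (\<Sum>u\<in>I. \<Sum>U\<in>UU u. perm_prob S (\<lambda>\<pi>. \<exists>E\<in>EE u. Q U E \<pi>))"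
    by (intro sum_mono perm_prob_Bex[OF finS finU])
  also have "\<dots> \<le> (\<Sum>u\<in>I. \<Sum>U\<in>UU u. \<Sum>E\<in>EE u. perm_prob S (Q U E))"
    by (intro sum_mono perm_prob_Bex[OF finS finE])
  also have "\<dots> \<le> (\<Sum>u\<in>I. \<Sum>U\<in>UU u. \<Sum>E\<in>EE u. (real u / real n) ^ (2 * u * r))"
  proof (intro sum_mono)
    fix u U E assume u: "u \<in> I" "U \<in> UU u" "E \<in> EE u"
    then have "perm_prob S (Q U E) \<le> (real (card U) / real n) ^ card (E \<times> {..<r})"
      unfolding Q_def using n by (intro perm_prob_positions_le) (auto simp: UU_def EE_def)
    then show "perm_prob S (Q U E) \<le> (real u / real n) ^ (2 * u * r)"
      using u by (simp add: UU_def EE_def card_cartesian_product)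
  qed
  also have "\<dots> = (\<Sum>u\<in>I. real (n choose u) * (real (m choose (2 * u)) * (real u / real n) ^ (2 * u * r)))"
    by (simp add: cU cE)
  also have "\<dots> \<le> (\<Sum>u\<in>I. 3 * (real d)\<^sup>2 / real n * (1 / 2) ^ (u - 1))"
  proof (rule sum_mono)
    fix u assume uI: "u \<in> I"
    then have u: "1 \<le> u" "u \<le> n" "12 * d\<^sup>2 * u \<le> n" by (auto simp: I_def)
    define x where "x = real u / real n"
    have x: "0 < x" "x \<le> 1" using u n by (auto simp: x_def)
    have e3: "exp 1 \<le> (3::real)" by (rule exp_le)
    have "real (n choose u) \<le> (exp 1 * real n / real u) ^ u" by (rule binomial_le_exp_pow[OF u(1)])
    also have "\<dots> \<le> (3 / x) ^ u"
      using e3 u n by (intro power_mono) (auto simp: x_def divide_right_mono)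
    finally have 1: "real (n choose u) \<le> (3 / x) ^ u" .
    have "real (m * r) = real (n * d)" using mr by simp
    then have m2: "real m * 2 \<le> real n * real d" using r2 mult_left_mono[of 2 "real r" "real m"] by simp
    have "real (m choose (2 * u)) \<le> (exp 1 * real m / real (2 * u)) ^ (2 * u)"
      using u(1) by (intro binomial_le_exp_pow) simp
    also have "\<dots> \<le> (real d / x) ^ (2 * u)"
    proof (intro power_mono)
      have "exp 1 * real m \<le> 3 * real m" using e3 by (intro mult_right_mono) auto
      also have "\<dots> \<le> 2 * (real n * real d)" using m2 by simp
      finally show "exp 1 * real m / real (2 * u) \<le> real d / x"
        using u n by (simp add: x_def field_simps)
    qed simp
    also have "\<dots> = ((real d)\<^sup>2 / x\<^sup>2) ^ u" by (simp add: power_mult power_divide)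
    finally have 2: "real (m choose (2 * u)) \<le> ((real d)\<^sup>2 / x\<^sup>2) ^ u" .
    \<comment> \<open>Blocks of size at least 2 give at least \<open>4 * u\<close>
      positions.\<close>
    have "x ^ (2 * u * r) = (x ^ (2 * r)) ^ u" by (simp add: power_mult[symmetric] mult.commute mult.left_commute)
    also have "\<dots> \<le> (x ^ 4) ^ u" using x r2 by (intro power_mono power_decreasing) auto
    finally have 3: "x ^ (2 * u * r) \<le> (x ^ 4) ^ u" .
    have "real (n choose u) * (real (m choose (2 * u)) * x ^ (2 * u * r)) \<le> (3 / x) ^ u * (((real d)\<^sup>2 / x\<^sup>2) ^ u * (x ^ 4) ^ u)"
      using 1 2 3 x by (intro mult_mono) auto
    also have "\<dots> = (3 * (real d)\<^sup>2 * x) ^ u"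
      unfolding power_mult_distrib[symmetric] using x by (simp add: field_simps eval_nat_numeral)
    \<comment> \<open>One factor is kept as the source of \<open>1 / n\<close>. In the others
      \<open>12 * d^2 * u \<le> n\<close> bounds the base by \<open>1 / 4\<close>, of which one half
      pays for the \<open>u\<close> in \<open>x = u / n\<close> and the rest is summed
      geometrically.\<close>
    also have "\<dots> = (3 * (real d)\<^sup>2 * x) * (3 * (real d)\<^sup>2 * x) ^ (u - 1)"
      using u(1) by (metis One_nat_def Suc_pred less_eq_Suc_le power_Suc)
    also have "\<dots> \<le> (3 * (real d)\<^sup>2 * x) * (1 / 4) ^ (u - 1)"
    proof (intro mult_left_mono power_mono)
      have "real (12 * d\<^sup>2 * u) \<le> real n" using u(3) by (rule of_nat_mono)
      then show "3 * (real d)\<^sup>2 * x \<le> 1 / 4" using n by (simp add: x_def field_simps)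
    qed (use x in auto)
    also have "\<dots> = 3 * (real d)\<^sup>2 / real n * (real u * (1 / 4) ^ (u - 1))" by (simp add: x_def)
    also have "\<dots> \<le> 3 * (real d)\<^sup>2 / real n * (1 / 2) ^ (u - 1)"
    proof (rule mult_left_mono)
      have "Suc k \<le> 2 ^ k" for k by (induction k) auto
      from this[of "u - 1"] have "real u \<le> 2 ^ (u - 1)" using u(1) by (metis One_nat_def Suc_pred less_eq_Suc_le of_nat_le_iff of_nat_numeral of_nat_power)
      then have "real u * (1 / 4) ^ (u - 1) \<le> 2 ^ (u - 1) * (1 / 4) ^ (u - 1)" by (rule mult_right_mono) simp
      also have "\<dots> = (1 / 2) ^ (u - 1)" unfolding power_mult_distrib[symmetric] by simp
      finally show "real u * (1 / 4) ^ (u - 1) \<le> (1 / 2) ^ (u - 1)" .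
    qed simp
    finally show "real (n choose u) * (real (m choose (2 * u)) * (real u / real n) ^ (2 * u * r)) \<le> 3 * (real d)\<^sup>2 / real n * (1 / 2) ^ (u - 1)"
      unfolding x_def .
  qed
  also have "\<dots> \<le> (\<Sum>u\<in>{1..n}. 3 * (real d)\<^sup>2 / real n * (1 / 2) ^ (u - 1))"
    by (rule sum_mono2) (auto simp: I_def)
  also have "\<dots> = 3 * (real d)\<^sup>2 / real n * (\<Sum>u\<in>{1..n}. (1 / 2) ^ (u - 1))" by (simp add: sum_distrib_left)
  also have "(\<Sum>u\<in>{1..n}. (1 / 2 :: real) ^ (u - 1)) = (\<Sum>u<n. (1 / 2) ^ u)"
    by (rule sum.reindex_bij_witness[of _ Suc "\<lambda>u. u - 1"]) auto
  also have "3 * (real d)\<^sup>2 / real n * (\<Sum>u<n. (1 / 2) ^ u) \<le> 3 * (real d)\<^sup>2 / real n * 2"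
  proof (rule mult_left_mono)
    show "(\<Sum>u<n. (1 / 2 :: real) ^ u) \<le> 2" using geometric_sum[of "1 / 2 :: real" n] by simp
  qed simp
  also have "3 * (real d)\<^sup>2 / real n * 2 = 6 * (real d)\<^sup>2 / real n" by simp
  finally show ?thesis .
qed

end

section \<open>Lower bound for the first moment of colourings\<close>

definition nonmono :: "nat \<Rightarrow> nat \<Rightarrow> (nat \<Rightarrow> nat) set" where
  "nonmono r k = {b \<in> {..<r} \<rightarrow>\<^sub>E {..<k}. \<not> (\<exists>c. \<forall>i<r. b i = c)}"

lemma finite_nonmono: "finite (nonmono r k)"
  unfolding nonmono_def by (rule finite_subset[OF _ finite_PiE[of "{..<r}" "\<lambda>_. {..<k}"]]) auto

lemma card_nonmono:
  assumes "r \<ge> 1"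
  shows "card (nonmono r k) = k ^ r - k"
proof -
  let ?P = "{..<r} \<rightarrow>\<^sub>E {..<k}" and ?K = "(\<lambda>c. \<lambda>i\<in>{..<r}. c) ` {..<k}"
  have "nonmono r k = ?P - ?K"
  proof (intro equalityI subsetI)
    fix b assume b: "b \<in> nonmono r k"
    have "b \<notin> ?K"
    proof
      assume "b \<in> ?K"
      then obtain c where "b = (\<lambda>i\<in>{..<r}. c)" by blast
      then have "\<forall>i<r. b i = c" by simp
      then show False using b unfolding nonmono_def by blast
    qed
    then show "b \<in> ?P - ?K" using b unfolding nonmono_def by blast
  next
    fix b assume b: "b \<in> ?P - ?K"
    have "\<not> (\<exists>c. \<forall>i<r. b i = c)"
    proof
      assume "\<exists>c. \<forall>i<r. b i = c"
      then obtain c where c: "\<forall>i<r. b i = c" by blast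
      then have "b 0 = c" using assms by simp
      moreover have "b 0 < k" using b assms PiE_mem[of b "{..<r}" "\<lambda>_. {..<k}" 0] by simp
      moreover have "b = (\<lambda>i\<in>{..<r}. c)"
      proof
        fix i show "b i = (\<lambda>i\<in>{..<r}. c) i"
          using c b PiE_arb[of b "{..<r}" "\<lambda>_. {..<k}" i] by (cases "i < r") auto
      qed
      ultimately show False using b by blast
    qed
    then show "b \<in> nonmono r k" using b unfolding nonmono_def by blast
  qed
  moreover have "?K \<subseteq> ?P" by (auto split: if_splits)
  moreover have "card ?K = k"
  proof -
    have "inj_on (\<lambda>c. \<lambda>i\<in>{..<r}. c) {..<k}"
    proof (rule inj_onI)
      fix c c' :: nat assume "(\<lambda>i\<in>{..<r}. c) = (\<lambda>i\<in>{..<r}. c')"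
      then have "(\<lambda>i\<in>{..<r}. c) 0 = (\<lambda>i\<in>{..<r}. c') 0" by simp
      then show "c = c'" using assms by simp
    qed
    then show ?thesis by (simp add: card_image)
  qed
  ultimately show ?thesis by (simp add: card_Diff_subset card_funcsetE)
qed

text \<open>Transposing two colours permutes the non-monochromatic words, so all colours occur
  equally often in them.\<close>

lemma nonmono_color_count:
  assumes c: "c < k"
  shows "k * (\<Sum>b\<in>nonmono r k. card {i. i < r \<and> b i = c}) = r * card (nonmono r k)"
proof -
  let ?B = "nonmono r k"
  define A where "A c = (\<Sum>b\<in>?B. card {i. i < r \<and> b i = c})" for c
  have eq: "A c' = A c" if c': "c' < k" for c'
    unfolding A_def
  proof (rule sum.reindex_bij_witness[of _ "\<lambda>b. \<lambda>i\<in>{..<r}. transpose c c' (b i)" "\<lambda>b. \<lambda>i\<in>{..<r}. transpose c c' (b i)"])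
    have lt: "transpose c c' x < k" if "x < k" for x using that c c' by (auto simp: transpose_def)
    show in_B: "(\<lambda>i\<in>{..<r}. transpose c c' (b i)) \<in> ?B" if b: "b \<in> ?B" for b
    proof -
      have "\<not> (\<exists>e. \<forall>i<r. transpose c c' (b i) = e)"
      proof
        assume "\<exists>e. \<forall>i<r. transpose c c' (b i) = e"
        then obtain e where "\<forall>i<r. transpose c c' (b i) = e" by blast
        then have "\<forall>i<r. b i = transpose c c' e" by (metis transpose_involutory)
        then show False using b unfolding nonmono_def by blast
      qed
      then show ?thesis using b lt unfolding nonmono_def by auto
    qed
    then show "(\<lambda>i\<in>{..<r}. transpose c c' (b i)) \<in> ?B" if "b \<in> ?B" for b using that .
    show inv: "(\<lambda>i\<in>{..<r}. transpose c c' ((\<lambda>i\<in>{..<r}. transpose c c' (b i)) i)) = b" if b: "b \<in> ?B" for b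
    proof
      fix i show "(\<lambda>i\<in>{..<r}. transpose c c' ((\<lambda>i\<in>{..<r}. transpose c c' (b i)) i)) i = b i"
        using b PiE_arb[of b "{..<r}" "\<lambda>_. {..<k}" i] unfolding nonmono_def by (cases "i < r") auto
    qed
    then show "(\<lambda>i\<in>{..<r}. transpose c c' ((\<lambda>i\<in>{..<r}. transpose c c' (b i)) i)) = b" if "b \<in> ?B" for b using that .
    show "card {i. i < r \<and> (\<lambda>i\<in>{..<r}. transpose c c' (b i)) i = c} = card {i. i < r \<and> b i = c'}" if "b \<in> ?B" for b
      by (rule arg_cong[where f = card]) (auto simp: transpose_def split: if_splits)
  qed
  have "k * A c = (\<Sum>c'<k. A c')" using eq by simp
  also have "\<dots> = (\<Sum>b\<in>?B. \<Sum>c'<k. card {i. i < r \<and> b i = c'})" unfolding A_def by (rule sum.swap)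
  also have "\<dots> = (\<Sum>b\<in>?B. r)"
  proof (rule sum.cong[OF refl])
    fix b assume b: "b \<in> ?B"
    have "(\<Sum>c'<k. card {i. i < r \<and> b i = c'}) = (\<Sum>c'<k. \<Sum>i\<in>{i \<in> {..<r}. b i = c'}. 1)" by simp
    also have "\<dots> = (\<Sum>i<r. 1)" by (rule sum.group) (use b in \<open>auto simp: nonmono_def\<close>)
    finally show "(\<Sum>c'<k. card {i. i < r \<and> b i = c'}) = r" by simp
  qed
  finally show ?thesis by (simp add: A_def mult.commute)
qed

section \<open>Laying out the remaining blocks column by column\<close>

lemma card_div_class:
  assumes "d \<ge> 1"
  shows "card {x. x < d * u \<and> P (x div d)} = d * card {y. y < u \<and> P y}"
proof -
  have "bij_betw (\<lambda>(y, j). y * d + j) ({y. y < u \<and> P y} \<times> {..<d}) {x. x < d * u \<and> P (x div d)}"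
  proof (rule bij_betw_byWitness[where f' = "\<lambda>x. (x div d, x mod d)"])
    show "(\<lambda>(y, j). y * d + j) ` ({y. y < u \<and> P y} \<times> {..<d}) \<subseteq> {x. x < d * u \<and> P (x div d)}"
    proof (rule image_subsetI)
      fix z assume "z \<in> {y. y < u \<and> P y} \<times> {..<d}"
      then obtain y j where z: "z = (y, j)" "y < u" "P y" "j < d" by auto
      have "y * d + j < (y + 1) * d" using z by simp
      also have "\<dots> \<le> u * d" using z by (intro mult_right_mono) auto
      finally show "(\<lambda>(y, j). y * d + j) z \<in> {x. x < d * u \<and> P (x div d)}"
        using z by (simp add: mult.commute)
    qed
    show "(\<lambda>x. (x div d, x mod d)) ` {x. x < d * u \<and> P (x div d)} \<subseteq> {y. y < u \<and> P y} \<times> {..<d}"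
      using assms by (auto simp: less_mult_imp_div_less mult.commute)
  qed (use assms in auto)
  then have "card ({y. y < u \<and> P y} \<times> {..<d}) = card {x. x < d * u \<and> P (x div d)}" by (rule bij_betw_same_card)
  then show ?thesis by (simp add: card_cartesian_product mult.commute)
qed

lemma card_columns:
  fixes s r :: nat
  assumes "s \<ge> 1"
  shows "card {(e, i). e < s \<and> i < r \<and> P (i * s + e)} = card {x. x < r * s \<and> P x}"
proof -
  have "bij_betw (\<lambda>(e, i). i * s + e) {(e, i). e < s \<and> i < r \<and> P (i * s + e)} {x. x < r * s \<and> P x}"
  proof (rule bij_betw_byWitness[where f' = "\<lambda>x. (x mod s, x div s)"])
    show "(\<lambda>(e, i). i * s + e) ` {(e, i). e < s \<and> i < r \<and> P (i * s + e)} \<subseteq> {x. x < r * s \<and> P x}"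
    proof (rule image_subsetI)
      fix z assume "z \<in> {(e, i). e < s \<and> i < r \<and> P (i * s + e)}"
      then obtain e i where z: "z = (e, i)" "e < s" "i < r" "P (i * s + e)" by auto
      have "i * s + e < (i + 1) * s" using z by simp
      also have "\<dots> \<le> r * s" using z by (intro mult_right_mono) auto
      finally show "(\<lambda>(e, i). i * s + e) z \<in> {x. x < r * s \<and> P x}" using z by simp
    qed
    show "(\<lambda>x. (x mod s, x div s)) ` {x. x < r * s \<and> P x} \<subseteq> {(e, i). e < s \<and> i < r \<and> P (i * s + e)}"
      using assms by (auto simp: less_mult_imp_div_less)
  qed (use assms in auto)
  then show ?thesis by (rule bij_betw_same_card)
qed

context config
begin

text \<open>The words counted here use every non-monochromatic block equally often, except for a bounded
  number of blocks at the end. In those, colours are laid out column by column in runs of length at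
  most the number of rows, so that the first two entries of each row differ and every colour
  is used a multiple of \<open>d\<close> times.\<close>

lemma many_nonmono_words:
  assumes k: "k \<ge> 2 * r" and md: "m \<ge> d"
  defines "\<beta> \<equiv> card (nonmono r k)"
  shows "\<exists>a. (\<forall>c<k. k * a c \<le> n + k * (r * (\<beta> + 1))) \<and> sum a {..<k} = n \<and>
    real \<beta> ^ m \<le> real \<beta> ^ (d * (\<beta> + 1)) * (exp 1 * (real m + 1)) ^ \<beta> *
      real (card {f \<in> words S {..<k} (\<lambda>c. d * a c). \<forall>e<m. (\<lambda>i\<in>{..<r}. f (e, i)) \<in> nonmono r k})"
proof -
  let ?B = "nonmono r k"
  have finB: "finite ?B" by (rule finite_nonmono)
  have k2: "k \<ge> 2" "k \<ge> 1" using k r2 by linarith+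
  have \<beta>0: "\<beta> \<ge> 1"
  proof -
    have "k * 1 < k * k ^ (r - 1)" using k2 r2 by (intro mult_strict_left_mono one_less_power) auto
    also have "\<dots> = k ^ r" using r2 by (cases r) auto
    finally show ?thesis unfolding \<beta>_def using card_nonmono[of r k] r2 by simp
  qed
  \<comment> \<open>Each block type occurs \<open>q = d * q'\<close> times in the first
    \<open>m0\<close> blocks, so colour counts there are multiples of \<open>d\<close>. Dividing
    \<open>m - d\<close> instead of \<open>m\<close> leaves at least \<open>d\<close> rows for the
    tail.\<close>
  define q' where "q' = (m - d) div (\<beta> * d)"
  define q where "q = d * q'"
  define m0 where "m0 = \<beta> * q"
  define s where "s = m - m0"
  have m0_le: "m0 + d \<le> m"
  proof -
    have "m0 = \<beta> * d * q'" by (simp add: m0_def q_def)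
    also have "\<dots> \<le> m - d" unfolding q'_def by (rule times_div_less_eq_dividend)
    finally show ?thesis using md by simp
  qed
  have ms: "m = m0 + s" using m0_le by (simp add: s_def)
  have sd: "s \<ge> d" using m0_le ms by simp
  have s1: "s \<ge> 1" using sd d1 by simp
  have s_le: "s \<le> d * (\<beta> + 1)"
  proof -
    have "m - d < \<beta> * d * q' + \<beta> * d"
    proof -
      have "0 < \<beta> * d" using \<beta>0 d1 by simp
      from dividend_less_times_div[OF this, of "m - d"] show ?thesis unfolding q'_def by linarith
    qed
    then have "m < m0 + \<beta> * d + d" using md by (simp add: m0_def q_def)
    then show ?thesis using ms by (simp add: algebra_simps)
  qed
  \<comment> \<open>The runs have length \<open>d * g\<close>, the largest multiple of
    \<open>d\<close> not exceeding the number \<open>s\<close> of rows.\<close>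
  define g where "g = s div d"
  have dg: "d * g \<le> s" unfolding g_def by simp
  have g1: "g \<ge> 1" unfolding g_def using sd d1 by (simp add: div_greater_zero_iff Suc_le_eq)
  have s2dg: "s \<le> 2 * (d * g)"
  proof -
    have "s < d * g + d" unfolding g_def using d1 dividend_less_times_div[of d s] by simp
    moreover have "d \<le> d * g" using g1 by simp
    ultimately show ?thesis by linarith
  qed
  \<comment> \<open>Rounding at most halves the run length, so \<open>k \<ge> 2 * r\<close> colours
    are enough to fill all \<open>r\<close> columns.\<close>
  have rs: "r * s \<le> k * (d * g)"
  proof -
    have "r * s \<le> r * (2 * (d * g))" using s2dg by (rule mult_left_mono) simp
    also have "\<dots> = (2 * r) * (d * g)" by simp
    also have "\<dots> \<le> k * (d * g)" using k by (rule mult_right_mono) simp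
    finally show ?thesis .
  qed
  define A where "A c = (\<Sum>b\<in>?B. card {i. i < r \<and> b i = c})" for c
  have kA: "k * A c = r * \<beta>" if "c < k" for c
    unfolding A_def \<beta>_def by (rule nonmono_color_count[OF that])
  \<comment> \<open>The tail has room for all points of exactly \<open>u\<close> vertices, as
    \<open>r * s = d * u\<close> shows.\<close>
  define u where "u = n - r * (\<beta> * q')"
  have du: "r * s = d * u"
  proof -
    have "r * m0 + r * s = d * n" using mr ms by (simp add: algebra_simps)
    moreover have "r * m0 = d * (r * (\<beta> * q'))" by (simp add: m0_def q_def)
    ultimately show ?thesis unfolding u_def by (simp add: diff_mult_distrib2)
  qed
  have nu: "n = r * (\<beta> * q') + u"
  proof -
    have "d * (r * (\<beta> * q')) \<le> d * n"
    proof -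
      have "d * (r * (\<beta> * q')) = r * m0" by (simp add: m0_def q_def)
      also have "\<dots> \<le> r * m" using ms by simp
      finally show ?thesis using mr by (simp add: mult.commute)
    qed
    then have "r * (\<beta> * q') \<le> n" using d1 by simp
    then show ?thesis by (simp add: u_def)
  qed
  have ukg: "u \<le> k * g"
  proof -
    have "d * u \<le> d * (k * g)" using rs du by (simp add: mult.left_commute)
    then show ?thesis using d1 by simp
  qed
  have u_le: "u \<le> r * (\<beta> + 1)"
  proof -
    have "d * u \<le> r * (d * (\<beta> + 1))" using du s_le by (metis mult_le_mono2)
    then have "d * u \<le> d * (r * (\<beta> + 1))" by (simp only: mult.left_commute)
    then show ?thesis using d1 by simp
  qed
  define w where "w c = card {y. y < u \<and> y div g = c}" for c
  define a where "a c = q' * A c + w c" for c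
  have w_le: "w c \<le> u" for c unfolding w_def using card_mono[of "{..<u}" "{y. y < u \<and> y div g = c}"] by auto
  have a_bound: "k * a c \<le> n + k * (r * (\<beta> + 1))" if "c < k" for c
  proof -
    have "k * a c = q' * (k * A c) + k * w c" by (simp add: a_def algebra_simps)
    also have "\<dots> = r * (\<beta> * q') + k * w c" using kA[OF that] by simp
    also have "\<dots> \<le> n + k * (r * (\<beta> + 1))"
    proof (rule add_mono)
      show "r * (\<beta> * q') \<le> n" using nu by simp
      show "k * w c \<le> k * (r * (\<beta> + 1))" using w_le[of c] u_le by (intro mult_left_mono) auto
    qed
    finally show ?thesis .
  qed
  have a_sum: "sum a {..<k} = n"
  proof -
    have "(\<Sum>c<k. A c) = r * \<beta>"
    proof -
      have "k * (\<Sum>c<k. A c) = (\<Sum>c<k. r * \<beta>)" using kA by (simp add: sum_distrib_left)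
      also have "\<dots> = k * (r * \<beta>)" by simp
      finally show ?thesis using k2 by simp
    qed
    moreover have "(\<Sum>c<k. w c) = u"
    proof -
      have "(\<Sum>c<k. w c) = (\<Sum>c<k. \<Sum>y\<in>{y \<in> {..<u}. y div g = c}. 1)" by (simp add: w_def)
      also have "\<dots> = (\<Sum>y<u. 1)"
      proof (rule sum.group)
        show "(\<lambda>y. y div g) ` {..<u} \<subseteq> {..<k}"
          using ukg less_le_trans[OF _ ukg] by (auto intro!: less_mult_imp_div_less)
      qed auto
      finally show ?thesis by simp
    qed
    ultimately show ?thesis
      using nu by (simp add: a_def sum.distrib sum_distrib_left[symmetric] algebra_simps)
  qed
  let ?W1 = "words {..<m0} ?B (\<lambda>_. q)"
  let ?M = "{f \<in> words S {..<k} (\<lambda>c. d * a c). \<forall>e<m. (\<lambda>i\<in>{..<r}. f (e, i)) \<in> ?B}"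
  define tl where "tl e i = (i * s + e) div (d * g)" for e i
  define F where "F \<phi> = (\<lambda>(e, i)\<in>S. if e < m0 then \<phi> e i else tl (e - m0) i)" for \<phi> :: "nat \<Rightarrow> nat \<Rightarrow> nat"
  have Fv: "F \<phi> (e, i) = (if e < m0 then \<phi> e i else tl (e - m0) i)" if "e < m" "i < r" for \<phi> e i
    using that by (simp add: F_def)
  have tl_lt: "tl e i < k" if "e < s" "i < r" for e i
  proof -
    have "i * s + e < (i + 1) * s" using that by simp
    also have "\<dots> \<le> r * s" using that by (intro mult_right_mono) auto
    also note rs
    finally show ?thesis unfolding tl_def by (rule less_mult_imp_div_less)
  qed
  \<comment> \<open>Horizontally adjacent slots are \<open>s \<ge> d * g\<close> ranks apart, so the
    run index goes up by at least 1.\<close>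
  have tl_ne: "tl e 0 \<noteq> tl e 1" for e
  proof -
    have "tl e 0 + 1 = (e + d * g) div (d * g)" unfolding tl_def using d1 g1 by simp
    also have "\<dots> \<le> (s + e) div (d * g)" using dg by (intro div_le_mono) simp
    also have "\<dots> = tl e 1" by (simp add: tl_def)
    finally show ?thesis by simp
  qed
  have inM: "F \<phi> \<in> ?M" if \<phi>: "\<phi> \<in> ?W1" for \<phi>
  proof -
    have \<phi>B: "\<phi> e \<in> ?B" if "e < m0" for e using \<phi> that by (auto simp: words_def)
    have \<phi>k: "\<phi> e i < k" if "e < m0" "i < r" for e i using \<phi>B[OF that(1)] that(2) by (auto simp: nonmono_def)
    have FS: "F \<phi> \<in> S \<rightarrow>\<^sub>E {..<k}"
    proof (rule PiE_I)
      fix x assume "x \<in> S"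
      then obtain e i where x: "x = (e, i)" "e < m" "i < r" by auto
      then show "F \<phi> x \<in> {..<k}" using Fv[OF x(2,3)] \<phi>k[of e i] tl_lt[of "e - m0" i] ms by auto
    qed (simp add: F_def)
    have blocks: "(\<lambda>i\<in>{..<r}. F \<phi> (e, i)) \<in> ?B" if e: "e < m" for e
    proof (cases "e < m0")
      case True
      have "(\<lambda>i\<in>{..<r}. F \<phi> (e, i)) = \<phi> e"
      proof
        fix i show "(\<lambda>i\<in>{..<r}. F \<phi> (e, i)) i = \<phi> e i"
          using Fv[OF e, of i] True \<phi>B[OF True] PiE_arb[of "\<phi> e" "{..<r}" "\<lambda>_. {..<k}" i]
          unfolding nonmono_def by (cases "i < r") auto
      qed
      then show ?thesis using \<phi>B[OF True] by simp
    next
      case False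
      have "F \<phi> (e, 0) \<noteq> F \<phi> (e, 1)" using tl_ne[of "e - m0"] Fv[OF e] False r2 by simp
      then have "\<not> (\<exists>c. \<forall>i<r. F \<phi> (e, i) = c)" 
      proof -
        have "0 < r" "1 < r" using r2 by auto
        then show ?thesis using \<open>F \<phi> (e, 0) \<noteq> F \<phi> (e, 1)\<close> by metis
      qed
      moreover have "\<forall>i<r. F \<phi> (e, i) < k" using FS e by auto
      ultimately show ?thesis unfolding nonmono_def by auto
    qed
    have count: "card {x \<in> S. F \<phi> x = c} = d * a c" if c: "c < k" for c
    proof -
      let ?P1 = "{x \<in> {..<m0} \<times> {..<r}. \<phi> (fst x) (snd x) = c}"
      let ?P2 = "{x \<in> {m0..<m} \<times> {..<r}. tl (fst x - m0) (snd x) = c}"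
      have "{x \<in> S. F \<phi> x = c} = ?P1 \<union> ?P2"
        using ms by (auto simp: Fv split: if_splits)
      moreover have "?P1 \<inter> ?P2 = {}" by auto
      moreover have "finite ?P1" "finite ?P2" by auto
      ultimately have "card {x \<in> S. F \<phi> x = c} = card ?P1 + card ?P2" by (simp add: card_Un_disjoint)
      moreover have "card ?P1 = q * A c"
      proof -
        have "?P1 = (SIGMA e:{..<m0}. {i. i < r \<and> \<phi> e i = c})" by auto
        then have "card ?P1 = (\<Sum>e<m0. card {i. i < r \<and> \<phi> e i = c})" by simp
        also have "\<dots> = (\<Sum>b\<in>?B. \<Sum>e\<in>{e \<in> {..<m0}. \<phi> e = b}. card {i. i < r \<and> \<phi> e i = c})"
          by (rule sum.group[symmetric]) (use \<phi>B finB in auto)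
        also have "\<dots> = (\<Sum>b\<in>?B. q * card {i. i < r \<and> b i = c})"
          using \<phi> by (intro sum.cong) (auto simp: words_def)
        finally show ?thesis by (simp add: A_def sum_distrib_left)
      qed
      moreover have "card ?P2 = d * w c"
      proof -
        have "bij_betw (\<lambda>x. (fst x - m0, snd x)) ?P2 {(e, i). e < s \<and> i < r \<and> (i * s + e) div (d * g) = c}"
          by (rule bij_betw_byWitness[where f' = "\<lambda>x. (fst x + m0, snd x)"]) (use ms in \<open>auto simp: tl_def\<close>)
        then have "card ?P2 = card {(e, i). e < s \<and> i < r \<and> (i * s + e) div (d * g) = c}" by (rule bij_betw_same_card)
        also have "\<dots> = card {x. x < r * s \<and> x div (d * g) = c}"
          by (rule card_columns[OF s1])
        also have "\<dots> = card {x. x < d * u \<and> (x div d) div g = c}"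
          unfolding du by (simp add: div_mult2_eq)
        also have "\<dots> = d * w c" unfolding w_def by (rule card_div_class[OF d1])
        finally show ?thesis .
      qed
      ultimately show ?thesis by (simp add: a_def q_def algebra_simps)
    qed
    show ?thesis using FS blocks count by (simp add: words_def)
  qed
  have inj: "inj_on F ?W1"
  proof (rule inj_onI)
    fix \<phi> \<psi> assume \<phi>: "\<phi> \<in> ?W1" and \<psi>: "\<psi> \<in> ?W1" and eq: "F \<phi> = F \<psi>"
    show "\<phi> = \<psi>"
    proof (rule PiE_ext[of _ "{..<m0}" "\<lambda>_. ?B"])
      show "\<phi> \<in> {..<m0} \<rightarrow>\<^sub>E ?B" "\<psi> \<in> {..<m0} \<rightarrow>\<^sub>E ?B" using \<phi> \<psi> by (auto simp: words_def)
      fix e assume e: "e \<in> {..<m0}"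
      have B: "\<phi> e \<in> ?B" "\<psi> e \<in> ?B" using \<phi> \<psi> e by (auto simp: words_def)
      show "\<phi> e = \<psi> e"
      proof (rule PiE_ext[of _ "{..<r}" "\<lambda>_. {..<k}"])
        show "\<phi> e \<in> {..<r} \<rightarrow>\<^sub>E {..<k}" "\<psi> e \<in> {..<r} \<rightarrow>\<^sub>E {..<k}" using B by (auto simp: nonmono_def)
        fix i assume i: "i \<in> {..<r}"
        have "F \<phi> (e, i) = F \<psi> (e, i)" using eq by simp
        then show "\<phi> e i = \<psi> e i" using e i ms by (simp add: Fv)
      qed
    qed
  qed
  have finM: "finite ?M" by (rule finite_subset[OF _ words_finite[OF finS finite_lessThan[of k]]]) auto
  have cW1: "card ?W1 \<le> card ?M" by (rule card_inj_on_le[OF inj _ finM]) (use inM in blast)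
  \<comment> \<open>The head is a word over the alphabet of blocks with uniform type, so there are
    \<open>\<beta> ^ m0\<close> of them up to a polynomial factor.\<close>
  have "1 \<le> (exp 1 * (real m0 + 1)) ^ \<beta> * (real (card ?W1) * (1 / real \<beta>) ^ m0)"
  proof -
    have "sum (\<lambda>_. q) ?B = card {..<m0}" by (simp add: m0_def \<beta>_def)
    from card_words_lower[OF finite_lessThan finB this]
    have "1 \<le> (exp 1 * (real m0 + 1)) ^ \<beta> * (real (card ?W1) * (\<Prod>c\<in>?B. (real q / real m0) ^ q))"
      by (simp add: \<beta>_def)
    moreover have "(\<Prod>c\<in>?B. (real q / real m0) ^ q) = (1 / real \<beta>) ^ m0"
    proof (cases "q = 0")
      case True
      then show ?thesis by (simp add: m0_def)
    next
      case False
      then have "real q / real m0 = 1 / real \<beta>" using \<beta>0 by (simp add: m0_def field_simps)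
      then show ?thesis by (simp add: \<beta>_def[symmetric] m0_def power_mult[symmetric] mult.commute)
    qed
    ultimately show ?thesis by simp
  qed
  then have b1: "real \<beta> ^ m0 \<le> (exp 1 * (real m0 + 1)) ^ \<beta> * real (card ?W1)"
    using \<beta>0 by (simp add: power_one_over field_simps)
  have "real \<beta> ^ m = real \<beta> ^ s * real \<beta> ^ m0" by (simp add: ms power_add)
  also have "\<dots> \<le> real \<beta> ^ (d * (\<beta> + 1)) * ((exp 1 * (real m + 1)) ^ \<beta> * real (card ?M))"
  proof (rule mult_mono)
    show "real \<beta> ^ s \<le> real \<beta> ^ (d * (\<beta> + 1))" using \<beta>0 s_le by (intro power_increasing) auto
    have "(exp 1 * (real m0 + 1)) ^ \<beta> * real (card ?W1) \<le> (exp 1 * (real m + 1)) ^ \<beta> * real (card ?M)"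
      using ms cW1 by (intro mult_mono power_mono mult_left_mono) auto
    then show "real \<beta> ^ m0 \<le> (exp 1 * (real m + 1)) ^ \<beta> * real (card ?M)" using b1 by linarith
  qed auto
  finally have "real \<beta> ^ m \<le> real \<beta> ^ (d * (\<beta> + 1)) * (exp 1 * (real m + 1)) ^ \<beta> * real (card ?M)"
    by (simp only: mult.assoc)
  then show ?thesis using a_bound a_sum by blast
qed

end

section \<open>The second moment of colourings\<close>

text \<open>Group the words by type. For a fixed type each summand is the probability of the word
  under the product law with its own frequencies, so each group contributes at most 1, and there are
  at most \<open>(card A + 1) ^ card C\<close> types.\<close>

lemma sum_types_le:
  assumes A: "finite A" and C: "finite C"
  shows "(\<Sum>f\<in>A \<rightarrow>\<^sub>E C. \<Prod>x\<in>A. real (card {y \<in> A. f y = f x}) / real (card A)) \<le> (real (card A) + 1) ^ card C"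
proof -
  define ty where "ty f = (\<lambda>c\<in>C. card {y \<in> A. f y = c})" for f :: "'a \<Rightarrow> 'b"
  define h where "h f = (\<Prod>x\<in>A. real (card {y \<in> A. f y = f x}) / real (card A))" for f :: "'a \<Rightarrow> 'b"
  let ?T = "C \<rightarrow>\<^sub>E {..card A}"
  have finF: "finite (A \<rightarrow>\<^sub>E C)" using A C by (intro finite_PiE) auto
  have finT: "finite ?T" using C by (intro finite_PiE) auto
  have "(\<Sum>f\<in>A \<rightarrow>\<^sub>E C. h f) = (\<Sum>t\<in>?T. \<Sum>f\<in>{f \<in> A \<rightarrow>\<^sub>E C. ty f = t}. h f)"
  proof (rule sum.group[symmetric, OF finF finT])
    show "ty ` (A \<rightarrow>\<^sub>E C) \<subseteq> ?T" unfolding ty_def using A by (auto intro!: card_mono)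
  qed
  also have "\<dots> \<le> (\<Sum>t\<in>?T. 1)"
  proof (rule sum_mono)
    fix t assume "t \<in> ?T"
    show "(\<Sum>f\<in>{f \<in> A \<rightarrow>\<^sub>E C. ty f = t}. h f) \<le> 1"
    proof (cases "{f \<in> A \<rightarrow>\<^sub>E C. ty f = t} = {}")
      case True
      then show ?thesis by (metis sum.empty zero_le_one)
    next
      case False
      then obtain f0 where f0: "f0 \<in> A \<rightarrow>\<^sub>E C" "ty f0 = t" by blast
      have tc: "t c = card {y \<in> A. f y = c}" if "ty f = t" "c \<in> C" for f c
        using that unfolding ty_def by auto
      have "(\<Sum>c\<in>C. t c) = (\<Sum>c\<in>C. \<Sum>y\<in>{y \<in> A. f0 y = c}. 1)" using tc[OF f0(2)] by simp
      also have "\<dots> = (\<Sum>y\<in>A. 1)" by (rule sum.group) (use A C f0 in auto)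
      finally have tsum: "(\<Sum>c\<in>C. t c) = card A" by simp
      have "(\<Sum>f\<in>{f \<in> A \<rightarrow>\<^sub>E C. ty f = t}. h f) = (\<Sum>f\<in>{f \<in> A \<rightarrow>\<^sub>E C. ty f = t}. \<Prod>x\<in>A. real (t (f x)) / real (card A))"
      proof (rule sum.cong[OF refl])
        fix f assume f: "f \<in> {f \<in> A \<rightarrow>\<^sub>E C. ty f = t}"
        then have "t (f x) = card {y \<in> A. f y = f x}" if "x \<in> A" for x using tc[of f "f x"] that by auto
        then show "h f = (\<Prod>x\<in>A. real (t (f x)) / real (card A))" unfolding h_def by simp
      qed
      also have "\<dots> \<le> (\<Sum>f\<in>A \<rightarrow>\<^sub>E C. \<Prod>x\<in>A. real (t (f x)) / real (card A))"
        by (rule sum_mono2[OF finF]) (auto intro!: prod_nonneg)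
      also have "\<dots> = (\<Prod>x\<in>A. \<Sum>c\<in>C. real (t c) / real (card A))"
        by (rule prod_sum_PiE[symmetric]) (use A C in auto)
      also have "\<dots> = (\<Prod>x\<in>A. 1)"
      proof (rule prod.cong[OF refl])
        fix x assume "x \<in> A"
        then have "card A > 0" using A by (auto simp: card_gt_0_iff)
        moreover have "(\<Sum>c\<in>C. real (t c)) = real (card A)" using tsum by (metis of_nat_sum)
        ultimately show "(\<Sum>c\<in>C. real (t c) / real (card A)) = 1" by (simp add: sum_divide_distrib[symmetric])
      qed
      finally show ?thesis by simp
    qed
  qed
  also have "\<dots> = (real (card A) + 1) ^ card C" using C by (simp add: card_funcsetE add.commute)
  finally show ?thesis unfolding h_def .
qed

text \<open>Cauchy--Schwarz for the number \<open>X\<close> of events that occur, written as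
  \<open>X\<close> times the indicator that one occurs.\<close>

lemma perm_prob_second_moment:
  assumes S: "finite S" and I: "finite I"
  shows "(\<Sum>i\<in>I. perm_prob S (Q i))\<^sup>2 \<le> perm_prob S (\<lambda>p. \<exists>i\<in>I. Q i p) * (\<Sum>i\<in>I. \<Sum>j\<in>I. perm_prob S (\<lambda>p. Q i p \<and> Q j p))"
proof -
  let ?\<Omega> = "{p. p permutes S}" and ?F = "fact (card S) :: real"
  define X where "X p = (\<Sum>i\<in>I. of_bool (Q i p) :: real)" for p
  define Y where "Y p = (of_bool (\<exists>i\<in>I. Q i p) :: real)" for p
  have fin: "finite ?\<Omega>" by (rule finite_permutations[OF S])
  have XY: "X p = Y p * X p" for p
  proof (cases "\<exists>i\<in>I. Q i p")
    case False
    then have "X p = 0" unfolding X_def by (intro sum.neutral) auto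
    then show ?thesis by simp
  qed (simp add: Y_def)
  have 1: "(\<Sum>i\<in>I. perm_prob S (Q i)) = (\<Sum>p\<in>?\<Omega>. X p) / ?F"
    unfolding perm_prob_eq_sum[OF S] X_def sum_divide_distrib[symmetric] by (subst sum.swap) simp
  have 2: "perm_prob S (\<lambda>p. \<exists>i\<in>I. Q i p) = (\<Sum>p\<in>?\<Omega>. (Y p)\<^sup>2) / ?F"
  proof -
    have "(Y p)\<^sup>2 = of_bool (\<exists>i\<in>I. Q i p)" for p unfolding Y_def by (cases "\<exists>i\<in>I. Q i p") auto
    then show ?thesis unfolding perm_prob_eq_sum[OF S] by simp
  qed
  have 3: "(\<Sum>i\<in>I. \<Sum>j\<in>I. perm_prob S (\<lambda>p. Q i p \<and> Q j p)) = (\<Sum>p\<in>?\<Omega>. (X p)\<^sup>2) / ?F"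
  proof -
    have "(\<Sum>p\<in>?\<Omega>. (X p)\<^sup>2) = (\<Sum>p\<in>?\<Omega>. \<Sum>i\<in>I. \<Sum>j\<in>I. of_bool (Q i p \<and> Q j p))"
      unfolding X_def power2_eq_square sum_product of_bool_conj ..
    also have "\<dots> = (\<Sum>i\<in>I. \<Sum>p\<in>?\<Omega>. \<Sum>j\<in>I. of_bool (Q i p \<and> Q j p))" by (rule sum.swap)
    also have "\<dots> = (\<Sum>i\<in>I. \<Sum>j\<in>I. \<Sum>p\<in>?\<Omega>. of_bool (Q i p \<and> Q j p))"
      by (intro sum.cong refl sum.swap)
    finally show ?thesis unfolding perm_prob_eq_sum[OF S] by (simp add: sum_divide_distrib)
  qed
  have "(\<Sum>p\<in>?\<Omega>. X p)\<^sup>2 = (\<Sum>p\<in>?\<Omega>. Y p * X p)\<^sup>2" by (simp only: XY[symmetric])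
  also have "\<dots> \<le> (\<Sum>p\<in>?\<Omega>. (Y p)\<^sup>2) * (\<Sum>p\<in>?\<Omega>. (X p)\<^sup>2)" by (rule Cauchy_Schwarz_ineq_sum)
  finally have "(\<Sum>p\<in>?\<Omega>. X p)\<^sup>2 / ?F\<^sup>2 \<le> (\<Sum>p\<in>?\<Omega>. (Y p)\<^sup>2) * (\<Sum>p\<in>?\<Omega>. (X p)\<^sup>2) / ?F\<^sup>2" by (rule divide_right_mono) simp
  then show ?thesis unfolding 1 2 3 by (simp add: power2_eq_square)
qed

text \<open>The power mean inequality, by Bernoulli at \<open>card K * \<alpha> c\<close>, where the
  linear terms cancel in the sum.\<close>

lemma sum_power_ge:
  fixes \<alpha> :: "'a \<Rightarrow> real"
  assumes "finite K" "card K \<ge> 1" "\<And>c. c \<in> K \<Longrightarrow> \<alpha> c \<ge> 0" "sum \<alpha> K = 1" "r \<ge> 1"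
  shows "1 / real (card K) ^ (r - 1) \<le> (\<Sum>c\<in>K. \<alpha> c ^ r)"
proof -
  let ?k = "real (card K)"
  have k: "?k > 0" using assms by simp
  have "?k = (\<Sum>c\<in>K. 1 + real r * (?k * \<alpha> c - 1))"
    using assms(4) by (simp add: sum.distrib sum_distrib_left[symmetric] sum_subtractf)
  also have "\<dots> \<le> (\<Sum>c\<in>K. (?k * \<alpha> c) ^ r)"
  proof (rule sum_mono)
    fix c assume "c \<in> K"
    then have "-1 \<le> ?k * \<alpha> c - 1" using assms k by simp
    from Bernoulli_inequality[OF this, of r] show "1 + real r * (?k * \<alpha> c - 1) \<le> (?k * \<alpha> c) ^ r" by simp
  qed
  also have "\<dots> = ?k ^ r * (\<Sum>c\<in>K. \<alpha> c ^ r)" by (simp add: power_mult_distrib sum_distrib_left)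
  also have "?k ^ r = ?k * ?k ^ (r - 1)" using assms(5) by (cases r) auto
  finally have "1 \<le> ?k ^ (r - 1) * (\<Sum>c\<in>K. \<alpha> c ^ r)" using k by (simp add: mult.assoc)
  then show ?thesis using k by (simp add: field_simps)
qed

lemma sum_constant_blocks:
  fixes z :: "'c \<Rightarrow> real" and h :: "'c \<Rightarrow> 'k"
  assumes C: "finite C" and K: "finite K" "h \<in> C \<rightarrow> K" and r: "r \<ge> 1"
  shows "(\<Sum>b\<in>{b \<in> {..<r} \<rightarrow>\<^sub>E C. \<exists>c. \<forall>i<r. h (b i) = c}. \<Prod>i<r. z (b i)) = (\<Sum>c\<in>K. (\<Sum>x\<in>{x \<in> C. h x = c}. z x) ^ r)"
proof -
  have "{b \<in> {..<r} \<rightarrow>\<^sub>E C. \<exists>c. \<forall>i<r. h (b i) = c} = (\<Union>c\<in>K. {..<r} \<rightarrow>\<^sub>E {x \<in> C. h x = c})"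
  proof (intro equalityI subsetI)
    fix b assume "b \<in> {b \<in> {..<r} \<rightarrow>\<^sub>E C. \<exists>c. \<forall>i<r. h (b i) = c}"
    then obtain c where b: "b \<in> {..<r} \<rightarrow>\<^sub>E C" and c: "\<forall>i<r. h (b i) = c" by blast
    have "c \<in> K" using b c K(2) r PiE_mem[OF b, of 0] by force
    moreover have "b \<in> {..<r} \<rightarrow>\<^sub>E {x \<in> C. h x = c}" using b c by (auto simp: PiE_iff)
    ultimately show "b \<in> (\<Union>c\<in>K. {..<r} \<rightarrow>\<^sub>E {x \<in> C. h x = c})" by blast
  next
    fix b assume "b \<in> (\<Union>c\<in>K. {..<r} \<rightarrow>\<^sub>E {x \<in> C. h x = c})"
    then obtain c where "b \<in> {..<r} \<rightarrow>\<^sub>E {x \<in> C. h x = c}" by blast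
    then show "b \<in> {b \<in> {..<r} \<rightarrow>\<^sub>E C. \<exists>c. \<forall>i<r. h (b i) = c}" by (auto simp: PiE_iff)
  qed
  then have "(\<Sum>b\<in>{b \<in> {..<r} \<rightarrow>\<^sub>E C. \<exists>c. \<forall>i<r. h (b i) = c}. \<Prod>i<r. z (b i)) = (\<Sum>b\<in>(\<Union>c\<in>K. {..<r} \<rightarrow>\<^sub>E {x \<in> C. h x = c}). \<Prod>i<r. z (b i))"
    by simp
  also have "\<dots> = (\<Sum>c\<in>K. \<Sum>b\<in>{..<r} \<rightarrow>\<^sub>E {x \<in> C. h x = c}. \<Prod>i<r. z (b i))"
  proof (rule sum.UNION_disjoint[OF K(1)])
    show "\<forall>c\<in>K. finite ({..<r} \<rightarrow>\<^sub>E {x \<in> C. h x = c})" using C by (intro ballI finite_PiE) auto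
    show "\<forall>c\<in>K. \<forall>c'\<in>K. c \<noteq> c' \<longrightarrow> ({..<r} \<rightarrow>\<^sub>E {x \<in> C. h x = c}) \<inter> ({..<r} \<rightarrow>\<^sub>E {x \<in> C. h x = c'}) = {}"
    proof (intro ballI impI)
      fix c c' :: 'k assume "c \<noteq> c'"
      show "({..<r} \<rightarrow>\<^sub>E {x \<in> C. h x = c}) \<inter> ({..<r} \<rightarrow>\<^sub>E {x \<in> C. h x = c'}) = {}"
      proof (rule ccontr)
        assume "\<not> ?thesis"
        then obtain b where "b \<in> {..<r} \<rightarrow>\<^sub>E {x \<in> C. h x = c}" "b \<in> {..<r} \<rightarrow>\<^sub>E {x \<in> C. h x = c'}" by blast
        from PiE_mem[OF this(1), of 0] PiE_mem[OF this(2), of 0] show False using r \<open>c \<noteq> c'\<close> by auto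
      qed
    qed
  qed
  also have "\<dots> = (\<Sum>c\<in>K. (\<Sum>x\<in>{x \<in> C. h x = c}. z x) ^ r)"
  proof (rule sum.cong[OF refl])
    fix c :: 'k
    have "(\<Prod>i<r. \<Sum>x\<in>{x \<in> C. h x = c}. z x) = (\<Sum>b\<in>{..<r} \<rightarrow>\<^sub>E {x \<in> C. h x = c}. \<Prod>i<r. z (b i))"
      by (rule prod_sum_PiE) (use C in auto)
    then show "(\<Sum>b\<in>{..<r} \<rightarrow>\<^sub>E {x \<in> C. h x = c}. \<Prod>i<r. z (b i)) = (\<Sum>x\<in>{x \<in> C. h x = c}. z x) ^ r" by simp
  qed
  finally show ?thesis .
qed

text \<open>Inclusion--exclusion over the two events that a random block is constant in its first,
  respectively second, coordinate; both have probability at least \<open>1 / k ^ (r - 1)\<close>.\<close>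

lemma sum_doubly_nonconstant_blocks_le:
  fixes p :: "nat \<times> nat \<Rightarrow> real"
  assumes r: "r \<ge> 1" and k: "k \<ge> 1" and p0: "\<And>x. p x \<ge> 0" and psum: "sum p ({..<k} \<times> {..<k}) = 1"
  shows "(\<Sum>b\<in>{b \<in> {..<r} \<rightarrow>\<^sub>E {..<k} \<times> {..<k}. \<not> (\<exists>c. \<forall>i<r. fst (b i) = c) \<and> \<not> (\<exists>c. \<forall>i<r. snd (b i) = c)}. \<Prod>i<r. p (b i))
    \<le> 1 - 2 * (1 / real k ^ (r - 1)) + (\<Sum>x\<in>{..<k} \<times> {..<k}. p x ^ r)"
proof -
  let ?C = "{..<k} \<times> {..<k}"
  let ?P = "{..<r} \<rightarrow>\<^sub>E ?C"
  let ?M1 = "{b \<in> ?P. \<exists>c. \<forall>i<r. fst (b i) = c}" and ?M2 = "{b \<in> ?P. \<exists>c. \<forall>i<r. snd (b i) = c}"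
  let ?M3 = "{b \<in> ?P. \<exists>c. \<forall>i<r. (\<lambda>x. x) (b i) = c}"
  define f where "f b = (\<Prod>i<r. p (b i))" for b
  have finP: "finite ?P" by (intro finite_PiE) auto
  have fin: "finite ?M1" "finite ?M2" using finP by auto
  have inter: "?M1 \<inter> ?M2 = ?M3"
  proof (intro equalityI subsetI)
    fix b assume "b \<in> ?M1 \<inter> ?M2"
    then obtain c c' where b: "b \<in> ?P" "\<forall>i<r. fst (b i) = c" "\<forall>i<r. snd (b i) = c'" by blast
    then have "\<forall>i<r. b i = (c, c')" by (simp add: prod_eq_iff)
    then show "b \<in> ?M3" using b by blast
  next
    fix b assume "b \<in> ?M3"
    then obtain c where "b \<in> ?P" "\<forall>i<r. b i = c" by blast
    then have "b \<in> ?P" "\<forall>i<r. fst (b i) = fst c" "\<forall>i<r. snd (b i) = snd c" by simp_all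
    then show "b \<in> ?M1 \<inter> ?M2" by blast
  qed
  have eq: "{b \<in> ?P. \<not> (\<exists>c. \<forall>i<r. fst (b i) = c) \<and> \<not> (\<exists>c. \<forall>i<r. snd (b i) = c)} = ?P - (?M1 \<union> ?M2)" by blast
  have "sum f (?P - (?M1 \<union> ?M2)) = sum f ?P - sum f (?M1 \<union> ?M2)"
    using finP by (intro sum_diff) auto
  also have "sum f (?M1 \<union> ?M2) = sum f ?M1 + sum f ?M2 - sum f ?M3"
    using sum.union_inter[OF fin, of f] unfolding inter by linarith
  also have "sum f ?P = 1"
  proof -
    have "(\<Prod>i<r. sum p ?C) = sum f ?P" unfolding f_def by (rule prod_sum_PiE) auto
    then show ?thesis using psum by simp
  qed
  also have "sum f ?M3 = (\<Sum>x\<in>?C. p x ^ r)"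
  proof -
    have "sum f ?M3 = (\<Sum>c\<in>?C. (\<Sum>x\<in>{x \<in> ?C. x = c}. p x) ^ r)"
      unfolding f_def by (rule sum_constant_blocks) (use r in auto)
    also have "\<dots> = (\<Sum>c\<in>?C. p c ^ r)"
    proof (rule sum.cong[OF refl])
      fix c assume "c \<in> ?C"
      then have "{x \<in> ?C. x = c} = {c}" by auto
      then show "(\<Sum>x\<in>{x \<in> ?C. x = c}. p x) ^ r = p c ^ r" by simp
    qed
    finally show ?thesis .
  qed
  also have "1 - (sum f ?M1 + sum f ?M2 - (\<Sum>x\<in>?C. p x ^ r)) \<le> 1 - 2 * (1 / real k ^ (r - 1)) + (\<Sum>x\<in>?C. p x ^ r)"
  proof -
    have lower: "1 / real k ^ (r - 1) \<le> (\<Sum>b\<in>{b \<in> ?P. \<exists>c. \<forall>i<r. h (b i) = c}. f b)" if h: "h \<in> ?C \<rightarrow> {..<k}" for h :: "nat \<times> nat \<Rightarrow> nat"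
    proof -
      have "(\<Sum>c<k. \<Sum>x\<in>{x \<in> ?C. h x = c}. p x) = sum p ?C" by (rule sum.group) (use h in auto)
      then have "1 / real (card {..<k}) ^ (r - 1) \<le> (\<Sum>c<k. (\<Sum>x\<in>{x \<in> ?C. h x = c}. p x) ^ r)"
        using psum p0 k r by (intro sum_power_ge) (auto intro: sum_nonneg)
      also have "\<dots> = (\<Sum>b\<in>{b \<in> ?P. \<exists>c. \<forall>i<r. h (b i) = c}. f b)"
        unfolding f_def by (rule sum_constant_blocks[symmetric]) (use h r in auto)
      finally show ?thesis by simp
    qed
    have "1 / real k ^ (r - 1) \<le> sum f ?M1" by (rule lower) auto
    moreover have "1 / real k ^ (r - 1) \<le> sum f ?M2" by (rule lower) auto
    ultimately show ?thesis by linarith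
  qed
  finally show ?thesis unfolding eq f_def .
qed

text \<open>The right-hand side is the relative entropy of \<open>p\<close> to the uniform
  distribution on \<open>C\<close>. Substitute \<open>y = k^2 * p\<close>: as \<open>y\<close> sums
  to \<open>k^2\<close>, the linear terms of \<open>F\<close> cancel on both sides, and
  \<open>\<kappa>^2 * (k^2) ^ r = k^2\<close> matches the normalisation of the power sums.\<close>

lemma relative_entropy_bound:
  fixes p :: "'a \<Rightarrow> real" and \<kappa> A s :: real
  assumes C: "finite C" "card C = k\<^sup>2" and k: "k \<ge> 2" and r: "r \<ge> 2" and \<kappa>: "\<kappa> = 1 / real k ^ (r - 1)"
    and p: "\<And>x. x \<in> C \<Longrightarrow> 0 \<le> p x \<and> (real k)\<^sup>2 * p x \<le> Y" and psum: "sum p C = 1"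
    and F: "\<And>y. 0 \<le> y \<Longrightarrow> y \<le> Y \<Longrightarrow> A * \<kappa>\<^sup>2 * (y ^ r - 1 - real r * (y - 1)) \<le> y * ln y - y + 1"
  shows "A * ((\<Sum>x\<in>C. p x ^ r) - \<kappa>\<^sup>2) \<le> (\<Sum>x\<in>C. p x * ln ((real k)\<^sup>2 * p x))"
proof -
  let ?k = "real k"
  have k0: "?k > 0" using k by simp
  define y where "y x = ?k\<^sup>2 * p x" for x
  have ysum: "sum y C = ?k\<^sup>2" unfolding y_def sum_distrib_left[symmetric] psum by simp
  have cC: "real (card C) = ?k\<^sup>2" using C by simp
  have \<kappa>k: "\<kappa>\<^sup>2 * (?k\<^sup>2) ^ r = ?k\<^sup>2"
  proof -
    have "(?k\<^sup>2) ^ r = (?k ^ r)\<^sup>2" by (simp add: power_mult[symmetric] mult.commute)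
    also have "?k ^ r = ?k * ?k ^ (r - 1)" using r by (cases r) auto
    finally show ?thesis unfolding \<kappa> using k0 by (simp add: power_mult_distrib power_divide)
  qed
  have "A * \<kappa>\<^sup>2 * (\<Sum>x\<in>C. y x ^ r - 1 - real r * (y x - 1)) = A * (?k\<^sup>2 * ((\<Sum>x\<in>C. p x ^ r) - \<kappa>\<^sup>2))"
  proof -
    have "(\<Sum>x\<in>C. y x ^ r - 1 - real r * (y x - 1)) = (\<Sum>x\<in>C. y x ^ r) - ?k\<^sup>2 - real r * (sum y C - ?k\<^sup>2)"
      by (simp add: sum_subtractf sum_distrib_left[symmetric] cC)
    also have "\<dots> = (?k\<^sup>2) ^ r * (\<Sum>x\<in>C. p x ^ r) - ?k\<^sup>2"
      unfolding ysum by (simp add: y_def power_mult_distrib sum_distrib_left)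
    finally have "(\<Sum>x\<in>C. y x ^ r - 1 - real r * (y x - 1)) = (?k\<^sup>2) ^ r * (\<Sum>x\<in>C. p x ^ r) - ?k\<^sup>2" .
    then have "\<kappa>\<^sup>2 * (\<Sum>x\<in>C. y x ^ r - 1 - real r * (y x - 1)) = \<kappa>\<^sup>2 * (?k\<^sup>2) ^ r * (\<Sum>x\<in>C. p x ^ r) - \<kappa>\<^sup>2 * ?k\<^sup>2"
      by (simp only: right_diff_distrib mult.assoc)
    also have "\<dots> = ?k\<^sup>2 * ((\<Sum>x\<in>C. p x ^ r) - \<kappa>\<^sup>2)" unfolding \<kappa>k by (simp add: algebra_simps)
    finally show ?thesis by (simp only: mult.assoc)
  qed
  moreover have "A * \<kappa>\<^sup>2 * (\<Sum>x\<in>C. y x ^ r - 1 - real r * (y x - 1)) \<le> (\<Sum>x\<in>C. y x * ln (y x) - y x + 1)"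
    unfolding sum_distrib_left
  proof (rule sum_mono)
    fix x assume "x \<in> C"
    then show "A * \<kappa>\<^sup>2 * (y x ^ r - 1 - real r * (y x - 1)) \<le> y x * ln (y x) - y x + 1"
      using p[of x] by (intro F) (auto simp: y_def)
  qed
  moreover have "(\<Sum>x\<in>C. y x * ln (y x) - y x + 1) = ?k\<^sup>2 * (\<Sum>x\<in>C. p x * ln (?k\<^sup>2 * p x))"
  proof -
    have "(\<Sum>x\<in>C. y x * ln (y x) - y x + 1) = (\<Sum>x\<in>C. y x * ln (y x)) - sum y C + ?k\<^sup>2"
      by (simp add: sum.distrib sum_subtractf cC)
    then have "(\<Sum>x\<in>C. y x * ln (y x) - y x + 1) = (\<Sum>x\<in>C. y x * ln (y x))" unfolding ysum by simp
    then show ?thesis by (simp add: y_def sum_distrib_left mult.assoc)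
  qed
  ultimately have "?k\<^sup>2 * (A * ((\<Sum>x\<in>C. p x ^ r) - \<kappa>\<^sup>2)) \<le> ?k\<^sup>2 * (\<Sum>x\<in>C. p x * ln (?k\<^sup>2 * p x))"
    by (simp only: mult.left_commute)
  then show ?thesis using k0 by simp
qed

section \<open>Joint behaviour of two colourings\<close>

context config
begin

definition proper_word :: "(nat \<Rightarrow> nat) \<Rightarrow> (nat \<times> nat \<Rightarrow> nat \<times> nat) \<Rightarrow> bool" where
  "proper_word \<sigma> \<pi> \<longleftrightarrow> (\<forall>e<m. \<not> (\<exists>c. \<forall>i<r. \<sigma> (vt (\<pi> (e, i))) = c))"

text \<open>The excess of one joint block over independence, raised to the power \<open>m\<close>,
  is traded for relative entropy. The result is written as a product of empirical frequencies over
  the vertices so that it can be summed over all pairs by \<open>sum_types_le\<close>.\<close>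

lemma perm_prob_both_proper_le:
  assumes n: "n > 0" and k: "k \<ge> 2" and \<kappa>: "\<kappa> = 1 / real k ^ (r - 1)"
    and \<sigma>: "\<sigma> \<in> {1..n} \<rightarrow>\<^sub>E {..<k}" and \<tau>: "\<tau> \<in> {1..n} \<rightarrow>\<^sub>E {..<k}"
    and bal: "\<And>c. c < k \<Longrightarrow> (real k)\<^sup>2 * (real (card {v \<in> {1..n}. \<sigma> v = c}) / real n) \<le> Y"
    and F: "\<And>y. 0 \<le> y \<Longrightarrow> y \<le> Y \<Longrightarrow> real d / (real r * (1 - \<kappa>)\<^sup>2) * \<kappa>\<^sup>2 * (y ^ r - 1 - real r * (y - 1)) \<le> y * ln y - y + 1"
  shows "perm_prob S (\<lambda>\<pi>. proper_word \<sigma> \<pi> \<and> proper_word \<tau> \<pi>) \<le>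
    (exp 1 * (real (m * r) + 1)) ^ k\<^sup>2 * ((1 - \<kappa>) ^ (2 * m) * (real k ^ (2 * n) *
      (\<Prod>v\<in>{1..n}. real (card {u \<in> {1..n}. (\<sigma> u, \<tau> u) = (\<sigma> v, \<tau> v)}) / real n)))"
proof -
  let ?C = "{..<k} \<times> {..<k}"
  define f where "f v = (\<sigma> v, \<tau> v)" for v
  have f: "f \<in> {1..n} \<rightarrow> ?C"
  proof (rule Pi_I)
    fix v assume v: "v \<in> {1..n}"
    show "f v \<in> ?C" using PiE_mem[OF \<sigma> v] PiE_mem[OF \<tau> v] by (simp add: f_def)
  qed
  define cnt where "cnt x = card {v \<in> {1..n}. f v = x}" for x
  define p where "p x = real (cnt x) / real n" for x
  have p0: "p x \<ge> 0" for x by (simp add: p_def)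
  have cntsum: "sum cnt ?C = n"
  proof -
    have "sum cnt ?C = (\<Sum>x\<in>?C. \<Sum>v\<in>{v \<in> {1..n}. f v = x}. 1)" by (simp add: cnt_def)
    also have "\<dots> = (\<Sum>v\<in>{1..n}. 1)" by (rule sum.group[OF _ _ funcset_image[OF f]]) auto
    finally show ?thesis by simp
  qed
  have psum: "sum p ?C = 1"
  proof -
    have "sum p ?C = real (sum cnt ?C) / real n" by (simp add: p_def sum_divide_distrib)
    then show ?thesis using cntsum n by simp
  qed
  let ?B = "{b \<in> {..<r} \<rightarrow>\<^sub>E ?C. \<not> (\<exists>c. \<forall>i<r. fst (b i) = c) \<and> \<not> (\<exists>c. \<forall>i<r. snd (b i) = c)}"
  define s where "s = (\<Sum>x\<in>?C. p x ^ r)"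
  have \<kappa>1: "0 < \<kappa>" "\<kappa> < 1" unfolding \<kappa> using k r2 by (auto intro!: one_less_power)
  have blk: "(\<Sum>b\<in>?B. \<Prod>i<r. p (b i)) \<le> 1 - 2 * \<kappa> + s"
    unfolding \<kappa> s_def by (rule sum_doubly_nonconstant_blocks_le) (use r2 k p0 psum in auto)
  have "perm_prob S (\<lambda>\<pi>. proper_word \<sigma> \<pi> \<and> proper_word \<tau> \<pi>) \<le> perm_prob S (\<lambda>\<pi>. \<forall>e<m. (\<lambda>i\<in>{..<r}. (f \<circ> vt) (\<pi> (e, i))) \<in> ?B)"
  proof (rule perm_prob_mono[OF finS])
    fix \<pi> assume pi: "\<pi> permutes S" and pr: "proper_word \<sigma> \<pi> \<and> proper_word \<tau> \<pi>"
    show "\<forall>e<m. (\<lambda>i\<in>{..<r}. (f \<circ> vt) (\<pi> (e, i))) \<in> ?B"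
    proof (intro allI impI)
      fix e assume e: "e < m"
      have "f (vt (\<pi> (e, i))) \<in> ?C" if "i < r" for i
      proof -
        have "(e, i) \<in> S" using e that by simp
        then have "\<pi> (e, i) \<in> S" by (simp only: permutes_in_image[OF pi])
        then show ?thesis by (intro funcset_mem[OF f] funcset_mem[OF vt_in])
      qed
      then have 1: "(\<lambda>i\<in>{..<r}. (f \<circ> vt) (\<pi> (e, i))) \<in> {..<r} \<rightarrow>\<^sub>E ?C" (is "?b \<in> _")
        by (intro restrict_PiE_iff[THEN iffD2]) simp
      have c: "fst (?b i) = \<sigma> (vt (\<pi> (e, i)))" "snd (?b i) = \<tau> (vt (\<pi> (e, i)))" if "i < r" for i
        using that by (simp_all add: f_def)
      have "\<not> (\<exists>c. \<forall>i<r. \<sigma> (vt (\<pi> (e, i))) = c)" "\<not> (\<exists>c. \<forall>i<r. \<tau> (vt (\<pi> (e, i))) = c)"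
        using pr e unfolding proper_word_def by blast+
      then have "\<not> (\<exists>c. \<forall>i<r. fst (?b i) = c) \<and> \<not> (\<exists>c. \<forall>i<r. snd (?b i) = c)"
        using c by metis
      with 1 show "?b \<in> ?B" by blast
    qed
  qed
  also have "\<dots> \<le> (exp 1 * (real (m * r) + 1)) ^ card ?C * (\<Sum>b\<in>?B. \<Prod>i<r. real (d * cnt (b i)) / real (m * r)) ^ m"
  proof (rule perm_prob_blocks_le)
    show "f \<circ> vt \<in> S \<rightarrow> ?C"
      by (intro Pi_I, unfold comp_def, rule funcset_mem[OF f funcset_mem[OF vt_in]])
    show "card {x \<in> S. (f \<circ> vt) x = c} = d * cnt c" for c
      using card_points[OF f, of c] by (simp add: cnt_def)
  qed auto
  also have "(\<lambda>x. real (d * cnt x) / real (m * r)) = p"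
    using d1 unfolding mr p_def by auto
  also have "card ?C = k\<^sup>2" by (simp add: card_cartesian_product power2_eq_square)
  finally have 1: "perm_prob S (\<lambda>\<pi>. proper_word \<sigma> \<pi> \<and> proper_word \<tau> \<pi>) \<le>
     (exp 1 * (real (m * r) + 1)) ^ k\<^sup>2 * (\<Sum>b\<in>?B. \<Prod>i<r. p (b i)) ^ m" .
  define A where "A = real d / (real r * (1 - \<kappa>)\<^sup>2)"
  define Z where "Z = (\<Sum>x\<in>?C. p x * ln ((real k)\<^sup>2 * p x))"
  have AZ: "A * (s - \<kappa>\<^sup>2) \<le> Z"
    unfolding s_def Z_def
  proof (rule relative_entropy_bound[OF _ _ k r2 \<kappa> _ psum F[folded A_def]])
    show "card ?C = k\<^sup>2" by (simp add: card_cartesian_product power2_eq_square)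
    fix x assume x: "x \<in> ?C"
    \<comment> \<open>An overlap of classes is at most a whole colour class of \<sigma>; this keeps
      \<open>y\<close> below \<open>Y\<close>.\<close>
    have "cnt x \<le> card {v \<in> {1..n}. \<sigma> v = fst x}" unfolding cnt_def f_def by (rule card_mono) auto
    then have "p x \<le> real (card {v \<in> {1..n}. \<sigma> v = fst x}) / real n" unfolding p_def by (intro divide_right_mono) auto
    then have "(real k)\<^sup>2 * p x \<le> (real k)\<^sup>2 * (real (card {v \<in> {1..n}. \<sigma> v = fst x}) / real n)" by (rule mult_left_mono) simp
    also have "\<dots> \<le> Y" using x by (intro bal) auto
    finally show "0 \<le> p x \<and> (real k)\<^sup>2 * p x \<le> Y" using p0 by simp
  qed auto
  have mA: "real m * ((s - \<kappa>\<^sup>2) / (1 - \<kappa>)\<^sup>2) \<le> real n * Z"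
  proof -
    have "real m * real r = real n * real d" using mr by (metis of_nat_mult)
    then have "real m = real n * (real d / real r)" using r2 by (simp add: field_simps)
    then have "real m * ((s - \<kappa>\<^sup>2) / (1 - \<kappa>)\<^sup>2) = real n * (A * (s - \<kappa>\<^sup>2))" by (simp add: A_def)
    also have "\<dots> \<le> real n * Z" using AZ by (rule mult_left_mono) simp
    finally show ?thesis .
  qed
  have expZ: "exp (real n * Z) = real k ^ (2 * n) * (\<Prod>v\<in>{1..n}. p (f v))"
  proof -
    have "exp (real n * Z) = (\<Prod>x\<in>?C. exp (real n * (p x * ln ((real k)\<^sup>2 * p x))))"
      unfolding Z_def sum_distrib_left by (rule exp_sum) simp
    also have "\<dots> = (\<Prod>x\<in>?C. ((real k)\<^sup>2 * p x) ^ cnt x)"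
    proof (rule prod.cong[OF refl])
      fix x
      show "exp (real n * (p x * ln ((real k)\<^sup>2 * p x))) = ((real k)\<^sup>2 * p x) ^ cnt x"
      proof (cases "cnt x = 0")
        case True
        then show ?thesis by (simp add: p_def)
      next
        case False
        then have pos: "(real k)\<^sup>2 * p x > 0" using n k by (simp add: p_def)
        have e: "real n * (p x * ln ((real k)\<^sup>2 * p x)) = real (cnt x) * ln ((real k)\<^sup>2 * p x)"
          using n by (simp add: p_def)
        show ?thesis unfolding e exp_of_nat_mult using pos by simp
      qed
    qed
    also have "\<dots> = (\<Prod>x\<in>?C. \<Prod>v\<in>{v \<in> {1..n}. f v = x}. (real k)\<^sup>2 * p (f v))"
      by (rule prod.cong) (auto simp: cnt_def)
    also have "\<dots> = (\<Prod>v\<in>{1..n}. (real k)\<^sup>2 * p (f v))"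
      by (rule prod.group[OF _ _ funcset_image[OF f]]) auto
    also have "\<dots> = real k ^ (2 * n) * (\<Prod>v\<in>{1..n}. p (f v))"
      by (simp add: prod.distrib power_mult)
    finally show ?thesis .
  qed
  \<comment> \<open>Factoring out \<open>(1 - \<kappa>)^2\<close>, the value for independent
    colourings, leaves \<open>1 + z \<le> exp z\<close>.\<close>
  have base: "1 - 2 * \<kappa> + s \<le> (1 - \<kappa>)\<^sup>2 * exp ((s - \<kappa>\<^sup>2) / (1 - \<kappa>)\<^sup>2)"
  proof -
    have "1 - 2 * \<kappa> + s = (1 - \<kappa>)\<^sup>2 * (1 + (s - \<kappa>\<^sup>2) / (1 - \<kappa>)\<^sup>2)"
    proof -
      have "(1 - \<kappa>)\<^sup>2 * (1 + (s - \<kappa>\<^sup>2) / (1 - \<kappa>)\<^sup>2) = (1 - \<kappa>)\<^sup>2 + (s - \<kappa>\<^sup>2)"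
        using \<kappa>1 by (simp add: distrib_left)
      then show ?thesis by (simp add: power2_eq_square algebra_simps)
    qed
    also have "\<dots> \<le> (1 - \<kappa>)\<^sup>2 * exp ((s - \<kappa>\<^sup>2) / (1 - \<kappa>)\<^sup>2)"
      by (rule mult_left_mono[OF exp_ge_add_one_self]) simp
    finally show ?thesis .
  qed
  have "(\<Sum>b\<in>?B. \<Prod>i<r. p (b i)) ^ m \<le> ((1 - \<kappa>)\<^sup>2 * exp ((s - \<kappa>\<^sup>2) / (1 - \<kappa>)\<^sup>2)) ^ m"
    using blk base by (intro power_mono) (auto intro!: sum_nonneg prod_nonneg p0)
  also have "\<dots> = (1 - \<kappa>) ^ (2 * m) * exp (real m * ((s - \<kappa>\<^sup>2) / (1 - \<kappa>)\<^sup>2))"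
    by (simp only: power_mult_distrib power_mult exp_of_nat_mult)
  also have "\<dots> \<le> (1 - \<kappa>) ^ (2 * m) * exp (real n * Z)"
    using mA \<kappa>1 by (intro mult_left_mono) auto
  finally have 2: "(\<Sum>b\<in>?B. \<Prod>i<r. p (b i)) ^ m \<le> (1 - \<kappa>) ^ (2 * m) * (real k ^ (2 * n) * (\<Prod>v\<in>{1..n}. p (f v)))"
    unfolding expZ .
  have "(exp 1 * (real (m * r) + 1)) ^ k\<^sup>2 * (\<Sum>b\<in>?B. \<Prod>i<r. p (b i)) ^ m \<le>
    (exp 1 * (real (m * r) + 1)) ^ k\<^sup>2 * ((1 - \<kappa>) ^ (2 * m) * (real k ^ (2 * n) * (\<Prod>v\<in>{1..n}. p (f v))))"
    using 2 by (rule mult_left_mono) simp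
  with 1 show ?thesis unfolding p_def cnt_def f_def by linarith
qed

end

context config
begin

text \<open>With \<open>T = k ^ n * (1 - \<kappa>) ^ m\<close>, the first moment over colourings of
  type \<open>a\<close> is at least \<open>T\<close> and the second at most \<open>T^2\<close>, both
  up to polynomial factors. The conclusion is multiplied out, with the prefactors left
  explicit.\<close>

lemma perm_prob_colorable_ge:
  fixes Y \<kappa> :: real
  assumes n: "n > 0" and k: "k \<ge> 2 * r" and md: "m \<ge> d" and \<kappa>: "\<kappa> = 1 / real k ^ (r - 1)"
    and F: "\<And>y. 0 \<le> y \<Longrightarrow> y \<le> Y \<Longrightarrow> real d / (real r * (1 - \<kappa>)\<^sup>2) * \<kappa>\<^sup>2 * (y ^ r - 1 - real r * (y - 1)) \<le> y * ln y - y + 1"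
    and \<beta>: "\<beta> = card (nonmono r k)"
    and Y: "real k + (real k)\<^sup>2 * real (r * (\<beta> + 1)) / real n \<le> Y"
  shows "1 \<le> (exp (real k * real (r * (\<beta> + 1))) * real \<beta> ^ (d * (\<beta> + 1)))\<^sup>2 * (exp 1 * (real (n * d) + 1)) ^ (2 * k + 2 * \<beta> + 2 * k\<^sup>2)
    * perm_prob S (\<lambda>\<pi>. \<exists>\<sigma>\<in>{1..n} \<rightarrow>\<^sub>E {..<k}. proper_word \<sigma> \<pi>)"
proof -
  define c0 where "c0 = real (r * (\<beta> + 1))"
  define P where "P = exp 1 * (real (n * d) + 1)"
  have k2: "k \<ge> 2" "real k > 0" using k r2 by auto
  have \<kappa>1: "0 < \<kappa>" "\<kappa> < 1" unfolding \<kappa> using k2 r2 by (auto intro!: one_less_power)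
  obtain a where a: "\<forall>c<k. k * a c \<le> n + k * (r * (\<beta> + 1))" "sum a {..<k} = n"
    and many: "real \<beta> ^ m \<le> real \<beta> ^ (d * (\<beta> + 1)) * (exp 1 * (real m + 1)) ^ \<beta> *
      real (card {f \<in> words S {..<k} (\<lambda>c. d * a c). \<forall>e<m. (\<lambda>i\<in>{..<r}. f (e, i)) \<in> nonmono r k})"
    using many_nonmono_words[OF k md] unfolding \<beta> by blast
  define M where "M = {f \<in> words S {..<k} (\<lambda>c. d * a c). \<forall>e<m. (\<lambda>i\<in>{..<r}. f (e, i)) \<in> nonmono r k}"
  define \<Sigma> where "\<Sigma> = words {1..n} {..<k} a"
  have fin\<Sigma>: "finite \<Sigma>" unfolding \<Sigma>_def by (rule words_finite) auto
  have P1: "exp 1 * (real n + 1) \<le> P" "real n + 1 \<le> P" "exp 1 * (real m + 1) \<le> P" "exp 1 * (real (m * r) + 1) = P"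
  proof -
    have "n \<le> n * d" using d1 by simp
    then have nd: "real n \<le> real (n * d)" by (rule of_nat_mono)
    have "m \<le> m * r" using r2 by simp
    then have md': "real m \<le> real (n * d)" unfolding mr by (rule of_nat_mono)
    show "exp 1 * (real n + 1) \<le> P" unfolding P_def using nd by (intro mult_left_mono) auto
    show "exp 1 * (real m + 1) \<le> P" unfolding P_def using md' by (intro mult_left_mono) auto
    show "exp 1 * (real (m * r) + 1) = P" unfolding P_def mr ..
    have "1 * (real n + 1) \<le> exp 1 * (real n + 1)" by (intro mult_right_mono) auto
    then have "real n + 1 \<le> exp 1 * (real n + 1)" by (simp only: mult_1_left)
    then show "real n + 1 \<le> P" using \<open>exp 1 * (real n + 1) \<le> P\<close> by (rule order.trans)
  qed
  have P0: "P \<ge> 1" using P1(2) by simp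
  have a_le: "real (a c) / real n \<le> (1 + real k * c0 / real n) / real k" if "c < k" for c
  proof -
    have "real (k * a c) \<le> real (n + k * (r * (\<beta> + 1)))" using a(1) that by (intro of_nat_mono) auto
    then have "real k * real (a c) \<le> real n + real k * c0" by (simp add: c0_def)
    then show ?thesis using n k2 by (simp add: field_simps)
  qed

  \<comment> \<open>Near balance costs only a constant: the frequencies exceed \<open>1 / k\<close>
    by a factor of at most \<open>1 + k * c0 / n\<close>, whose \<open>n\<close>-th power is at most
    \<open>exp (k * c0)\<close>.\<close>
  have card\<Sigma>: "real k ^ n \<le> P ^ k * exp (real k * c0) * real (card \<Sigma>)"
  proof -
    define \<eta> where "\<eta> = (1 + real k * c0 / real n) / real k"
    have \<eta>0: "\<eta> \<ge> 0" unfolding \<eta>_def c0_def by simp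
    have "(\<Prod>c<k. (real (a c) / real n) ^ a c) \<le> (\<Prod>c<k. \<eta> ^ a c)"
      using a_le unfolding \<eta>_def by (intro prod_mono) (auto intro!: power_mono)
    also have "\<dots> = \<eta> ^ n" using a(2) by (simp add: power_sum[symmetric])
    also have "\<dots> = (1 + real k * c0 / real n) ^ n / real k ^ n" unfolding \<eta>_def by (rule power_divide)
    also have "\<dots> \<le> exp (real k * c0) / real k ^ n"
    proof (rule divide_right_mono)
      have "(1 + real k * c0 / real n) ^ n \<le> exp (real k * c0 / real n) ^ n"
        by (intro power_mono exp_ge_add_one_self) (simp add: c0_def)
      also have "\<dots> = exp (real k * c0)" using n by (simp flip: exp_of_nat_mult)
      finally show "(1 + real k * c0 / real n) ^ n \<le> exp (real k * c0)" .
    qed simp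
    finally have prod: "(\<Prod>c<k. (real (a c) / real n) ^ a c) \<le> exp (real k * c0) / real k ^ n" .
    have "1 \<le> (exp 1 * (real n + 1)) ^ k * (real (card \<Sigma>) * (\<Prod>c<k. (real (a c) / real n) ^ a c))"
      using card_words_lower[of "{1..n}" "{..<k}" a] a(2) unfolding \<Sigma>_def by simp
    also have "\<dots> \<le> P ^ k * (real (card \<Sigma>) * (exp (real k * c0) / real k ^ n))"
      using prod P1(1) P0 by (intro mult_mono power_mono mult_left_mono) (auto intro!: prod_nonneg mult_nonneg_nonneg)
    finally have "1 \<le> (P ^ k * exp (real k * c0) * real (card \<Sigma>)) / real k ^ n" by (simp add: algebra_simps)
    then show ?thesis using k2 by (simp add: le_divide_eq)
  qed
  have \<beta>eq: "real \<beta> = real k ^ r * (1 - \<kappa>)"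
  proof -
    have "k ^ 1 \<le> k ^ r" using k2 r2 by (intro power_increasing) auto
    then have "real \<beta> = real k ^ r - real k" unfolding \<beta> using card_nonmono[of r k] r2 by (simp add: of_nat_diff)
    moreover have "real k = real k ^ r * \<kappa>" unfolding \<kappa> using k2 r2 by (cases r) auto
    moreover have "real k ^ r * (1 - \<kappa>) = real k ^ r - real k ^ r * \<kappa>" by (simp add: algebra_simps)
    ultimately show ?thesis by linarith
  qed
  define D1 where "D1 = real \<beta> ^ (d * (\<beta> + 1))"
  have D1: "D1 \<ge> 0" by (simp add: D1_def)
  \<comment> \<open>Bounding the number of words of the given type by \<open>k ^ (m * r)\<close>
    gives one lower bound for all \<sigma> in \<Sigma>; since
    \<open>\<beta> = k ^ r * (1 - \<kappa>)\<close>, it compares directly with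
    \<open>(1 - \<kappa>) ^ m\<close>.\<close>
  define \<rho> where "\<rho> = real (card M) / real k ^ (m * r)"
  have \<rho>0: "\<rho> \<ge> 0" by (simp add: \<rho>_def)
  have rho: "(1 - \<kappa>) ^ m \<le> D1 * P ^ \<beta> * \<rho>"
  proof -
    have "real k ^ (m * r) * (1 - \<kappa>) ^ m = real \<beta> ^ m"
      by (simp add: \<beta>eq power_mult_distrib power_mult[symmetric] mult.commute)
    also have "\<dots> \<le> D1 * (exp 1 * (real m + 1)) ^ \<beta> * real (card M)" using many unfolding D1_def M_def .
    also have "\<dots> \<le> D1 * P ^ \<beta> * real (card M)"
      using P1(3) D1 by (intro mult_right_mono mult_left_mono power_mono) auto
    finally show ?thesis unfolding \<rho>_def using k2 by (simp add: field_simps)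
  qed
  have proper_ge: "\<rho> \<le> perm_prob S (proper_word \<sigma>)" if \<sigma>: "\<sigma> \<in> \<Sigma>" for \<sigma>
  proof -
    have \<sigma>E: "\<sigma> \<in> {1..n} \<rightarrow> {..<k}" using \<sigma> unfolding \<Sigma>_def words_def by blast
    have g: "\<sigma> \<circ> vt \<in> S \<rightarrow> {..<k}"
      by (intro Pi_I, unfold comp_def, rule funcset_mem[OF \<sigma>E funcset_mem[OF vt_in]])
    have t: "card {x \<in> S. (\<sigma> \<circ> vt) x = c} = d * a c" if "c \<in> {..<k}" for c
      using card_points[OF \<sigma>E, of c] \<sigma> that unfolding \<Sigma>_def words_def by simp
    have MW: "M \<subseteq> words S {..<k} (\<lambda>c. d * a c)" unfolding M_def by blast
    have "card (words S {..<k} (\<lambda>c. d * a c)) \<le> card (S \<rightarrow>\<^sub>E {..<k})"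
      by (intro card_mono finite_PiE) (auto simp: words_def)
    also have "\<dots> = k ^ (m * r)" by (simp add: card_funcsetE card_cartesian_product)
    finally have W: "card (words S {..<k} (\<lambda>c. d * a c)) \<le> k ^ (m * r)" .
    have Wpos: "card (words S {..<k} (\<lambda>c. d * a c)) > 0"
      by (rule perm_prob_word(2)[OF finS finite_lessThan g t MW])
    have "real (card (words S {..<k} (\<lambda>c. d * a c))) \<le> real (k ^ (m * r))" using W by (rule of_nat_mono)
    then have "\<rho> \<le> real (card M) / real (card (words S {..<k} (\<lambda>c. d * a c)))"
      unfolding \<rho>_def using Wpos k2 by (intro divide_left_mono) auto
    also have "\<dots> = perm_prob S (\<lambda>\<pi>. restrict ((\<sigma> \<circ> vt) \<circ> \<pi>) S \<in> M)"
      by (rule perm_prob_word(1)[OF finS finite_lessThan g t MW, symmetric])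
    also have "\<dots> \<le> perm_prob S (proper_word \<sigma>)"
    proof (rule perm_prob_mono[OF finS])
      fix \<pi> assume "restrict ((\<sigma> \<circ> vt) \<circ> \<pi>) S \<in> M"
      then have nm: "(\<lambda>i\<in>{..<r}. restrict ((\<sigma> \<circ> vt) \<circ> \<pi>) S (e, i)) \<in> nonmono r k" if "e < m" for e
        using that unfolding M_def by blast
      show "proper_word \<sigma> \<pi>" unfolding proper_word_def
      proof (intro allI impI notI)
        fix e assume e: "e < m" and "\<exists>c. \<forall>i<r. \<sigma> (vt (\<pi> (e, i))) = c"
        then obtain c where "\<forall>i<r. \<sigma> (vt (\<pi> (e, i))) = c" by blast
        then have "\<forall>i<r. (\<lambda>i\<in>{..<r}. restrict ((\<sigma> \<circ> vt) \<circ> \<pi>) S (e, i)) i = c" using e by simp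
        then show False using nm[OF e] unfolding nonmono_def by blast
      qed
    qed
    finally show ?thesis .
  qed
  define L where "L = real (card \<Sigma>) * \<rho>"
  have L0: "L \<ge> 0" unfolding L_def using \<rho>0 by simp
  have L_le: "L \<le> (\<Sum>\<sigma>\<in>\<Sigma>. perm_prob S (proper_word \<sigma>))"
    unfolding L_def using sum_mono[of \<Sigma> "\<lambda>_. \<rho>", OF proper_ge] by simp
  define D where "D = exp (real k * c0) * D1"
  have key: "real k ^ n * (1 - \<kappa>) ^ m \<le> D * P ^ (k + \<beta>) * L"
  proof -
    have "real k ^ n * (1 - \<kappa>) ^ m \<le> (P ^ k * exp (real k * c0) * real (card \<Sigma>)) * (D1 * P ^ \<beta> * \<rho>)"
      using card\<Sigma> rho \<kappa>1 P0 by (intro mult_mono) auto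
    then show ?thesis by (simp add: D_def L_def power_add algebra_simps)
  qed
  have T: "0 < real k ^ n * (1 - \<kappa>) ^ m" using k2 \<kappa>1 by simp
  define T where "T = real k ^ n * (1 - \<kappa>) ^ m"
  have T0: "T > 0" using T by (simp add: T_def)
  define pr where "pr = perm_prob S (\<lambda>\<pi>. \<exists>\<sigma>\<in>\<Sigma>. proper_word \<sigma> \<pi>)"
  have both: "(\<Sum>\<sigma>\<in>\<Sigma>. \<Sum>\<tau>\<in>\<Sigma>. perm_prob S (\<lambda>\<pi>. proper_word \<sigma> \<pi> \<and> proper_word \<tau> \<pi>)) \<le> P ^ k\<^sup>2 * (T\<^sup>2 * P ^ k\<^sup>2)"
  proof -
    let ?C = "{..<k} \<times> {..<k}"
    define h where "h f = (\<Prod>v\<in>{1..n}. real (card {u \<in> {1..n}. f u = f v}) / real (card {1..n}))" for f :: "nat \<Rightarrow> nat \<times> nat"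
    have pair: "perm_prob S (\<lambda>\<pi>. proper_word \<sigma> \<pi> \<and> proper_word \<tau> \<pi>) \<le> P ^ k\<^sup>2 * (T\<^sup>2 * h (\<lambda>v\<in>{1..n}. (\<sigma> v, \<tau> v)))"
      if \<sigma>\<tau>: "\<sigma> \<in> \<Sigma>" "\<tau> \<in> \<Sigma>" for \<sigma> \<tau>
    proof -
      have E: "\<sigma> \<in> {1..n} \<rightarrow>\<^sub>E {..<k}" "\<tau> \<in> {1..n} \<rightarrow>\<^sub>E {..<k}" using \<sigma>\<tau> unfolding \<Sigma>_def words_def by blast+
      have bal: "(real k)\<^sup>2 * (real (card {v \<in> {1..n}. \<sigma> v = c}) / real n) \<le> Y" if c: "c < k" for c
      proof -
        have "card {v \<in> {1..n}. \<sigma> v = c} = a c" using \<sigma>\<tau>(1) c unfolding \<Sigma>_def words_def by blast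
        then have "(real k)\<^sup>2 * (real (card {v \<in> {1..n}. \<sigma> v = c}) / real n) \<le> (real k)\<^sup>2 * ((1 + real k * c0 / real n) / real k)"
          using a_le[OF c] by (intro mult_left_mono) auto
        also have "\<dots> = real k + (real k)\<^sup>2 * c0 / real n" using k2 n by (simp add: field_simps power2_eq_square)
        also have "\<dots> \<le> Y" using Y unfolding c0_def .
        finally show ?thesis .
      qed
      have "perm_prob S (\<lambda>\<pi>. proper_word \<sigma> \<pi> \<and> proper_word \<tau> \<pi>) \<le>
        (exp 1 * (real (m * r) + 1)) ^ k\<^sup>2 * ((1 - \<kappa>) ^ (2 * m) * (real k ^ (2 * n) *
        (\<Prod>v\<in>{1..n}. real (card {u \<in> {1..n}. (\<sigma> u, \<tau> u) = (\<sigma> v, \<tau> v)}) / real n)))"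
        by (rule perm_prob_both_proper_le[OF n k2(1) \<kappa> E bal F])
      also have "(\<Prod>v\<in>{1..n}. real (card {u \<in> {1..n}. (\<sigma> u, \<tau> u) = (\<sigma> v, \<tau> v)}) / real n) = h (\<lambda>v\<in>{1..n}. (\<sigma> v, \<tau> v))"
        unfolding h_def
      proof (rule prod.cong[OF refl])
        fix v assume v: "v \<in> {1..n}"
        have "{u \<in> {1..n}. (\<lambda>v\<in>{1..n}. (\<sigma> v, \<tau> v)) u = (\<lambda>v\<in>{1..n}. (\<sigma> v, \<tau> v)) v} = {u \<in> {1..n}. (\<sigma> u, \<tau> u) = (\<sigma> v, \<tau> v)}"
          using v by auto
        then show "real (card {u \<in> {1..n}. (\<sigma> u, \<tau> u) = (\<sigma> v, \<tau> v)}) / real n = real (card {u \<in> {1..n}. (\<lambda>v\<in>{1..n}. (\<sigma> v, \<tau> v)) u = (\<lambda>v\<in>{1..n}. (\<sigma> v, \<tau> v)) v}) / real (card {1..n})"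
          by simp
      qed
      also have "(1 - \<kappa>) ^ (2 * m) * (real k ^ (2 * n) * h (\<lambda>v\<in>{1..n}. (\<sigma> v, \<tau> v))) = T\<^sup>2 * h (\<lambda>v\<in>{1..n}. (\<sigma> v, \<tau> v))"
        by (simp add: T_def power_mult_distrib power_mult[symmetric] mult.commute mult.left_commute)
      finally show ?thesis unfolding P1(4) .
    qed
    \<comment> \<open>A pair of colourings is one word over the alphabet of colour pairs, so
      \<open>sum_types_le\<close> applies with \<open>k^2\<close> letters.\<close>
    have "(\<Sum>\<sigma>\<in>\<Sigma>. \<Sum>\<tau>\<in>\<Sigma>. h (\<lambda>v\<in>{1..n}. (\<sigma> v, \<tau> v))) = (\<Sum>z\<in>\<Sigma> \<times> \<Sigma>. h (\<lambda>v\<in>{1..n}. (fst z v, snd z v)))"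
      by (simp add: sum.cartesian_product case_prod_beta)
    also have "\<dots> = sum h ((\<lambda>z. \<lambda>v\<in>{1..n}. (fst z v, snd z v)) ` (\<Sigma> \<times> \<Sigma>))"
    proof (rule sum.reindex[symmetric, unfolded o_def])
      show "inj_on (\<lambda>z. \<lambda>v\<in>{1..n}. (fst z v, snd z v)) (\<Sigma> \<times> \<Sigma>)"
      proof (rule inj_onI)
        fix z z' assume z: "z \<in> \<Sigma> \<times> \<Sigma>" "z' \<in> \<Sigma> \<times> \<Sigma>" and eq: "(\<lambda>v\<in>{1..n}. (fst z v, snd z v)) = (\<lambda>v\<in>{1..n}. (fst z' v, snd z' v))"
        have v: "fst z v = fst z' v \<and> snd z v = snd z' v" if "v \<in> {1..n}" for v
          using fun_cong[OF eq, of v] that by simp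
        have E: "fst z \<in> {1..n} \<rightarrow>\<^sub>E {..<k}" "snd z \<in> {1..n} \<rightarrow>\<^sub>E {..<k}" "fst z' \<in> {1..n} \<rightarrow>\<^sub>E {..<k}" "snd z' \<in> {1..n} \<rightarrow>\<^sub>E {..<k}"
          using z unfolding \<Sigma>_def words_def by (auto simp only: mem_Times_iff mem_Collect_eq)
        have "fst z = fst z'" by (rule PiE_ext[OF E(1) E(3)]) (use v in blast)
        moreover have "snd z = snd z'" by (rule PiE_ext[OF E(2) E(4)]) (use v in blast)
        ultimately show "z = z'" by (simp add: prod_eq_iff)
      qed
    qed
    also have "\<dots> \<le> sum h ({1..n} \<rightarrow>\<^sub>E ?C)"
    proof (rule sum_mono2)
      show "finite ({1..n} \<rightarrow>\<^sub>E ?C)" by (intro finite_PiE) auto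
      show "(\<lambda>z. \<lambda>v\<in>{1..n}. (fst z v, snd z v)) ` (\<Sigma> \<times> \<Sigma>) \<subseteq> {1..n} \<rightarrow>\<^sub>E ?C"
      proof (rule image_subsetI)
        fix z assume z: "z \<in> \<Sigma> \<times> \<Sigma>"
        have E: "fst z \<in> {1..n} \<rightarrow>\<^sub>E {..<k}" "snd z \<in> {1..n} \<rightarrow>\<^sub>E {..<k}"
          using z unfolding \<Sigma>_def words_def by (auto simp only: mem_Times_iff mem_Collect_eq)
        show "(\<lambda>v\<in>{1..n}. (fst z v, snd z v)) \<in> {1..n} \<rightarrow>\<^sub>E ?C"
          by (intro restrict_PiE_iff[THEN iffD2] ballI SigmaI PiE_mem[OF E(1)] PiE_mem[OF E(2)])
      qed
    qed (auto simp: h_def intro!: prod_nonneg)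
    also have "\<dots> \<le> (real (card {1..n}) + 1) ^ card ?C" unfolding h_def by (rule sum_types_le) auto
    also have "\<dots> = (real n + 1) ^ k\<^sup>2" by (simp add: card_cartesian_product power2_eq_square)
    also have "\<dots> \<le> P ^ k\<^sup>2" using P1(2) by (intro power_mono) auto
    finally have hsum: "(\<Sum>\<sigma>\<in>\<Sigma>. \<Sum>\<tau>\<in>\<Sigma>. h (\<lambda>v\<in>{1..n}. (\<sigma> v, \<tau> v))) \<le> P ^ k\<^sup>2" .
    have "(\<Sum>\<sigma>\<in>\<Sigma>. \<Sum>\<tau>\<in>\<Sigma>. perm_prob S (\<lambda>\<pi>. proper_word \<sigma> \<pi> \<and> proper_word \<tau> \<pi>)) \<le> (\<Sum>\<sigma>\<in>\<Sigma>. \<Sum>\<tau>\<in>\<Sigma>. P ^ k\<^sup>2 * (T\<^sup>2 * h (\<lambda>v\<in>{1..n}. (\<sigma> v, \<tau> v))))"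
      by (intro sum_mono pair)
    also have "\<dots> = P ^ k\<^sup>2 * (T\<^sup>2 * (\<Sum>\<sigma>\<in>\<Sigma>. \<Sum>\<tau>\<in>\<Sigma>. h (\<lambda>v\<in>{1..n}. (\<sigma> v, \<tau> v))))" by (simp only: sum_distrib_left)
    also have "\<dots> \<le> P ^ k\<^sup>2 * (T\<^sup>2 * P ^ k\<^sup>2)" using hsum P0 by (intro mult_left_mono) auto
    finally show ?thesis .
  qed
  have "T\<^sup>2 \<le> (D * P ^ (k + \<beta>) * L)\<^sup>2" using key T0 unfolding T_def by (intro power_mono) auto
  also have "\<dots> = D\<^sup>2 * P ^ (2 * (k + \<beta>)) * L\<^sup>2" by (simp add: power_mult_distrib power_mult[symmetric] mult.commute)
  also have "\<dots> \<le> D\<^sup>2 * P ^ (2 * (k + \<beta>)) * (pr * (P ^ k\<^sup>2 * (T\<^sup>2 * P ^ k\<^sup>2)))"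
  proof (rule mult_left_mono)
    have "L\<^sup>2 \<le> (\<Sum>\<sigma>\<in>\<Sigma>. perm_prob S (proper_word \<sigma>))\<^sup>2" using L_le L0 by (intro power_mono) auto
    also have "\<dots> \<le> pr * (\<Sum>\<sigma>\<in>\<Sigma>. \<Sum>\<tau>\<in>\<Sigma>. perm_prob S (\<lambda>\<pi>. proper_word \<sigma> \<pi> \<and> proper_word \<tau> \<pi>))"
      unfolding pr_def by (rule perm_prob_second_moment[OF finS fin\<Sigma>])
    also have "\<dots> \<le> pr * (P ^ k\<^sup>2 * (T\<^sup>2 * P ^ k\<^sup>2))"
      using both by (rule mult_left_mono) (simp add: pr_def perm_prob_nonneg)
    finally show "L\<^sup>2 \<le> pr * (P ^ k\<^sup>2 * (T\<^sup>2 * P ^ k\<^sup>2))" .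
  qed (use P0 in simp)
  also have "\<dots> = T\<^sup>2 * (D\<^sup>2 * P ^ (2 * k + 2 * \<beta> + 2 * k\<^sup>2) * pr)"
  proof -
    have "P ^ (2 * k + 2 * \<beta> + 2 * k\<^sup>2) = P ^ (2 * (k + \<beta>)) * (P ^ k\<^sup>2 * P ^ k\<^sup>2)"
      by (simp only: power_add[symmetric] distrib_left mult_2)
    then show ?thesis by (simp only: mult.assoc mult.left_commute mult.commute)
  qed
  finally have "T\<^sup>2 * 1 \<le> T\<^sup>2 * (D\<^sup>2 * P ^ (2 * k + 2 * \<beta> + 2 * k\<^sup>2) * pr)" by simp
  \<comment> \<open>\<open>T\<close> cancels, so its size is never computed; the comparison of
    \<open>k\<close> with \<open>d\<close> enters only through \<open>F\<close>.\<close>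
  then have "1 \<le> D\<^sup>2 * P ^ (2 * k + 2 * \<beta> + 2 * k\<^sup>2) * pr" using T0 by (subst (asm) mult_le_cancel_left_pos) auto
  also have "\<dots> \<le> D\<^sup>2 * P ^ (2 * k + 2 * \<beta> + 2 * k\<^sup>2) * perm_prob S (\<lambda>\<pi>. \<exists>\<sigma>\<in>{1..n} \<rightarrow>\<^sub>E {..<k}. proper_word \<sigma> \<pi>)"
  proof (rule mult_left_mono)
    show "pr \<le> perm_prob S (\<lambda>\<pi>. \<exists>\<sigma>\<in>{1..n} \<rightarrow>\<^sub>E {..<k}. proper_word \<sigma> \<pi>)"
      unfolding pr_def
    proof (rule perm_prob_mono[OF finS])
      fix \<pi> assume "\<exists>\<sigma>\<in>\<Sigma>. proper_word \<sigma> \<pi>"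
      then show "\<exists>\<sigma>\<in>{1..n} \<rightarrow>\<^sub>E {..<k}. proper_word \<sigma> \<pi>" unfolding \<Sigma>_def words_def by blast
    qed
  qed (use P0 in simp)
  finally show ?thesis unfolding D_def D1_def P_def c0_def .
qed

end

section \<open>Almost proper colourings\<close>

text \<open>Colour classes are independent sets. The existence of some proper colouring ensures that
  the \<open>LEAST\<close> in the definition is attained.\<close>

lemma card_le_chromatic_times_independence:
  assumes V: "finite V" and col: "\<exists>k f. proper_coloring V H k f"
  shows "card V \<le> chromatic_number V H * independence_number V H"
proof -
  obtain f where f: "proper_coloring V H (chromatic_number V H) f"
    using col LeastI_ex[of "\<lambda>k. \<exists>f. proper_coloring V H k f"] unfolding chromatic_number_def by blast
  let ?\<chi> = "chromatic_number V H"
  have fin: "finite {card S | S. independent_set V H S}"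
    by (rule finite_subset[of _ "{..card V}"]) (use V in \<open>auto simp: independent_set_def intro: card_mono\<close>)
  have "card {v \<in> V. f v = c} \<le> independence_number V H" if "c < ?\<chi>" for c
  proof -
    have "independent_set V H {v \<in> V. f v = c}"
      unfolding independent_set_def
    proof (intro conjI ballI notI)
      fix e assume "e \<in> H" "e \<subseteq> {v \<in> V. f v = c}"
      then have "e \<in> H" "\<forall>v\<in>e. f v = c" by blast+
      then show False using f unfolding proper_coloring_def by blast
    qed blast
    then show ?thesis unfolding independence_number_def using fin by (intro Max_ge) auto
  qed
  then have "(\<Sum>c<?\<chi>. card {v \<in> V. f v = c}) \<le> (\<Sum>c<?\<chi>. independence_number V H)" by (intro sum_mono) auto
  moreover have "card V = (\<Sum>c<?\<chi>. card {v \<in> V. f v = c})"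
  proof -
    have "(\<Sum>c<?\<chi>. card {v \<in> V. f v = c}) = (\<Sum>c<?\<chi>. \<Sum>v\<in>{v \<in> V. f v = c}. 1)" by simp
    also have "\<dots> = (\<Sum>v\<in>V. 1)" by (rule sum.group) (use V f in \<open>auto simp: proper_coloring_def\<close>)
    finally show ?thesis by simp
  qed
  ultimately show ?thesis by simp
qed

text \<open>Subsets of independent sets are independent, so excluding size \<open>s\<close> excludes
  all larger sizes. Nonempty edges make the empty set independent, hence \<open>Max\<close> is taken
  over a nonempty set.\<close>

lemma independence_number_less:
  assumes V: "finite V" and ne: "\<And>e. e \<in> H \<Longrightarrow> e \<noteq> {}"
    and none: "\<And>X. X \<subseteq> V \<Longrightarrow> card X = s \<Longrightarrow> \<exists>e\<in>H. e \<subseteq> X"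
  shows "independence_number V H < s"
proof (rule ccontr)
  assume "\<not> ?thesis"
  then have ge: "s \<le> independence_number V H" by simp
  have fin: "finite {card S | S. independent_set V H S}"
    by (rule finite_subset[of _ "{..card V}"]) (use V in \<open>auto simp: independent_set_def intro: card_mono\<close>)
  have "independent_set V H {}" using ne by (auto simp: independent_set_def)
  then have "{card S | S. independent_set V H S} \<noteq> {}" by blast
  from Max_in[OF fin this] obtain X where X: "independent_set V H X" "independence_number V H = card X"
    unfolding independence_number_def by blast
  then obtain X' where "X' \<subseteq> X" "card X' = s" using ge obtain_subset_with_card_n[of s X] by auto
  moreover have "X' \<subseteq> V" using X \<open>X' \<subseteq> X\<close> by (auto simp: independent_set_def)
  ultimately obtain e where "e \<in> H" "e \<subseteq> X'" using none by blast
  then have "e \<in> H" "e \<subseteq> X" using \<open>X' \<subseteq> X\<close> by blast+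
  then show False using X(1) unfolding independent_set_def by blast
qed

section \<open>Monochromatic blocks: concentration and repair\<close>

context config
begin

definition mono_blocks :: "(nat \<Rightarrow> nat) \<Rightarrow> (nat \<times> nat \<Rightarrow> nat \<times> nat) \<Rightarrow> nat set" where
  "mono_blocks \<sigma> \<pi> = {e. e < m \<and> (\<exists>c. \<forall>i<r. \<sigma> (vt (\<pi> (e, i))) = c)}"

definition min_mono :: "nat \<Rightarrow> (nat \<times> nat \<Rightarrow> nat \<times> nat) \<Rightarrow> nat" where
  "min_mono k \<pi> = Min ((\<lambda>\<sigma>. card (mono_blocks \<sigma> \<pi>)) ` ({1..n} \<rightarrow>\<^sub>E {..<k}))"

lemma finite_mono_blocks: "finite (mono_blocks \<sigma> \<pi>)"
  by (rule finite_subset[of _ "{..<m}"]) (auto simp: mono_blocks_def)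

lemma finite_colorings: "finite ({1..n} \<rightarrow>\<^sub>E {..<k::nat})"
  by (intro finite_PiE) auto

lemma colorings_nonempty: "0 < (k::nat) \<Longrightarrow> ({1..n} \<rightarrow>\<^sub>E {..<k}) \<noteq> {}"
  by (simp add: PiE_eq_empty_iff lessThan_empty_iff)

lemma min_mono_le: "\<sigma> \<in> {1..n} \<rightarrow>\<^sub>E {..<k} \<Longrightarrow> min_mono k \<pi> \<le> card (mono_blocks \<sigma> \<pi>)"
  unfolding min_mono_def using finite_colorings by (intro Min_le) auto

lemma min_mono_attained:
  assumes "k > 0"
  shows "\<exists>\<sigma>\<in>{1..n} \<rightarrow>\<^sub>E {..<k}. min_mono k \<pi> = card (mono_blocks \<sigma> \<pi>)"
proof -
  have "min_mono k \<pi> \<in> (\<lambda>\<sigma>. card (mono_blocks \<sigma> \<pi>)) ` ({1..n} \<rightarrow>\<^sub>E {..<k})"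
    unfolding min_mono_def using finite_colorings colorings_nonempty[OF assms] by (intro Min_in) auto
  then show ?thesis by blast
qed

text \<open>A transposition of two positions changes only the blocks that contain them, so an
  optimal colouring for \<pi> gets at most two new monochromatic blocks.\<close>

lemma min_mono_swap_le:
  assumes "k > 0"
  shows "min_mono k (\<pi> \<circ> transpose x y) \<le> min_mono k \<pi> + 2"
proof -
  obtain \<sigma> where \<sigma>: "\<sigma> \<in> {1..n} \<rightarrow>\<^sub>E {..<k}" "min_mono k \<pi> = card (mono_blocks \<sigma> \<pi>)"
    using min_mono_attained[OF assms] by blast
  have "mono_blocks \<sigma> (\<pi> \<circ> transpose x y) \<subseteq> mono_blocks \<sigma> \<pi> \<union> {fst x, fst y}"
  proof
    fix e assume e: "e \<in> mono_blocks \<sigma> (\<pi> \<circ> transpose x y)"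
    show "e \<in> mono_blocks \<sigma> \<pi> \<union> {fst x, fst y}"
    proof (cases "e = fst x \<or> e = fst y")
      case False
      then have "transpose x y (e, i) = (e, i)" for i by (auto simp: transpose_def)
      then show ?thesis using e by (simp add: mono_blocks_def)
    qed auto
  qed
  then have "card (mono_blocks \<sigma> (\<pi> \<circ> transpose x y)) \<le> card (mono_blocks \<sigma> \<pi> \<union> {fst x, fst y})"
    using finite_mono_blocks by (intro card_mono) auto
  also have "\<dots> \<le> card (mono_blocks \<sigma> \<pi>) + card {fst x, fst y}" by (rule card_Un_le)
  also have "card {fst x, fst y} \<le> 2" by (cases "fst x = fst y") auto
  finally show ?thesis using min_mono_le[OF \<sigma>(1), of "\<pi> \<circ> transpose x y"] \<sigma>(2) by linarith
qed

lemma perm_prob_min_mono_le: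
  assumes k: "k > 0" and \<gamma>: "0 \<le> \<gamma>" "\<gamma> \<le> 1"
    and Q: "1 \<le> Q * perm_prob S (\<lambda>\<pi>. \<exists>\<sigma>\<in>{1..n} \<rightarrow>\<^sub>E {..<k}. proper_word \<sigma> \<pi>)" and Q0: "Q \<ge> 0"
  shows "perm_prob S (\<lambda>\<pi>. real (min_mono k \<pi>) > \<gamma> * real (m * r)) \<le> Q * exp (- (\<gamma>\<^sup>2 * real (m * r) / 64))"
proof -
  let ?N = "real (m * r)"
  define pc where "pc = perm_prob S (\<lambda>\<pi>. \<exists>\<sigma>\<in>{1..n} \<rightarrow>\<^sub>E {..<k}. proper_word \<sigma> \<pi>)"
  define pf where "pf = perm_prob S (\<lambda>\<pi>. real (min_mono k \<pi>) > \<gamma> * ?N)"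
  have lip: "\<bar>real (min_mono k (\<pi> \<circ> transpose x y)) - real (min_mono k \<pi>)\<bar> \<le> 2" for \<pi> x y
  proof -
    have "min_mono k ((\<pi> \<circ> transpose x y) \<circ> transpose x y) \<le> min_mono k (\<pi> \<circ> transpose x y) + 2"
      by (rule min_mono_swap_le[OF k])
    then have "min_mono k \<pi> \<le> min_mono k (\<pi> \<circ> transpose x y) + 2" by (simp add: o_assoc[symmetric])
    moreover have "min_mono k (\<pi> \<circ> transpose x y) \<le> min_mono k \<pi> + 2" by (rule min_mono_swap_le[OF k])
    ultimately show ?thesis by linarith
  qed
  have zero: "real (min_mono k \<pi>) = 0" if ex: "\<exists>\<sigma>\<in>{1..n} \<rightarrow>\<^sub>E {..<k}. proper_word \<sigma> \<pi>" for \<pi>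
  proof -
    obtain \<sigma> where \<sigma>: "\<sigma> \<in> {1..n} \<rightarrow>\<^sub>E {..<k}" "proper_word \<sigma> \<pi>" using ex by blast
    then have "mono_blocks \<sigma> \<pi> = {}" unfolding mono_blocks_def proper_word_def by blast
    then show ?thesis using min_mono_le[OF \<sigma>(1), of \<pi>] by simp
  qed
  \<comment> \<open>With \<open>L = 2\<close> the choice \<open>l = \<gamma> / 32\<close> minimises
    the exponent \<open>(4 * l)^2 - l * \<gamma>\<close> per position, giving
    \<open>- \<gamma>^2 / 64\<close>.\<close>
  have "pf * pc \<le> exp ((2 * 2 * (\<gamma> / 32))\<^sup>2 * real (card S) - \<gamma> / 32 * (\<gamma> * ?N))"
    unfolding pf_def pc_def
    by (rule perm_concentration[OF finS _ _ _ lip zero]) (use \<gamma> in auto)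
  also have "(2 * 2 * (\<gamma> / 32))\<^sup>2 * real (card S) - \<gamma> / 32 * (\<gamma> * ?N) = - (\<gamma>\<^sup>2 * ?N / 64)"
    unfolding card_S by (simp add: power2_eq_square field_simps)
  finally have le: "pf * pc \<le> exp (- (\<gamma>\<^sup>2 * ?N / 64))" .
  have "pf * 1 \<le> pf * (Q * pc)" using Q unfolding pc_def pf_def by (intro mult_left_mono perm_prob_nonneg)
  also have "\<dots> = Q * (pf * pc)" by simp
  also have "\<dots> \<le> Q * exp (- (\<gamma>\<^sup>2 * ?N / 64))" using le Q0 by (rule mult_left_mono)
  finally show ?thesis by (simp add: pf_def)
qed

text \<open>Recolour \<open>U\<close> with colours from \<open>k\<close> upwards. An edge inside
  \<open>U\<close> is handled by \<open>degenerate_coloring\<close>, an edge only partly in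
  \<open>U\<close> sees an old and a new colour, and an edge disjoint from \<open>U\<close> is not
  monochromatic under \<sigma>, since otherwise its vertex in slot 0 would be in
  \<open>U\<close>.\<close>

lemma colorable_of_few_mono_blocks:
  assumes pi: "\<pi> permutes S" and s: "simple r m (vt \<circ> \<pi>)" and k: "k > 0"
    and few: "12 * d\<^sup>2 * min_mono k \<pi> \<le> n"
    and sparse: "\<And>U. U \<subseteq> {1..n} \<Longrightarrow> U \<noteq> {} \<Longrightarrow> 12 * d\<^sup>2 * card U \<le> n \<Longrightarrow>
       card {e. e < m \<and> edge r (vt \<circ> \<pi>) e \<subseteq> U} < 2 * card U"
  shows "\<exists>f. proper_coloring {1..n} (hgraph \<pi>) (k + 2 * r) f"
proof -
  let ?H = "hgraph \<pi>"
  have vtpi: "vt (\<pi> (e, i)) \<in> {1..n}" if "e < m" "i < r" for e i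
  proof -
    have "(e, i) \<in> S" using that by simp
    then have "\<pi> (e, i) \<in> S" by (simp only: permutes_in_image[OF pi])
    then show ?thesis by (rule funcset_mem[OF vt_in])
  qed
  obtain \<sigma> where \<sigma>: "\<sigma> \<in> {1..n} \<rightarrow>\<^sub>E {..<k}" "min_mono k \<pi> = card (mono_blocks \<sigma> \<pi>)"
    using min_mono_attained[OF k] by blast
  define U where "U = (\<lambda>e. vt (\<pi> (e, 0))) ` mono_blocks \<sigma> \<pi>"
  have r0: "0 < r" using r2 by simp
  have finU: "finite U" unfolding U_def using finite_mono_blocks by simp
  have U1: "U \<subseteq> {1..n}" unfolding U_def
  proof (rule image_subsetI)
    fix e assume "e \<in> mono_blocks \<sigma> \<pi>"
    then have "e < m" by (simp add: mono_blocks_def)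
    then show "vt (\<pi> (e, 0)) \<in> {1..n}" using r0 by (rule vtpi)
  qed
  have cU: "card U \<le> min_mono k \<pi>" unfolding U_def \<sigma>(2) by (rule card_image_le[OF finite_mono_blocks])
  have "\<exists>g. (\<forall>v\<in>U. g v < 2 * r) \<and> (\<forall>e\<in>?H. e \<subseteq> U \<longrightarrow> \<not> (\<exists>c::nat. \<forall>v\<in>e. g v = c))"
  proof (rule degenerate_coloring[OF finU r2])
    fix A assume "A \<in> ?H"
    then obtain e where e: "e < m" "A = edge r (vt \<circ> \<pi>) e" by auto
    then show "finite A \<and> card A = r"
      using s unfolding simple_def edge_def by (auto simp: card_image)
  next
    fix U' assume U': "U' \<subseteq> U" "U' \<noteq> {}"
    have "card U' \<le> card U" using U' finU by (intro card_mono)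
    then have "12 * d\<^sup>2 * card U' \<le> 12 * d\<^sup>2 * min_mono k \<pi>" using cU by (intro mult_left_mono) auto
    then have "12 * d\<^sup>2 * card U' \<le> n" using few by linarith
    then have "card {e. e < m \<and> edge r (vt \<circ> \<pi>) e \<subseteq> U'} < 2 * card U'"
      by (rule sparse[OF order.trans[OF U'(1) U1] U'(2)])
    moreover have eqA: "{A \<in> ?H. A \<subseteq> U'} = edge r (vt \<circ> \<pi>) ` {e. e < m \<and> edge r (vt \<circ> \<pi>) e \<subseteq> U'}" by blast
    have "card {A \<in> ?H. A \<subseteq> U'} \<le> card {e. e < m \<and> edge r (vt \<circ> \<pi>) e \<subseteq> U'}"
      unfolding eqA by (rule card_image_le) simp
    ultimately show "card {A \<in> ?H. A \<subseteq> U'} < 2 * card U'" by linarith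
  qed
  then obtain g where g: "\<forall>v\<in>U. g v < 2 * r" "\<forall>e\<in>?H. e \<subseteq> U \<longrightarrow> \<not> (\<exists>c::nat. \<forall>v\<in>e. g v = c)" by blast
  define f where "f v = (if v \<in> U then k + g v else \<sigma> v)" for v
  have "proper_coloring {1..n} ?H (k + 2 * r) f"
    unfolding proper_coloring_def
  proof (intro conjI ballI notI)
    fix v assume v: "v \<in> {1..n}"
    show "f v < k + 2 * r" using g(1) PiE_mem[OF \<sigma>(1) v] by (auto simp: f_def)
  next
    fix A assume A: "A \<in> ?H" and "\<exists>c. \<forall>v\<in>A. f v = c"
    then obtain c where c: "\<forall>v\<in>A. f v = c" by blast
    obtain e where e: "e < m" "A = edge r (vt \<circ> \<pi>) e" using A by auto
    have A1: "A \<subseteq> {1..n}" unfolding e(2) edge_def using vtpi[OF e(1)] by auto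
    show False
    proof (cases "A \<inter> U = {}")
      case True
      then have "\<forall>v\<in>A. \<sigma> v = c" using c unfolding f_def by (metis disjoint_iff)
      then have "\<forall>i<r. \<sigma> (vt (\<pi> (e, i))) = c" unfolding e(2) edge_def by simp
      then have "e \<in> mono_blocks \<sigma> \<pi>" using e(1) unfolding mono_blocks_def by blast
      then have "vt (\<pi> (e, 0)) \<in> U" unfolding U_def by blast
      moreover have "vt (\<pi> (e, 0)) \<in> A" unfolding e(2) edge_def using r0 by simp
      ultimately show False using True by blast
    next
      case False
      then obtain u where u: "u \<in> A" "u \<in> U" by blast
      then have ck: "c \<ge> k" using c by (auto simp: f_def)
      have "A \<subseteq> U"
      proof
        fix v assume v: "v \<in> A"
        show "v \<in> U"
        proof (rule ccontr)
          assume "v \<notin> U"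
          then have "\<sigma> v = c" using c v by (auto simp: f_def)
          moreover have "\<sigma> v < k" using PiE_mem[OF \<sigma>(1), of v] v A1 by auto
          ultimately show False using ck by simp
        qed
      qed
      moreover have "\<forall>v\<in>A. g v = c - k"
      proof
        fix v assume v: "v \<in> A"
        then have "f v = c" "v \<in> U" using c \<open>A \<subseteq> U\<close> by blast+
        then show "g v = c - k" by (auto simp: f_def)
      qed
      ultimately show False using g(2) A by blast
    qed
  qed
  then show ?thesis by blast
qed

text \<open>Union bound over all \<open>s\<close>-sets: there are at most
  \<open>exp (s * (1 + ln (1 / x)))\<close> of them, and
  \<open>m * x ^ r = s * (d / r) * x ^ (r - 1)\<close>. Of the 2 in \<open>dense\<close>, one unit
  pays for the 1 in the binomial bound and one becomes the gain \<open>exp (- s)\<close>.\<close>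

lemma perm_prob_large_indep_le:
  assumes n: "n > 0" and s: "0 < s" and x: "x = real s / real n"
    and dense: "2 + ln (1 / x) \<le> real d / real r * x ^ (r - 1)"
  shows "perm_prob S (\<lambda>\<pi>. \<exists>X\<subseteq>{1..n}. card X = s \<and> (\<forall>e<m. \<not> edge r (vt \<circ> \<pi>) e \<subseteq> X))
    \<le> (exp 1 * (real (n * d) + 1))\<^sup>2 * exp (- real s)"
proof (cases "s \<le> n")
  case False
  have none: "\<not> (\<exists>X\<subseteq>{1..n}. card X = s \<and> Q X)" for Q
  proof
    assume "\<exists>X\<subseteq>{1..n}. card X = s \<and> Q X"
    then obtain X where "X \<subseteq> {1..n}" "card X = s" by blast
    then show False using card_mono[of "{1..n}" X] False by simp
  qed
  have "perm_prob S (\<lambda>\<pi>. \<exists>X\<subseteq>{1..n}. card X = s \<and> (\<forall>e<m. \<not> edge r (vt \<circ> \<pi>) e \<subseteq> X)) = perm_prob S (\<lambda>_. False)"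
    by (rule perm_prob_cong) (simp only: none)
  also have "\<dots> = 0" by (simp add: perm_prob_def)
  finally show ?thesis by simp
next
  case True
  define P where "P = exp 1 * (real (n * d) + 1)"
  have x0: "0 < x" "x \<le> 1" using True s n by (auto simp: x)
  let ?XX = "{X. X \<subseteq> {1..n} \<and> card X = s}"
  have finX: "finite ?XX" by (rule finite_subset[of _ "Pow {1..n}"]) auto
  have cX: "card ?XX = n choose s" using n_subsets[of "{1..n}" s] by simp
  have "perm_prob S (\<lambda>\<pi>. \<exists>X\<subseteq>{1..n}. card X = s \<and> (\<forall>e<m. \<not> edge r (vt \<circ> \<pi>) e \<subseteq> X))
     \<le> perm_prob S (\<lambda>\<pi>. \<exists>X\<in>?XX. \<forall>e<m. \<not> edge r (vt \<circ> \<pi>) e \<subseteq> X)"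
    by (rule perm_prob_mono[OF finS]) blast
  also have "\<dots> \<le> (\<Sum>X\<in>?XX. perm_prob S (\<lambda>\<pi>. \<forall>e<m. \<not> edge r (vt \<circ> \<pi>) e \<subseteq> X))"
    by (rule perm_prob_Bex[OF finS finX])
  also have "\<dots> \<le> (\<Sum>X\<in>?XX. P\<^sup>2 * (1 - x ^ r) ^ m)"
  proof (rule sum_mono)
    fix X assume "X \<in> ?XX"
    then show "perm_prob S (\<lambda>\<pi>. \<forall>e<m. \<not> edge r (vt \<circ> \<pi>) e \<subseteq> X) \<le> P\<^sup>2 * (1 - x ^ r) ^ m"
      using perm_prob_indep_le[OF _ n, of X] unfolding mr P_def x by simp
  qed
  also have "\<dots> = P\<^sup>2 * (real (n choose s) * (1 - x ^ r) ^ m)" using cX by simp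
  also have "\<dots> \<le> P\<^sup>2 * exp (- real s)"
  proof (rule mult_left_mono)
    have "real (n choose s) \<le> (exp 1 * real n / real s) ^ s" using s by (intro binomial_le_exp_pow) simp
    also have "\<dots> = exp (1 + ln (1 / x)) ^ s"
    proof -
      have "exp 1 * real n / real s = exp 1 * (1 / x)" by (simp add: x)
      also have "\<dots> = exp (1 + ln (1 / x))" using x0 by (simp add: exp_add)
      finally show ?thesis by simp
    qed
    also have "\<dots> = exp (real s * (1 + ln (1 / x)))" by (rule exp_of_nat_mult[symmetric])
    finally have b1: "real (n choose s) \<le> exp (real s * (1 + ln (1 / x)))" .
    have "(1 - x ^ r) ^ m \<le> exp (- (x ^ r)) ^ m"
      using x0 exp_ge_add_one_self[of "- (x ^ r)"] by (intro power_mono) (auto simp: power_le_one)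
    also have "\<dots> = exp (real m * - (x ^ r))" by (rule exp_of_nat_mult[symmetric])
    also have "real m * - (x ^ r) = - (real s * (real d / real r * x ^ (r - 1)))"
    proof -
      have "real m * real r = real n * real d" using mr by (metis of_nat_mult)
      then have "real m = real n * (real d / real r)" using r2 by (simp add: field_simps)
      moreover have "x ^ r = x * x ^ (r - 1)" using r2 by (cases r) auto
      moreover have "real n * x = real s" using n by (simp add: x)
      ultimately show ?thesis by (simp add: algebra_simps)
    qed
    finally have b2: "(1 - x ^ r) ^ m \<le> exp (- (real s * (real d / real r * x ^ (r - 1))))" .
    have "real (n choose s) * (1 - x ^ r) ^ m \<le> exp (real s * (1 + ln (1 / x))) * exp (- (real s * (real d / real r * x ^ (r - 1))))"
      using b1 b2 x0 by (intro mult_mono) (auto simp: power_le_one)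
    also have "\<dots> = exp (real s * (1 + ln (1 / x) - real d / real r * x ^ (r - 1)))"
      by (simp add: exp_add[symmetric] algebra_simps)
    also have "\<dots> \<le> exp (real s * (-1))"
    proof -
      have "real s * (1 + ln (1 / x) - real d / real r * x ^ (r - 1)) \<le> real s * (-1)"
        using dense by (intro mult_left_mono) auto
      then show ?thesis by simp
    qed
    finally show "real (n choose s) * (1 - x ^ r) ^ m \<le> exp (- real s)" by simp
  qed simp
  finally show ?thesis unfolding P_def .
qed

lemma perm_prob_simple_ge:
  assumes K: "K = max r d" and J: "J = 20 * K ^ 4" and N: "2 * ((2 * K) ^ 4 + J) + 6 \<le> n * d"
  shows "perm_prob S (\<lambda>\<pi>. simple r m (vt \<circ> \<pi>)) \<ge> 1 / real (2 * (1 + 2 * ((2 * K) ^ 4 + J)) ^ J)"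
proof -
  interpret tp: two_partitions S fst vt K
  proof
    fix p assume p: "p \<in> S"
    have "{q \<in> S. fst q = fst p} = {fst p} \<times> {..<r}" using p by auto
    then show "card {q \<in> S. fst q = fst p} \<le> K" by (simp add: K card_cartesian_product)
    have "vt p \<in> {1..n}" using p by (rule funcset_mem[OF vt_in])
    from vt_fib[OF this] show "card {q \<in> S. vt q = vt p} \<le> K" by (simp add: K)
  qed simp
  have "1 / real (2 * (1 + 2 * ((2 * K) ^ 4 + J)) ^ J) \<le> perm_prob S (\<lambda>\<pi>. short_cycles S fst vt \<pi> = {})"
    using tp.perm_prob_no_short_cycles[OF J] N unfolding card_S mr by simp
  also have "\<dots> \<le> perm_prob S (\<lambda>\<pi>. simple r m (vt \<circ> \<pi>))"
    by (rule perm_prob_mono[OF finS]) (rule simple_of_no_short_cycles)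
  finally show ?thesis .
qed

end

section \<open>Asymptotics of the parameters\<close>

text \<open>Everything that needs \<open>d\<close> large is gathered here. Taking \<open>k\<close>
  near \<open>(1 + \<epsilon> / 2) * K\<close> leaves \<open>(\<epsilon> / 2) * K\<close> for the
  \<open>2 * r\<close> repair colours and the rounding; \<open>(1 + \<epsilon>) / K\<close> is the
  density beyond which independent sets are excluded.\<close>

lemma density_parameters:
  fixes r :: nat and \<epsilon> :: real
  assumes r: "r \<ge> 2" and \<epsilon>: "\<epsilon> > 0"
  shows "eventually (\<lambda>d::nat. \<forall>K k \<kappa>. K = (real (r - 1) * real d / (real r * ln (real d))) powr (1 / real (r - 1)) \<longrightarrow>
      k = nat \<lceil>(1 + \<epsilon> / 2) * K\<rceil> \<longrightarrow> \<kappa> = 1 / real k ^ (r - 1) \<longrightarrow>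
      1 \<le> d \<and> 0 < ln (real d) \<and> 0 < K \<and> real (k + 2 * r) \<le> (1 + \<epsilon>) * K \<and> 2 * r \<le> k \<and>
      2 + ln (1 / ((1 + \<epsilon>) / K)) \<le> real d / real r * ((1 + \<epsilon>) / K) ^ (r - 1) \<and>
      (\<exists>\<eta>>0. \<forall>y. 0 \<le> y \<longrightarrow> y \<le> (1 + \<eta>) * real k \<longrightarrow>
        real d / (real r * (1 - \<kappa>)\<^sup>2) * \<kappa>\<^sup>2 * (y ^ r - 1 - real r * (y - 1)) \<le> y * ln y - y + 1)) sequentially"
proof -
  define p where "p = 1 / real (r - 1)"
  define c where "c = real (r - 1) / real r"
  have p0: "p > 0" and c0: "c > 0" and c1: "c \<le> 1" using r by (auto simp: p_def c_def)
  define \<theta> where "\<theta> = 1 + \<epsilon> / 2"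
  have \<theta>: "\<theta> > 1" using \<epsilon> by (simp add: \<theta>_def)
  \<comment> \<open>The slack \<theta> is split into three equal factors: one pays for
    \<open>1 / (1 - \<kappa>)^2\<close>, one for \<open>(1 + \<eta>) ^ (r - 1)\<close>, and one for
    lower order terms. The last is halved again as \<open>q2^2 = q\<close>, for replacing
    \<open>ln d\<close> by \<open>ln M\<close> and for the loss \<open>2 * ln t + 1\<close>.\<close>
  define q where "q = root 3 \<theta>"
  have q: "q > 1" "q ^ 3 = \<theta>" unfolding q_def using \<theta> by (auto simp: odd_real_root_pow)
  define q2 where "q2 = sqrt q"
  have q2: "q2 > 1" "q2\<^sup>2 = q" unfolding q2_def using q by auto
  define \<eta> where "\<eta> = root (r - 1) q - 1"
  have \<eta>: "\<eta> > 0" "(1 + \<eta>) ^ (r - 1) = q" unfolding \<eta>_def using q r by auto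
  define Kf where "Kf d = (c * real d / ln (real d)) powr p" for d :: nat
  have Keq: "(real (r - 1) * real d / (real r * ln (real d))) powr (1 / real (r - 1)) = Kf d" for d
    by (simp add: Kf_def p_def c_def)
  have Klim: "filterlim Kf at_top sequentially"
    unfolding Kf_def using p0 c0 by real_asymp
  have "((\<lambda>d::nat. ln (c * real d / ln (real d)) / ln (real d)) \<longlongrightarrow> 1) sequentially"
    using c0 by real_asymp
  moreover have "1 / q2 < 1" using q2 by simp
  ultimately have ev_ln: "eventually (\<lambda>d::nat. ln (c * real d / ln (real d)) / ln (real d) > 1 / q2) sequentially"
    by (rule order_tendstoD)
  have "eventually (\<lambda>t::real. t - 2 * ln t - 1 \<ge> t / q2) at_top"
  proof -
    have "((\<lambda>t::real. (t - 2 * ln t - 1) / t) \<longlongrightarrow> 1) at_top" by real_asymp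
    moreover have "1 / q2 < 1" using q2 by simp
    ultimately have "eventually (\<lambda>t::real. (t - 2 * ln t - 1) / t > 1 / q2) at_top" by (rule order_tendstoD)
    then show ?thesis using eventually_gt_at_top[of 0]
    proof eventually_elim
      case (elim t)
      then have "1 / q2 * t \<le> t - 2 * ln t - 1" by (simp only: pos_less_divide_eq less_imp_le)
      then show ?case by simp
    qed
  qed
  then obtain T0 where T0: "\<And>t. t \<ge> T0 \<Longrightarrow> t - 2 * ln t - 1 \<ge> t / q2"
    by (auto simp: eventually_at_top_linorder)
  have "eventually (\<lambda>x::real. (ln x)\<^sup>2 \<le> x \<and> 1 / (1 - 1 / x)\<^sup>2 \<le> q) at_top"
  proof (intro eventually_conj)
    show "eventually (\<lambda>x::real. (ln x)\<^sup>2 \<le> x) at_top" by real_asymp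
    have "((\<lambda>x::real. 1 / (1 - 1 / x)\<^sup>2) \<longlongrightarrow> 1) at_top" by real_asymp
    from order_tendstoD(2)[OF this q(1)] show "eventually (\<lambda>x::real. 1 / (1 - 1 / x)\<^sup>2 \<le> q) at_top"
      by eventually_elim simp
  qed
  then obtain X0 where X0: "\<And>x. x \<ge> X0 \<Longrightarrow> (ln x)\<^sup>2 \<le> x \<and> 1 / (1 - 1 / x)\<^sup>2 \<le> q"
    by (auto simp: eventually_at_top_linorder)
  \<comment> \<open>In order: the asymptotic bounds at \<open>real k\<close>,
    \<open>t \<ge> T0\<close>, \<open>t \<ge> 4 * r^2\<close>, \<open>k \<ge> 2 * r\<close>, room
    for the repair colours and the rounding, and \<open>t \<ge> 1\<close>, where
    \<open>t = ln k\<close>.\<close>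
  define B where "B = Max {X0, exp T0, exp (4 * (real r)\<^sup>2), 2 * real r, (2 * real r + 1) * 2 / \<epsilon>, exp 1}"
  have ev_K: "eventually (\<lambda>d. Kf d \<ge> B) sequentially" using Klim by (auto simp: filterlim_at_top)
  have ev_l: "eventually (\<lambda>d::nat. ln (real d) \<ge> 1 \<and> \<epsilon> * ln (real d) \<ge> 2) sequentially"
  proof (intro eventually_conj)
    show "eventually (\<lambda>d::nat. ln (real d) \<ge> 1) sequentially" by real_asymp
    show "eventually (\<lambda>d::nat. \<epsilon> * ln (real d) \<ge> 2) sequentially" using \<epsilon> by real_asymp
  qed
  show ?thesis
    using ev_ln ev_K ev_l eventually_ge_at_top[of 1]
  proof eventually_elim
    case (elim d)
    show ?case
    proof (intro allI impI)
      fix K \<kappa> :: real and k :: nat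
      assume K: "K = (real (r - 1) * real d / (real r * ln (real d))) powr (1 / real (r - 1))"
        and k: "k = nat \<lceil>(1 + \<epsilon> / 2) * K\<rceil>" and \<kappa>: "\<kappa> = 1 / real k ^ (r - 1)"
      define l where "l = ln (real d)"
      have l: "l \<ge> 1" "\<epsilon> * l \<ge> 2" using elim by (auto simp: l_def)
      have d1: "1 \<le> d" using elim by simp
      have KB: "K \<ge> B" using elim K Keq by simp
      have B: "B \<ge> X0" "B \<ge> exp T0" "B \<ge> exp (4 * (real r)\<^sup>2)" "B \<ge> 2 * real r" "B \<ge> (2 * real r + 1) * 2 / \<epsilon>" "B \<ge> exp 1"
        unfolding B_def by (auto intro!: Max_ge)
      have K0: "K > 0" using KB B(6) exp_gt_zero[of "1::real"] by linarith
      define M where "M = c * real d / l"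
      have M0: "M > 0" unfolding M_def using c0 d1 l by simp
      have KM: "K = M powr p" unfolding K Keq Kf_def M_def l_def ..
      have KrM: "K ^ (r - 1) = M"
      proof -
        have "K ^ (r - 1) = K powr real (r - 1)" using K0 by (simp add: powr_realpow)
        also have "\<dots> = M" unfolding KM powr_powr using M0 r by (simp add: p_def)
        finally show ?thesis .
      qed
      have kK: "real k \<ge> \<theta> * K" unfolding k \<theta>_def by linarith
      have kK': "real k \<le> \<theta> * K + 1"
      proof -
        have "\<theta> * K \<ge> 0" using \<theta> K0 by simp
        then show ?thesis unfolding k \<theta>_def by linarith
      qed
      have "1 * K \<le> \<theta> * K" using \<theta> K0 by (intro mult_right_mono) auto
      then have kK1: "real k \<ge> K" using kK by simp
      have kB: "real k \<ge> B" using kK1 KB by simp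
      have k0: "real k > 0" using kK1 K0 by simp
      have 1: "real (k + 2 * r) \<le> (1 + \<epsilon>) * K"
      proof -
        have "(2 * real r + 1) * 2 / \<epsilon> \<le> K" using B(5) KB by linarith
        then have "2 * real r + 1 \<le> \<epsilon> / 2 * K" using \<epsilon> by (simp add: field_simps)
        then show ?thesis using kK' by (simp add: \<theta>_def algebra_simps)
      qed
      have "real (2 * r) \<le> real k" using B(4) kB by simp
      then have 2: "2 * r \<le> k" by (simp only: of_nat_le_iff)
      have 3: "2 + ln (1 / ((1 + \<epsilon>) / K)) \<le> real d / real r * ((1 + \<epsilon>) / K) ^ (r - 1)"
      proof -
        have "ln (1 / ((1 + \<epsilon>) / K)) \<le> ln K"
          using K0 \<epsilon> by (intro ln_mono) (auto simp: field_simps)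
        also have "ln K = p * ln M" unfolding KM using M0 by (simp add: ln_powr)
        also have "\<dots> \<le> p * l"
        proof (rule mult_left_mono)
          have "M \<le> real d"
          proof -
            have "c * real d \<le> 1 * real d" using c1 by (intro mult_right_mono) auto
            also have "\<dots> \<le> real d * l" using l(1) d1 by simp
            finally show ?thesis unfolding M_def using l by (simp add: field_simps)
          qed
          then show "ln M \<le> l" unfolding l_def using M0 by (intro ln_mono) auto
        qed (use p0 in simp)
        finally have a: "ln (1 / ((1 + \<epsilon>) / K)) \<le> p * l" .
        have "real d / real r * ((1 + \<epsilon>) / K) ^ (r - 1) = (1 + \<epsilon>) ^ (r - 1) * (real d / (real r * M))"
          unfolding power_divide KrM by simp
        also have "real d / (real r * M) = p * l"
          unfolding M_def c_def p_def using r d1 l by (simp add: field_simps)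
        finally have b: "real d / real r * ((1 + \<epsilon>) / K) ^ (r - 1) = (1 + \<epsilon>) ^ (r - 1) * (p * l)" .
        \<comment> \<open>The leading terms \<open>p * l\<close> agree on both sides; Bernoulli
          yields the surplus \<open>\<epsilon> * l\<close>, which exceeds 2 for large
          \<open>d\<close>.\<close>
        have "1 + real (r - 1) * \<epsilon> \<le> (1 + \<epsilon>) ^ (r - 1)" using \<epsilon> by (intro Bernoulli_inequality) auto
        then have "(1 + real (r - 1) * \<epsilon>) * (p * l) \<le> (1 + \<epsilon>) ^ (r - 1) * (p * l)"
          using p0 l by (intro mult_right_mono) auto
        moreover have "(1 + real (r - 1) * \<epsilon>) * (p * l) = p * l + \<epsilon> * l"
          using r by (simp add: p_def field_simps)
        ultimately show ?thesis using a b l by linarith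
      qed
      have 4: "\<exists>\<eta>>0. \<forall>y. 0 \<le> y \<longrightarrow> y \<le> (1 + \<eta>) * real k \<longrightarrow>
        real d / (real r * (1 - \<kappa>)\<^sup>2) * \<kappa>\<^sup>2 * (y ^ r - 1 - real r * (y - 1)) \<le> y * ln y - y + 1"
      proof (intro exI[of _ \<eta>] conjI \<eta>(1) allI impI)
        fix y assume y: "0 \<le> y" "y \<le> (1 + \<eta>) * real k"
        define t where "t = ln (real k)"
        define A where "A = real d / (real r * (1 - \<kappa>)\<^sup>2) * \<kappa>\<^sup>2"
        define cc where "cc = real d / (real r * (1 - \<kappa>)\<^sup>2) * \<kappa>"
        have lnK: "ln K \<le> t" unfolding t_def using kK1 K0 by (intro ln_mono) auto
        have t1: "t \<ge> 1" "t \<ge> 4 * (real r)\<^sup>2" "t \<ge> T0"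
          unfolding t_def using kB B k0 by (auto simp: ln_ge_iff intro: order.trans)
        have k1: "real k \<ge> exp 1" using kB B(6) by linarith
        have k1': "real k > 1" using k1 exp_gt_one[of "1::real"] by linarith
        have r1: "r - 1 \<ge> 1" using r by simp
        have \<kappa>0: "\<kappa> > 0" unfolding \<kappa> using k0 by simp
        have \<kappa>k: "\<kappa> \<le> 1 / real k"
        proof -
          have "real k ^ 1 \<le> real k ^ (r - 1)" using k1' r1 by (intro power_increasing) auto
          then show ?thesis unfolding \<kappa> using k0 by (simp add: frac_le)
        qed
        have k1k: "1 / real k < 1" using k1' by simp
        have inv: "1 / (1 - \<kappa>)\<^sup>2 \<le> q"
        proof -
          have "1 / (1 - \<kappa>)\<^sup>2 \<le> 1 / (1 - 1 / real k)\<^sup>2"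
            using \<kappa>k k1k by (intro divide_left_mono power_mono mult_pos_pos) auto
          also have "\<dots> \<le> q" using X0[of "real k"] kB B(1) by linarith
          finally show ?thesis .
        qed
        have krM: "\<theta> * M \<le> real k ^ (r - 1)"
        proof -
          have "\<theta> ^ 1 \<le> \<theta> ^ (r - 1)" using \<theta> r1 by (intro power_increasing) auto
          then have "\<theta> * M \<le> \<theta> ^ (r - 1) * M" using M0 by (intro mult_right_mono) auto
          also have "\<dots> = (\<theta> * K) ^ (r - 1)" unfolding power_mult_distrib KrM ..
          also have "\<dots> \<le> real k ^ (r - 1)" using kK \<theta> K0 by (intro power_mono) auto
          finally show ?thesis .
        qed
        have cc_le: "cc * q \<le> p * l / q"
        proof -
          have "real d / real r * \<kappa> \<le> real d / real r * (1 / (\<theta> * M))"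
            unfolding \<kappa> using krM M0 \<theta> by (intro mult_left_mono frac_le) auto
          also have "\<dots> = p * l / \<theta>"
            unfolding M_def c_def p_def using r d1 l \<theta> by (simp add: field_simps)
          finally have a: "real d / real r * \<kappa> \<le> p * l / \<theta>" .
          have "cc = (real d / real r * \<kappa>) * (1 / (1 - \<kappa>)\<^sup>2)" by (simp add: cc_def)
          also have "\<dots> \<le> (p * l / \<theta>) * q" using a inv p0 l \<theta> \<kappa>0 by (intro mult_mono) auto
          finally have "cc * q \<le> (p * l / \<theta>) * q * q" using q by (intro mult_right_mono) auto
          also have "\<dots> = p * l / q" unfolding q(2)[symmetric] using q(1) by (simp add: eval_nat_numeral field_simps)
          finally show ?thesis .
        qed
        have t_ge: "p * l / q \<le> t - 2 * ln t - 1"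
        proof -
          have "1 / q2 < ln M / l" using elim(1) unfolding M_def l_def .
          then have "l / q2 \<le> ln M" using l q2 by (simp add: field_simps)
          then have "p * (l / q2) \<le> p * ln M" using p0 by (intro mult_left_mono) auto
          also have "\<dots> = ln K" unfolding KM using M0 by (simp add: ln_powr)
          also note lnK
          finally have "p * (l / q2) / q2 \<le> t / q2" using q2 by (intro divide_right_mono) auto
          moreover have "p * (l / q2) / q2 = p * l / q" unfolding q2(2)[symmetric] by (simp add: power2_eq_square)
          ultimately show ?thesis using T0[OF t1(3)] by linarith
        qed
        have t_pos: "t > 0" using t1 by linarith
        have cc0: "cc \<ge> 0" unfolding cc_def using \<kappa>0 by simp
        have cc_t: "cc \<le> t"
        proof -
          have "cc * 1 \<le> cc * q" using cc0 q by (intro mult_left_mono) auto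
          moreover have "ln t \<ge> 0" using t1 by simp
          ultimately show ?thesis using cc_le t_ge by linarith
        qed
        have Ak: "A * real k ^ (r - 1) = cc"
          unfolding A_def cc_def \<kappa> using k0 by (simp add: power2_eq_square)
        \<comment> \<open>Dividing by \<open>t^2\<close> serves both requirements: in the quadratic
          range the product of \<open>4 * r^2 \<le> t\<close> and \<open>cc \<le> t\<close> is
          beaten by \<open>(t^2) ^ (r - 1)\<close>, while \<open>ln y1 = t - 2 * ln t\<close> is
          still close to \<open>t\<close>.\<close>
        define y1 where "y1 = real k / t\<^sup>2"
        have "A * (y ^ r - 1 - real r * (y - 1)) \<le> y * ln y - y + 1"
        proof (rule power_excess_le_entropy_excess[OF y])
          show "1 \<le> r" using r by simp
          show "0 \<le> A" unfolding A_def by simp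
          show "1 \<le> y1" unfolding y1_def t_def using X0[of "real k"] kB B(1) t_pos[unfolded t_def] by (simp add: le_divide_eq)
          have "4 * A * (real r)\<^sup>2 * y1 ^ (r - 1) = 4 * (real r)\<^sup>2 * (A * real k ^ (r - 1)) / (t\<^sup>2) ^ (r - 1)"
            unfolding y1_def power_divide by simp
          also have "\<dots> = 4 * (real r)\<^sup>2 * cc / (t\<^sup>2) ^ (r - 1)" unfolding Ak ..
          also have "\<dots> \<le> t * t / (t\<^sup>2) ^ (r - 1)"
            using t1 cc_t cc0 t_pos by (intro divide_right_mono mult_mono) auto
          also have "\<dots> \<le> 1"
          proof -
            have "1 \<le> t\<^sup>2" using t1 by (simp add: one_le_power)
            then have "(t\<^sup>2) ^ 1 \<le> (t\<^sup>2) ^ (r - 1)" using r1 by (intro power_increasing) auto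
            then show ?thesis using t_pos by (simp add: divide_le_eq power2_eq_square)
          qed
          finally show "4 * A * (real r)\<^sup>2 * y1 ^ (r - 1) \<le> 1" .
          have "A * ((1 + \<eta>) * real k) ^ (r - 1) = cc * q"
            unfolding power_mult_distrib \<eta>(2) Ak[symmetric] by simp
          also have "\<dots> \<le> t - 2 * ln t - 1" using cc_le t_ge by linarith
          also have "\<dots> = ln y1 - 1" unfolding y1_def using k0 t_pos by (simp add: ln_div ln_realpow t_def[symmetric])
          finally show "A * ((1 + \<eta>) * real k) ^ (r - 1) \<le> ln y1 - 1" .
        qed
        then show "real d / (real r * (1 - \<kappa>)\<^sup>2) * \<kappa>\<^sup>2 * (y ^ r - 1 - real r * (y - 1)) \<le> y * ln y - y + 1"
          unfolding A_def .
      qed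
      show "1 \<le> d \<and> 0 < ln (real d) \<and> 0 < K \<and> real (k + 2 * r) \<le> (1 + \<epsilon>) * K \<and> 2 * r \<le> k \<and>
        2 + ln (1 / ((1 + \<epsilon>) / K)) \<le> real d / real r * ((1 + \<epsilon>) / K) ^ (r - 1) \<and>
        (\<exists>\<eta>>0. \<forall>y. 0 \<le> y \<longrightarrow> y \<le> (1 + \<eta>) * real k \<longrightarrow>
        real d / (real r * (1 - \<kappa>)\<^sup>2) * \<kappa>\<^sup>2 * (y ^ r - 1 - real r * (y - 1)) \<le> y * ln y - y + 1)"
      proof (intro conjI d1 K0 1 2 3 4)
        show "0 < ln (real d)" using l(1) unfolding l_def by linarith
      qed
    qed
  qed
qed

lemma poly_times_exp_tendsto_0:
  fixes c d :: real and E :: nat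
  assumes "c > 0" "d > 0"
  shows "((\<lambda>n::nat. (exp 1 * (real n * d + 1)) ^ E * exp (- (c * real n))) \<longlongrightarrow> 0) sequentially"
  using assms by real_asymp

section \<open>The theorem\<close>

context config
begin

text \<open>Conditioning on simplicity multiplies the probability of a bad event by at most
  \<open>1 / c1\<close>.\<close>

lemma hprob_ge:
  assumes c1: "c1 > 0" "perm_prob S (\<lambda>\<pi>. simple r m (vt \<circ> \<pi>)) \<ge> c1"
    and bad: "perm_prob S bad \<le> b"
    and good: "\<And>\<pi>. \<pi> permutes S \<Longrightarrow> simple r m (vt \<circ> \<pi>) \<Longrightarrow> \<not> bad \<pi> \<Longrightarrow> P (hgraph \<pi>)"
  shows "hprob r d n P \<ge> 1 - b / c1"
proof -
  define ps where "ps = perm_prob S (\<lambda>\<pi>. simple r m (vt \<circ> \<pi>))"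
  define pg where "pg = perm_prob S (\<lambda>\<pi>. simple r m (vt \<circ> \<pi>) \<and> P (hgraph \<pi>))"
  have ps: "ps > 0" "ps \<ge> c1" using c1 unfolding ps_def by auto
  have b0: "b \<ge> 0" using bad perm_prob_nonneg[of S bad] by linarith
  have "ps \<le> perm_prob S (\<lambda>\<pi>. (simple r m (vt \<circ> \<pi>) \<and> P (hgraph \<pi>)) \<or> bad \<pi>)"
    unfolding ps_def by (rule perm_prob_mono[OF finS]) (use good in blast)
  also have "\<dots> \<le> pg + perm_prob S bad" unfolding pg_def by (rule perm_prob_disj[OF finS])
  finally have "ps - b \<le> pg" using bad by linarith
  then have "(ps - b) / ps \<le> pg / ps" using ps by (intro divide_right_mono) auto
  moreover have "(ps - b) / ps = 1 - b / ps" using ps by (simp add: diff_divide_distrib)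
  moreover have "b / ps \<le> b / c1" using ps c1 b0 by (intro divide_left_mono) auto
  moreover have "hprob r d n P = pg / ps" unfolding pg_def ps_def by (rule hprob_eq) (use ps in \<open>simp add: ps_def\<close>)
  ultimately show ?thesis by linarith
qed

text \<open>The two upper bounds and \<open>n \<le> \<chi> * \<alpha>\<close> are all that is used
  of \<open>H\<close>, so \<open>P\<close> is kept abstract. The three error terms belong to a large
  independent set, too many monochromatic blocks, and a small dense vertex set.\<close>

lemma hprob_coloring_indep_ge:
  assumes n: "n > 0" and k: "k > 0" and s: "s > 0"
    and c1: "c1 > 0" "perm_prob S (\<lambda>\<pi>. simple r m (vt \<circ> \<pi>)) \<ge> c1"
    and dense: "2 + ln (1 / (real s / real n)) \<le> real d / real r * (real s / real n) ^ (r - 1)"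
    and Q: "1 \<le> Q * perm_prob S (\<lambda>\<pi>. \<exists>\<sigma>\<in>{1..n} \<rightarrow>\<^sub>E {..<k}. proper_word \<sigma> \<pi>)" "Q \<ge> 0"
    and \<gamma>: "\<gamma> = 1 / (12 * real d ^ 3)"
    and P: "\<And>H. chromatic_number {1..n} H \<le> k + 2 * r \<Longrightarrow> independence_number {1..n} H < s \<Longrightarrow>
      n \<le> chromatic_number {1..n} H * independence_number {1..n} H \<Longrightarrow> P H"
  shows "hprob r d n P \<ge> 1 - ((exp 1 * (real (n * d) + 1))\<^sup>2 * exp (- real s) + (Q * exp (- (\<gamma>\<^sup>2 * real (n * d) / 64)) + 6 * (real d)\<^sup>2 / real n)) / c1"
proof -
  define b1 where "b1 \<pi> \<longleftrightarrow> (\<exists>X\<subseteq>{1..n}. card X = s \<and> (\<forall>e<m. \<not> edge r (vt \<circ> \<pi>) e \<subseteq> X))" for \<pi>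
  define b2 where "b2 \<pi> \<longleftrightarrow> real (min_mono k \<pi>) > \<gamma> * real (m * r)" for \<pi>
  define b3 where "b3 \<pi> \<longleftrightarrow> (\<exists>U\<subseteq>{1..n}. U \<noteq> {} \<and> 12 * d\<^sup>2 * card U \<le> n \<and>
      2 * card U \<le> card {e. e < m \<and> edge r (vt \<circ> \<pi>) e \<subseteq> U})" for \<pi>
  have d0: "real d \<ge> 1" using d1 by simp
  have \<gamma>1: "0 \<le> \<gamma>" "\<gamma> \<le> 1"
  proof -
    have "1 \<le> 12 * real d ^ 3" using one_le_power[OF d0, of 3] by linarith
    then show "\<gamma> \<le> 1" unfolding \<gamma> by (simp add: divide_le_eq)
  qed (simp add: \<gamma>)
  have "perm_prob S (\<lambda>\<pi>. b1 \<pi> \<or> (b2 \<pi> \<or> b3 \<pi>)) \<le> perm_prob S b1 + perm_prob S (\<lambda>\<pi>. b2 \<pi> \<or> b3 \<pi>)"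
    by (rule perm_prob_disj[OF finS])
  also have "\<dots> \<le> perm_prob S b1 + (perm_prob S b2 + perm_prob S b3)"
    using perm_prob_disj[OF finS, of b2 b3] by simp
  also have "\<dots> \<le> (exp 1 * (real (n * d) + 1))\<^sup>2 * exp (- real s) + (Q * exp (- (\<gamma>\<^sup>2 * real (n * d) / 64)) + 6 * (real d)\<^sup>2 / real n)"
  proof (intro add_mono)
    show "perm_prob S b1 \<le> (exp 1 * (real (n * d) + 1))\<^sup>2 * exp (- real s)"
      unfolding b1_def by (rule perm_prob_large_indep_le[OF n s refl dense])
    show "perm_prob S b2 \<le> Q * exp (- (\<gamma>\<^sup>2 * real (n * d) / 64))"
      unfolding b2_def mr[symmetric] by (rule perm_prob_min_mono_le[OF k \<gamma>1 Q])
    show "perm_prob S b3 \<le> 6 * (real d)\<^sup>2 / real n"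
      unfolding b3_def by (rule perm_prob_dense_set_le[OF n])
  qed
  finally have bad: "perm_prob S (\<lambda>\<pi>. b1 \<pi> \<or> (b2 \<pi> \<or> b3 \<pi>))
    \<le> (exp 1 * (real (n * d) + 1))\<^sup>2 * exp (- real s) + (Q * exp (- (\<gamma>\<^sup>2 * real (n * d) / 64)) + 6 * (real d)\<^sup>2 / real n)" .
  show ?thesis
  proof (rule hprob_ge[OF c1 bad])
    fix \<pi> assume pi: "\<pi> permutes S" and simple: "simple r m (vt \<circ> \<pi>)" and nb: "\<not> (b1 \<pi> \<or> (b2 \<pi> \<or> b3 \<pi>))"
    have "\<exists>f. proper_coloring {1..n} (hgraph \<pi>) (k + 2 * r) f"
    proof (rule colorable_of_few_mono_blocks[OF pi simple k])
      \<comment> \<open>\<gamma> is chosen such that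
        \<open>\<gamma> * n * d = n / (12 * d^2)\<close>, the size up to which dense vertex sets are
        excluded.\<close>
      have "real (min_mono k \<pi>) \<le> \<gamma> * real (n * d)" using nb unfolding b2_def mr by simp
      then have "12 * (real d)\<^sup>2 * real (min_mono k \<pi>) \<le> 12 * (real d)\<^sup>2 * (\<gamma> * real (n * d))"
        by (rule mult_left_mono) simp
      also have "\<dots> = real n" unfolding \<gamma> using d0 by (simp add: power2_eq_square power3_eq_cube)
      finally have "real (12 * d\<^sup>2 * min_mono k \<pi>) \<le> real n" by simp
      then show "12 * d\<^sup>2 * min_mono k \<pi> \<le> n" by (simp only: of_nat_le_iff)
      fix U assume "U \<subseteq> {1..n}" "U \<noteq> {}" "12 * d\<^sup>2 * card U \<le> n"
      then show "card {e. e < m \<and> edge r (vt \<circ> \<pi>) e \<subseteq> U} < 2 * card U"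
        using nb unfolding b3_def by (meson not_le)
    qed
    then obtain f where f: "proper_coloring {1..n} (hgraph \<pi>) (k + 2 * r) f" by blast
    show "P (hgraph \<pi>)"
    proof (rule P)
      show "chromatic_number {1..n} (hgraph \<pi>) \<le> k + 2 * r"
        unfolding chromatic_number_def by (rule Least_le) (use f in blast)
      show "n \<le> chromatic_number {1..n} (hgraph \<pi>) * independence_number {1..n} (hgraph \<pi>)"
        using card_le_chromatic_times_independence[of "{1..n}" "hgraph \<pi>"] f by auto
      show "independence_number {1..n} (hgraph \<pi>) < s"
      proof (rule independence_number_less)
        fix X assume X: "X \<subseteq> {1..n}" "card X = s"
        have "\<exists>e<m. edge r (vt \<circ> \<pi>) e \<subseteq> X"
        proof (rule ccontr)
          assume "\<not> ?thesis"
          then have "b1 \<pi>" unfolding b1_def using X by blast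
          then show False using nb by blast
        qed
        then show "\<exists>e\<in>hgraph \<pi>. e \<subseteq> X" by blast
      next
        fix A assume "A \<in> hgraph \<pi>"
        then show "A \<noteq> {}" using r2 by (auto simp: edge_def lessThan_empty_iff)
      qed simp
    qed
  qed
qed

end

lemma ex_config:
  assumes "2 \<le> r" "1 \<le> d" "r dvd n * d"
  shows "\<exists>vt. config r d n (n * d div r) vt"
proof -
  define m where "m = n * d div r"
  have "m * r = n * d" using assms(3) by (simp add: m_def)
  then have "sum (\<lambda>_. d) {1..n} = card ({..<m} \<times> {..<r})" by (simp add: card_cartesian_product)
  from ex_word[OF _ _ this] obtain vt where vt: "vt \<in> words ({..<m} \<times> {..<r}) {1..n} (\<lambda>_. d)" by auto
  have "config r d n m vt"
  proof
    show "vt \<in> {..<m} \<times> {..<r} \<rightarrow> {1..n}" using vt unfolding words_def by blast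
    show "card {x \<in> {..<m} \<times> {..<r}. vt x = v} = d" if "v \<in> {1..n}" for v
      using vt that unfolding words_def by blast
  qed (use assms in auto)
  then show ?thesis unfolding m_def by blast
qed

text \<open>Dividing \<open>n\<close> by either upper bound gives a lower bound with factor
  \<open>1 / (1 + \<epsilon>)\<close>, and this is at least \<open>1 - \<epsilon>\<close>.\<close>

lemma relative_error_bounds:
  fixes n :: nat and K \<epsilon> \<chi> \<alpha> :: real
  assumes n: "n > 0" and K: "K > 0" and \<epsilon>: "\<epsilon> > 0"
    and \<chi>: "\<chi> \<le> (1 + \<epsilon>) * K" "0 \<le> \<chi>" and \<alpha>: "\<alpha> \<le> (1 + \<epsilon>) * (real n / K)" "0 \<le> \<alpha>" and prod: "real n \<le> \<chi> * \<alpha>"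
  shows "\<bar>(\<chi> - K) / K\<bar> \<le> \<epsilon>" "\<bar>(\<alpha> - real n / K) / (real n / K)\<bar> \<le> \<epsilon>"
proof -
  define a where "a = real n / K"
  have a: "a > 0" "real n = K * a" using n K by (auto simp: a_def)
  have e1: "0 < 1 + \<epsilon>" using \<epsilon> by simp
  have e: "1 - \<epsilon> \<le> 1 / (1 + \<epsilon>)" using \<epsilon> by (simp add: field_simps)
  have "K * a \<le> \<chi> * ((1 + \<epsilon>) * a)" using prod mult_left_mono[OF \<alpha>(1) \<chi>(2)] a unfolding a_def[symmetric] by linarith
  then have "K \<le> \<chi> * (1 + \<epsilon>)" using a(1) by (simp add: mult.assoc[symmetric])
  then have "1 / (1 + \<epsilon>) * K \<le> \<chi>" using e1 by (simp add: field_simps)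
  moreover have "(1 - \<epsilon>) * K \<le> 1 / (1 + \<epsilon>) * K" using e K by (intro mult_right_mono) auto
  ultimately have "(1 - \<epsilon>) * K \<le> \<chi>" by linarith
  then have "\<bar>\<chi> - K\<bar> \<le> \<epsilon> * K" using \<chi>(1) by (simp add: abs_le_iff algebra_simps)
  then show "\<bar>(\<chi> - K) / K\<bar> \<le> \<epsilon>" using K by (simp add: abs_divide divide_le_eq)
  have "K * a \<le> ((1 + \<epsilon>) * K) * \<alpha>" using prod mult_right_mono[OF \<chi>(1) \<alpha>(2)] a by linarith
  then have "K * a \<le> K * ((1 + \<epsilon>) * \<alpha>)" by (simp only: mult.left_commute mult.assoc)
  then have "a \<le> (1 + \<epsilon>) * \<alpha>" using K by simp
  then have "1 / (1 + \<epsilon>) * a \<le> \<alpha>" using e1 by (simp add: field_simps)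
  moreover have "(1 - \<epsilon>) * a \<le> 1 / (1 + \<epsilon>) * a" using e a by (intro mult_right_mono) auto
  ultimately have "(1 - \<epsilon>) * a \<le> \<alpha>" by linarith
  then have "\<bar>\<alpha> - a\<bar> \<le> \<epsilon> * a" using \<alpha>(1) unfolding a_def[symmetric] by (simp add: abs_le_iff algebra_simps)
  then show "\<bar>(\<alpha> - real n / K) / (real n / K)\<bar> \<le> \<epsilon>" using a(1) unfolding a_def[symmetric] by (simp add: abs_divide divide_le_eq)
qed

theorem theorem1:
  fixes r :: nat and \<epsilon> :: real
  assumes "r \<ge> 2" and "\<epsilon> > 0"
  shows "\<exists>d0::nat. \<forall>d\<ge>d0.
    (\<forall>\<delta>>0. \<exists>N. \<forall>n\<ge>N. r dvd n * d \<longrightarrow>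
       hprob r d n (\<lambda>H.
         let k = (real (r - 1) * real d / (real r * ln (real d))) powr (1 / real (r - 1));
             a = (real r * ln (real d) / (real (r - 1) * real d)) powr (1 / real (r - 1)) * real n
         in \<bar>(real (chromatic_number {1..n} H) - k) / k\<bar> \<le> \<epsilon> \<and>
            \<bar>(real (independence_number {1..n} H) - a) / a\<bar> \<le> \<epsilon>)
       \<ge> 1 - \<delta>)"
proof -
  obtain d0 where d0: "\<forall>d\<ge>d0. \<forall>K k \<kappa>. K = (real (r - 1) * real d / (real r * ln (real d))) powr (1 / real (r - 1)) \<longrightarrow>
      k = nat \<lceil>(1 + \<epsilon> / 2) * K\<rceil> \<longrightarrow> \<kappa> = 1 / real k ^ (r - 1) \<longrightarrow>
      1 \<le> d \<and> 0 < ln (real d) \<and> 0 < K \<and> real (k + 2 * r) \<le> (1 + \<epsilon>) * K \<and> 2 * r \<le> k \<and>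
      2 + ln (1 / ((1 + \<epsilon>) / K)) \<le> real d / real r * ((1 + \<epsilon>) / K) ^ (r - 1) \<and>
      (\<exists>\<eta>>0. \<forall>y. 0 \<le> y \<longrightarrow> y \<le> (1 + \<eta>) * real k \<longrightarrow>
        real d / (real r * (1 - \<kappa>)\<^sup>2) * \<kappa>\<^sup>2 * (y ^ r - 1 - real r * (y - 1)) \<le> y * ln y - y + 1)"
    using density_parameters[OF assms] unfolding eventually_sequentially by (elim exE)
  show ?thesis
  proof (rule exI[of _ d0], intro allI impI)
    fix d :: nat and \<delta> :: real
    assume d: "d \<ge> d0" and \<delta>: "\<delta> > 0"
    define K where "K = (real (r - 1) * real d / (real r * ln (real d))) powr (1 / real (r - 1))"
    define k where "k = nat \<lceil>(1 + \<epsilon> / 2) * K\<rceil>"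
    define \<kappa> where "\<kappa> = 1 / real k ^ (r - 1)"
    note D = d0[rule_format, OF d K_def k_def \<kappa>_def]
    have d1: "1 \<le> d" and K0: "0 < K" and kK: "real (k + 2 * r) \<le> (1 + \<epsilon>) * K" and kr: "2 * r \<le> k"
      and dens: "2 + ln (1 / ((1 + \<epsilon>) / K)) \<le> real d / real r * ((1 + \<epsilon>) / K) ^ (r - 1)" using D by blast+
    obtain \<eta> where \<eta>: "\<eta> > 0" and F: "\<And>y. 0 \<le> y \<Longrightarrow> y \<le> (1 + \<eta>) * real k \<Longrightarrow>
        real d / (real r * (1 - \<kappa>)\<^sup>2) * \<kappa>\<^sup>2 * (y ^ r - 1 - real r * (y - 1)) \<le> y * ln y - y + 1" using D by blast
    have k0: "k > 0" using kr assms(1) by linarith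
    have aK: "(real r * ln (real d) / (real (r - 1) * real d)) powr (1 / real (r - 1)) = 1 / K"
    proof -
      define M where "M = real (r - 1) * real d / (real r * ln (real d))"
      have "inverse M powr q = 1 / M powr q" for q
        unfolding inverse_powr by (simp only: inverse_eq_divide)
      moreover have "real r * ln (real d) / (real (r - 1) * real d) = inverse M" unfolding M_def by simp
      ultimately show ?thesis unfolding K_def M_def[symmetric] by (simp only:)
    qed
    define \<beta> where "\<beta> = card (nonmono r k)"
    define C0 where "C0 = (exp (real k * real (r * (\<beta> + 1))) * real \<beta> ^ (d * (\<beta> + 1)))\<^sup>2"
    define E0 where "E0 = 2 * k + 2 * \<beta> + 2 * k\<^sup>2"
    define \<gamma> where "\<gamma> = 1 / (12 * real d ^ 3)"
    define Kc where "Kc = max r d"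
    define J where "J = 20 * Kc ^ 4"
    define c1 where "c1 = 1 / real (2 * (1 + 2 * ((2 * Kc) ^ 4 + J)) ^ J)"
    have "0 < 2 * (1 + 2 * ((2 * Kc) ^ 4 + J)) ^ J" by simp
    then have c1: "c1 > 0" unfolding c1_def by (simp only: zero_less_divide_1_iff of_nat_0_less_iff)
    have C0: "C0 \<ge> 0" unfolding C0_def by simp
    have \<gamma>: "\<gamma> > 0" unfolding \<gamma>_def using d1 by simp
    \<comment> \<open>The failure probability before conditioning. The polynomial of degree
      \<open>E0\<close> is the price of the second moment and is swallowed by the exponential; the
      slowest term is the last, of order \<open>1 / n\<close>.\<close>
    define b where "b n = (exp 1 * (real n * real d + 1))\<^sup>2 * exp (- ((1 + \<epsilon>) / K * real n)) +
      (C0 * ((exp 1 * (real n * real d + 1)) ^ E0 * exp (- (\<gamma>\<^sup>2 * real d / 64 * real n))) + 6 * (real d)\<^sup>2 / real n)" for n :: nat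
    have "b \<longlonglongrightarrow> 0 + (C0 * 0 + 0)"
      unfolding b_def
    proof (intro tendsto_add tendsto_mult tendsto_const poly_times_exp_tendsto_0)
      show "((\<lambda>n. 6 * (real d)\<^sup>2 / real n) \<longlongrightarrow> 0) sequentially" by real_asymp
      show "0 < (1 + \<epsilon>) / K" using assms K0 by simp
      show "0 < \<gamma>\<^sup>2 * real d / 64" using \<gamma> d1 by simp
    qed (use d1 in auto)
    then have "b \<longlonglongrightarrow> 0" by simp
    moreover have "0 < \<delta> * c1" using \<delta> c1 by simp
    ultimately have evb: "eventually (\<lambda>n. b n < \<delta> * c1) sequentially" by (rule order_tendstoD)
    have evY: "eventually (\<lambda>n. (real k)\<^sup>2 * real (r * (\<beta> + 1)) / real n < \<eta> * real k) sequentially"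
    proof -
      have "((\<lambda>n. (real k)\<^sup>2 * real (r * (\<beta> + 1)) / real n) \<longlongrightarrow> 0) sequentially" by real_asymp
      moreover have "0 < \<eta> * real k" using \<eta> k0 by simp
      ultimately show ?thesis by (rule order_tendstoD)
    qed
    \<comment> \<open>The second condition serves the switching bound; the third gives
      \<open>m \<ge> d\<close>, as required for laying out the colour words.\<close>
    have evn: "eventually (\<lambda>n::nat. 1 \<le> n \<and> 2 * ((2 * Kc) ^ 4 + J) + 6 \<le> n \<and> d * r \<le> n) sequentially"
      by (intro eventually_conj eventually_ge_at_top)
    have "eventually (\<lambda>n. r dvd n * d \<longrightarrow>
       hprob r d n (\<lambda>H.
         let k = (real (r - 1) * real d / (real r * ln (real d))) powr (1 / real (r - 1));
             a = (real r * ln (real d) / (real (r - 1) * real d)) powr (1 / real (r - 1)) * real n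
         in \<bar>(real (chromatic_number {1..n} H) - k) / k\<bar> \<le> \<epsilon> \<and>
            \<bar>(real (independence_number {1..n} H) - a) / a\<bar> \<le> \<epsilon>)
       \<ge> 1 - \<delta>) sequentially"
      using evb evY evn
    proof eventually_elim
      case (elim n)
      have n: "n > 0" using elim by simp
      show ?case
      proof
        assume dvd: "r dvd n * d"
        define m where "m = n * d div r"
        obtain vt where "config r d n m vt" using ex_config[OF assms(1) d1 dvd] unfolding m_def by blast
        then interpret config r d n m vt .
        have nd: "n \<le> n * d" using d1 by simp
        have md: "m \<ge> d"
        proof -
          have "d * r \<le> m * r" using elim nd unfolding mr by linarith
          then show ?thesis using assms(1) by simp
        qed
        \<comment> \<open>The floor plus one makes \<open>s / n\<close> at least the critical
          density \<open>(1 + \<epsilon>) / K\<close>, while an independence number below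
          \<open>s\<close> is still at most \<open>(1 + \<epsilon>) * n / K\<close>, without
          rounding loss.\<close>
        define s where "s = nat \<lfloor>(1 + \<epsilon>) / K * real n\<rfloor> + 1"
        have x0: "0 < (1 + \<epsilon>) / K" using assms K0 by simp
        have s_ge: "(1 + \<epsilon>) / K * real n \<le> real s" unfolding s_def by linarith
        have s_le: "real (s - 1) \<le> (1 + \<epsilon>) / K * real n"
        proof -
          have "0 \<le> (1 + \<epsilon>) / K * real n" by (rule mult_nonneg_nonneg[OF less_imp_le[OF x0] of_nat_0_le_iff])
          then show ?thesis unfolding s_def by simp
        qed
        have x_ge: "(1 + \<epsilon>) / K \<le> real s / real n" using s_ge n by (simp add: pos_le_divide_eq)
        have dense: "2 + ln (1 / (real s / real n)) \<le> real d / real r * (real s / real n) ^ (r - 1)"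
        proof -
          have "0 < real s / real n" using x0 x_ge by linarith
          then have "1 / (real s / real n) \<le> 1 / ((1 + \<epsilon>) / K)" "0 < 1 / (real s / real n)"
            using x_ge x0 by (auto intro!: divide_left_mono mult_pos_pos simp del: divide_divide_eq_right divide_divide_eq_left)
          then have "ln (1 / (real s / real n)) \<le> ln (1 / ((1 + \<epsilon>) / K))" by (intro ln_mono) linarith+
          moreover have "real d / real r * ((1 + \<epsilon>) / K) ^ (r - 1) \<le> real d / real r * (real s / real n) ^ (r - 1)"
            using x_ge x0 by (intro mult_left_mono power_mono) auto
          ultimately show ?thesis using dens by linarith
        qed
        have Y: "real k + (real k)\<^sup>2 * real (r * (\<beta> + 1)) / real n \<le> (1 + \<eta>) * real k"
          using elim(2) by (simp add: algebra_simps)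
        have Q: "1 \<le> (C0 * (exp 1 * (real (n * d) + 1)) ^ E0) * perm_prob ({..<m} \<times> {..<r}) (\<lambda>\<pi>. \<exists>\<sigma>\<in>{1..n} \<rightarrow>\<^sub>E {..<k}. proper_word \<sigma> \<pi>)"
          unfolding C0_def E0_def by (rule perm_prob_colorable_ge[OF n kr md \<kappa>_def F \<beta>_def Y])
        have Q0: "0 \<le> C0 * (exp 1 * (real (n * d) + 1)) ^ E0" using C0 by simp
        have ps: "perm_prob ({..<m} \<times> {..<r}) (\<lambda>\<pi>. simple r m (vt \<circ> \<pi>)) \<ge> c1"
          unfolding c1_def by (rule perm_prob_simple_ge[OF Kc_def J_def]) (use elim nd in linarith)
        have "1 - \<delta> \<le> 1 - b n / c1"
        proof -
          have "b n / c1 \<le> \<delta>" using elim(1) c1 by (simp add: pos_divide_le_eq)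
          then show ?thesis by simp
        qed
        also have "\<dots> \<le> 1 - ((exp 1 * (real (n * d) + 1))\<^sup>2 * exp (- real s) +
            (C0 * (exp 1 * (real (n * d) + 1)) ^ E0 * exp (- (\<gamma>\<^sup>2 * real (n * d) / 64)) + 6 * (real d)\<^sup>2 / real n)) / c1"
        proof -
          have "(exp 1 * (real (n * d) + 1))\<^sup>2 * exp (- real s) \<le> (exp 1 * (real (n * d) + 1))\<^sup>2 * exp (- ((1 + \<epsilon>) / K * real n))"
            using s_ge by (intro mult_left_mono) auto
          moreover have "C0 * (exp 1 * (real (n * d) + 1)) ^ E0 * exp (- (\<gamma>\<^sup>2 * real (n * d) / 64)) =
              C0 * ((exp 1 * (real n * real d + 1)) ^ E0 * exp (- (\<gamma>\<^sup>2 * real d / 64 * real n)))"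
            by (simp add: mult_ac)
          ultimately have "(exp 1 * (real (n * d) + 1))\<^sup>2 * exp (- real s) +
            (C0 * (exp 1 * (real (n * d) + 1)) ^ E0 * exp (- (\<gamma>\<^sup>2 * real (n * d) / 64)) + 6 * (real d)\<^sup>2 / real n) \<le> b n"
            unfolding b_def of_nat_mult by linarith
          then show ?thesis using c1 by (intro diff_left_mono divide_right_mono) auto
        qed
        also have "\<dots> \<le> hprob r d n (\<lambda>H. let k = K; a = 1 / K * real n in
            \<bar>(real (chromatic_number {1..n} H) - k) / k\<bar> \<le> \<epsilon> \<and> \<bar>(real (independence_number {1..n} H) - a) / a\<bar> \<le> \<epsilon>)"
        proof (rule hprob_coloring_indep_ge[OF n k0 _ c1 ps dense Q Q0 \<gamma>_def])
          show "0 < s" by (simp add: s_def)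
          fix H assume H: "chromatic_number {1..n} H \<le> k + 2 * r" "independence_number {1..n} H < s"
            "n \<le> chromatic_number {1..n} H * independence_number {1..n} H"
          have "real (chromatic_number {1..n} H) \<le> real (k + 2 * r)" using H(1) by (rule of_nat_mono)
          then have h1: "real (chromatic_number {1..n} H) \<le> (1 + \<epsilon>) * K" using kK by linarith
          have "real (independence_number {1..n} H) \<le> real (s - 1)" using H(2) by (intro of_nat_mono) simp
          then have h2: "real (independence_number {1..n} H) \<le> (1 + \<epsilon>) * (real n / K)" using s_le by (simp add: algebra_simps)
          have "real n \<le> real (chromatic_number {1..n} H * independence_number {1..n} H)" using H(3) by (rule of_nat_mono)
          then have h3: "real n \<le> real (chromatic_number {1..n} H) * real (independence_number {1..n} H)" by simp
          have e: "1 / K * real n = real n / K" by simp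
          show "let k = K; a = 1 / K * real n in
            \<bar>(real (chromatic_number {1..n} H) - k) / k\<bar> \<le> \<epsilon> \<and> \<bar>(real (independence_number {1..n} H) - a) / a\<bar> \<le> \<epsilon>"
            unfolding Let_def e using relative_error_bounds[OF n K0 assms(2) h1 _ h2 _ h3] by simp
        qed
        finally show "1 - \<delta> \<le> hprob r d n (\<lambda>H.
          let k = (real (r - 1) * real d / (real r * ln (real d))) powr (1 / real (r - 1));
             a = (real r * ln (real d) / (real (r - 1) * real d)) powr (1 / real (r - 1)) * real n
          in \<bar>(real (chromatic_number {1..n} H) - k) / k\<bar> \<le> \<epsilon> \<and>
            \<bar>(real (independence_number {1..n} H) - a) / a\<bar> \<le> \<epsilon>)"
          unfolding aK K_def[symmetric] .
      qed
    qed
    then show "\<exists>N. \<forall>n\<ge>N. r dvd n * d \<longrightarrow>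
       hprob r d n (\<lambda>H.
         let k = (real (r - 1) * real d / (real r * ln (real d))) powr (1 / real (r - 1));
             a = (real r * ln (real d) / (real (r - 1) * real d)) powr (1 / real (r - 1)) * real n
         in \<bar>(real (chromatic_number {1..n} H) - k) / k\<bar> \<le> \<epsilon> \<and>
            \<bar>(real (independence_number {1..n} H) - a) / a\<bar> \<le> \<epsilon>)
       \<ge> 1 - \<delta>" unfolding eventually_sequentially .
  qed
qed

end
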